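(* Let $q\ge 3$ be an integer and let $a_0,\dots,a_{q-1}$ be non-negative integers with $\sum_{x=0}^{q-1}a_x=q$. Let $T=\{(x,y): x=0,\dots,q-1,\ y=1,\dots,a_x\}$. Let $G=G_{n,1/2}$ and let $X_n=X_n^{(a_0,\dots,a_{q-1})}$ be the number of $q$-tuples $$(\{A_{0,1},\dots,A_{0,a_0}\},\{A_{1,1},\dots,A_{1,a_1}\},\dots,\{A_{q-1,1},\dots,A_{q-1,a_{q-1}}\})$$ (each entry an unordered, possibly empty, collection of parts) such that $V(G)=\coprod_{(x,y)\in T}A_{x,y}$ and $d_{G[A_{x,y}]}(v)\equiv x \pmod q$ for all $(x,y)\in T$ and all $v\in A_{x,y}$. For $q$ even let $c=\sum_{x=0}^{q/2-1}a_{2x}$. Then: (1) if $q\ge 3$ is odd, $X_n$ converges in distribution to $\mathrm{Po}(1/\prod_{x} a_x!)$; (2) if $q\ge 4$ is even and $c>0$, $X_n$ converges in distribution to $\mathrm{Po}(2^c/\prod_x a_x!)$; (3) if $q\ge 4$ is even and $c=0$, $X_n$ converges in distribution to $\mathrm{Po}(2/\prod_x a_x!)$ as $n$ runs over even integers.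
   Context: $G_{n,1/2}$ is the binomial random graph on vertex set $[n]$ with each edge present independently with probability $1/2$. $\mathrm{Po}(\lambda)$ is the Poisson distribution with mean $\lambda$. Two such tuples differing only by reordering parts with the same first index $x$ are the same and counted once. *)

theory Defs
  imports
    "HOL-Probability.Probability"
    "HOL-Probability.Product_PMF"
    "HOL-Number_Theory.Cong"
    "HOL-Library.Disjoint_Sets"
    "HOL-Library.Multiset"
begin

text \<open>A simple graph on \<open>{1..n}\<close> is represented by its set of edges, which are two-element
  subsets of \<open>{1..n}\<close>.\<close>

definition all_edges :: "nat \<Rightarrow> nat set set" where
  "all_edges n = {e. e \<subseteq> {1..n} \<and> card e = 2}"

definition induced_edges :: "nat set set \<Rightarrow> nat set \<Rightarrow> nat set set" where
  "induced_edges G A = {e \<in> G. e \<subseteq> A}"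

definition degree_in :: "nat set set \<Rightarrow> nat \<Rightarrow> nat" where
  "degree_in G v = card {e \<in> G. v \<in> e}"

definition random_graph :: "nat \<Rightarrow> real \<Rightarrow> nat set set pmf" where
  "random_graph n p =
     map_pmf (\<lambda>f. {e. f e}) (Pi_pmf (all_edges n) False (\<lambda>_. bernoulli_pmf p))"

definition part_indices :: "nat \<Rightarrow> (nat \<Rightarrow> nat) \<Rightarrow> (nat \<times> nat) set" where
  "part_indices q a = (SIGMA x:{0..<q}. {1..a x})"

text \<open>Individual parts may be empty, as the vertex set is only required to be the disjoint
  union of the parts.\<close>

definition valid_family ::
    "nat \<Rightarrow> (nat \<Rightarrow> nat) \<Rightarrow> nat \<Rightarrow> nat set set \<Rightarrow> (nat \<times> nat \<Rightarrow> nat set) \<Rightarrow> bool" where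
  "valid_family q a n G A \<longleftrightarrow>
     disjoint_family_on A (part_indices q a) \<and>
     (\<Union>t\<in>part_indices q a. A t) = {1..n} \<and>
     (\<forall>(x, y)\<in>part_indices q a. \<forall>v\<in>A (x, y).
        [degree_in (induced_edges G (A (x, y))) v = x] (mod q))"

text \<open>The \<open>q\<close>-tuple of unordered collections determined by a family: two families give the same
  tuple iff they differ by reordering parts with the same first index. Multisets are used because
  the empty part may be repeated.\<close>

definition tuple_of_family ::
    "nat \<Rightarrow> (nat \<Rightarrow> nat) \<Rightarrow> (nat \<times> nat \<Rightarrow> nat set) \<Rightarrow> nat set multiset list" where
  "tuple_of_family q a A = map (\<lambda>x. {#A (x, y). y \<in># mset_set {1..a x}#}) [0..<q]"

definition num_tuples :: "nat \<Rightarrow> (nat \<Rightarrow> nat) \<Rightarrow> nat \<Rightarrow> nat set set \<Rightarrow> nat" where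
  "num_tuples q a n G = card {tuple_of_family q a A |A. valid_family q a n G A}"

definition X_law :: "nat \<Rightarrow> (nat \<Rightarrow> nat) \<Rightarrow> nat \<Rightarrow> real measure" where
  "X_law q a n =
     distr (measure_pmf (random_graph n (1/2))) borel (\<lambda>G. real (num_tuples q a n G))"

definition poisson_law :: "real \<Rightarrow> real measure" where
  "poisson_law rate = distr (measure_pmf (poisson_pmf rate)) borel real"

end

(* Method of moments. Expanding the congruences in characters of Z/q and averaging over the edges,
   the r-th joint moment becomes q^(-rn) times the partition function of a dense spin system: every
   vertex carries a type (f, alpha) in [q]^r x (Z/q)^r, and a pair of vertices has weight 1 if
   sum_{i : f_i = f'_i} (alpha_i + alpha'_i) = 0 mod q, and modulus bounded away from 1 otherwise.
   The system therefore concentrates on maximal cliques of pairwise compatible types.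

   Let F be the set of labels f of a clique S. Writing down f_i at the levels where the trie of F
   branches at f, and alpha_i at the other levels, is an injection S -> [q]^r, because the
   disagreement sets at the branching levels determine the remaining alpha_i by back substitution.
   Hence |S| <= q^r. If equality holds and q >= 3, then either F = [q]^r and alpha_i is a function of
   f_i with 2 alpha_i = 0, or two coordinates of f are related by a permutation of [q] throughout S.
   The second case means that two of the r partitions coincide up to relabelling, so only the first
   contributes to factorial moments, and its phases multiply to the r-th power of the mean. *)
theory Submission
  imports
    Defs
    "HOL-Real_Asymp.Real_Asymp"
begin

section \<open>Maximal cliques of vertex types\<close>

text \<open>The normalisation \<open>q^(-rn)\<close> is cancelled exactly by the
  \<open>(q^r)^n\<close> configurations supported on one clique of size \<open>q^r\<close>, each of
  modulus 1; everything hinges on the excited ones summing to \<open>o(q^(rn))\<close>, although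
  there are \<open>q^(2rn)\<close> configurations in all. The surviving phases with
  \<open>2 \<alpha> = 0\<close> express the handshake lemma: for even \<open>q\<close> the phase
  \<open>q/2\<close> on a part with residue \<open>x\<close> carries the sign
  \<open>(-1)^(x * size)\<close>, so summing over these phases tests whether every part of odd
  residue has even size. With \<open>c\<close> parts of even residue, \<open>2^q\<close> phases and
  \<open>q - c\<close> parities, each satisfied with probability about 1/2, give \<open>2^c\<close>.
  If \<open>c = 0\<close>, the last parity is that of \<open>n\<close>: this leaves 2 for even
  \<open>n\<close>, and no tuples at all for odd \<open>n\<close>. Empty parts make the number of
  labellings of a tuple irregular. Moments are therefore taken only of the tuples without empty
  parts, and the others are shown to be asymptotically improbable.\<close>

type_synonym vertex_type = "(nat \<Rightarrow> nat) \<times> (nat \<Rightarrow> nat)"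

text \<open>Exponent of the root of unity that an edge contributes: in every partition where its
  ends share a part, the edge raises both of their degrees.\<close>

definition agreement_sum :: "nat \<Rightarrow> vertex_type \<Rightarrow> vertex_type \<Rightarrow> nat" where
  "agreement_sum r s t = (\<Sum>i<r. if fst s i = fst t i then snd s i + snd t i else 0)"

definition vertex_types :: "nat \<Rightarrow> nat \<Rightarrow> vertex_type set" where
  "vertex_types q r = (\<Pi>\<^sub>E i\<in>{..<r}. {..<q}) \<times> (\<Pi>\<^sub>E i\<in>{..<r}. {..<q})"

text \<open>What remains of compatibility after comparing two types with equal labels against a
  third: the phase of the third cancels. Being weaker than the clique condition, it survives the
  addition of a type that may be incompatible with itself.\<close>

definition coherent :: "nat \<Rightarrow> nat \<Rightarrow> vertex_type set \<Rightarrow> bool" where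
  "coherent q r S \<longleftrightarrow> (\<forall>s\<in>S. \<forall>s'\<in>S. \<forall>t\<in>S. fst s = fst s' \<longrightarrow>
     int q dvd (\<Sum>i<r. if fst s i = fst t i then int (snd s i) - int (snd s' i) else 0))"

definition branches :: "(nat \<Rightarrow> nat) set \<Rightarrow> (nat \<Rightarrow> nat) \<Rightarrow> nat \<Rightarrow> bool" where
  "branches F f i \<longleftrightarrow> (\<exists>f'\<in>F. (\<forall>j<i. f' j = f j) \<and> f' i \<noteq> f i)"

definition trie_code :: "nat \<Rightarrow> (nat \<Rightarrow> nat) set \<Rightarrow> vertex_type \<Rightarrow> nat \<Rightarrow> nat" where
  "trie_code r F s = (\<lambda>i\<in>{..<r}. if branches F (fst s) i then fst s i else snd s i)"

lemma finite_vertex_types: "finite (vertex_types q r)"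
  unfolding vertex_types_def by (intro finite_cartesian_product finite_PiE) auto

lemma vertex_typesD:
  assumes "s \<in> vertex_types q r" "i < r"
  shows "fst s i < q" "snd s i < q"
  using assms unfolding vertex_types_def mem_Times_iff by (blast dest: PiE_mem)+

lemma vertex_types_ext:
  assumes "s \<in> vertex_types q r"
  shows "fst s \<in> extensional {..<r}" "snd s \<in> extensional {..<r}"
  using assms unfolding vertex_types_def mem_Times_iff PiE_def by blast+

lemma vertex_types_eqI:
  assumes "s \<in> vertex_types q r" "t \<in> vertex_types q r"
    and "\<And>i. i < r \<Longrightarrow> fst s i = fst t i" "\<And>i. i < r \<Longrightarrow> snd s i = snd t i"
  shows "s = t"
  using assms(3,4) vertex_types_ext[OF assms(1)] vertex_types_ext[OF assms(2)]
  by (intro prod_eqI extensionalityI[of _ "{..<r}"]) auto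

section \<open>Injectivity of the trie code\<close>

lemma branches_cong:
  assumes "\<And>j. j \<le> i \<Longrightarrow> f j = f' j"
  shows "branches F f i \<longleftrightarrow> branches F f' i"
  using assms unfolding branches_def by auto

text \<open>At a first disagreement each of the two words witnesses that the other branches, so the
  hypothesis excludes it.\<close>

lemma trie_walk:
  assumes "f \<in> F" "f' \<in> F"
    and "\<And>i. i < r \<Longrightarrow> branches F f i \<Longrightarrow> branches F f' i \<Longrightarrow> f i = f' i"
  shows "i < r \<Longrightarrow> f i = f' i"
proof (induction i rule: less_induct)
  case (less i)
  then have agree: "\<forall>j<i. f j = f' j" by auto
  show ?case
  proof (rule ccontr)
    assume ne: "f i \<noteq> f' i"
    have "branches F f i" unfolding branches_def using agree ne assms(2) by (intro bexI[of _ f']) auto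
    moreover have "branches F f' i" unfolding branches_def using agree ne assms(1) by (intro bexI[of _ f]) auto
    ultimately show False using assms(3) less.prems ne by blast
  qed
qed

lemma eq_of_int_dvd:
  assumes "int q dvd int a - int b" "a < q" "b < q"
  shows "a = b"
  using assms by (metis cong_iff_dvd_diff cong_int_iff cong_less_modulus_unique_nat)

text \<open>Taking \<open>t = s\<close> shows that the differences over all coordinates sum to 0
  modulo \<open>q\<close>. Subtracting turns agreement sets into disagreement sets, which are the
  ones that start at a branching level.\<close>

lemma coherent_disagreement:
  assumes "coherent q r S" "s \<in> S" "s' \<in> S" "t \<in> S" "fst s = fst s'"
  shows "int q dvd (\<Sum>i<r. if fst s i \<noteq> fst t i then int (snd s i) - int (snd s' i) else 0)"
proof -
  have "int q dvd (\<Sum>i<r. if fst s i = fst t i then int (snd s i) - int (snd s' i) else 0)"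
    using assms unfolding coherent_def by blast
  moreover have "int q dvd (\<Sum>i<r. int (snd s i) - int (snd s' i))"
    using assms(1)[unfolded coherent_def, rule_format, OF assms(2,3,2,5)] by simp
  moreover have "(\<Sum>i<r. int (snd s i) - int (snd s' i)) =
      (\<Sum>i<r. if fst s i = fst t i then int (snd s i) - int (snd s' i) else 0) +
      (\<Sum>i<r. if fst s i \<noteq> fst t i then int (snd s i) - int (snd s' i) else 0)"
    unfolding sum.distrib[symmetric] by (rule sum.cong) auto
  ultimately show ?thesis by (simp only: dvd_add_right_iff)
qed

text \<open>The disagreement sets belonging to the branching levels of \<open>f\<close> have distinct least elements,
  so the relations they impose form a triangular system.\<close>

lemma coherent_back_substitution:
  assumes coh: "coherent q r S" and S: "S \<subseteq> vertex_types q r"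
    and s: "s \<in> S" "s' \<in> S" "fst s = fst s'"
    and eq: "\<And>i. m \<le> i \<Longrightarrow> i < r \<Longrightarrow> \<not> branches (fst ` S) (fst s) i \<Longrightarrow> snd s i = snd s' i"
  shows "i < r \<Longrightarrow> m \<le> i \<Longrightarrow> snd s i = snd s' i"
proof (induction "r - i" arbitrary: i rule: less_induct)
  case less
  have above: "snd s j = snd s' j" if "i < j" "j < r" for j
    using less.hyps[of j] less.prems that by auto
  show ?case
  proof (cases "branches (fst ` S) (fst s) i")
    case False
    then show ?thesis using eq less.prems by auto
  next
    case True
    then obtain t where t: "t \<in> S" "\<forall>j<i. fst t j = fst s j" "fst t i \<noteq> fst s i"
      unfolding branches_def by auto
    have "(\<Sum>j<r. if fst s j \<noteq> fst t j then int (snd s j) - int (snd s' j) else 0) =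
          (\<Sum>j<r. if j = i then int (snd s j) - int (snd s' j) else 0)"
    proof (rule sum.cong)
      fix j assume "j \<in> {..<r}"
      then show "(if fst s j \<noteq> fst t j then int (snd s j) - int (snd s' j) else 0) =
          (if j = i then int (snd s j) - int (snd s' j) else 0)"
        using t above[of j] by (cases j i rule: linorder_cases) auto
    qed simp
    also have "\<dots> = int (snd s i) - int (snd s' i)" using less.prems by (simp add: sum.delta)
    finally have "int q dvd int (snd s i) - int (snd s' i)"
      using coherent_disagreement[OF coh s(1,2) t(1) s(3)] by simp
    then show ?thesis
      using vertex_typesD(2)[OF subsetD[OF S]] s(1,2) less.prems(1)
      by (intro eq_of_int_dvd) assumption+
  qed
qed

lemma trie_code_inj:
  assumes coh: "coherent q r S" and S: "S \<subseteq> vertex_types q r"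
  shows "inj_on (trie_code r (fst ` S)) S"
proof (rule inj_onI)
  fix s s' assume s: "s \<in> S" "s' \<in> S" and eq: "trie_code r (fst ` S) s = trie_code r (fst ` S) s'"
  have code: "(if branches (fst ` S) (fst s) i then fst s i else snd s i) =
      (if branches (fst ` S) (fst s') i then fst s' i else snd s' i)" if "i < r" for i
    using fun_cong[OF eq, of i] that unfolding trie_code_def by auto
  have "fst s i = fst s' i" if "i < r" for i
    by (rule trie_walk[of "fst s" "fst ` S" "fst s'" r]) (use s that in \<open>auto dest!: code\<close>)
  moreover have ext: "fst s \<in> extensional {..<r}" "fst s' \<in> extensional {..<r}"
    using s S vertex_types_ext by blast+
  ultimately have f: "fst s = fst s'" by (intro extensionalityI[OF ext]) auto
  have off: "snd s i = snd s' i" if "i < r" "\<not> branches (fst ` S) (fst s) i" for i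
    using code[OF that(1)] that(2) f by simp
  have pos: "snd s i = snd s' i" if "i < r" for i
    by (rule coherent_back_substitution[OF coh S s f, of 0]) (use off that in auto)
  show "s = s'"
    by (rule vertex_types_eqI[of _ q r]) (use s S f pos in auto)
qed

lemma trie_code_range:
  assumes "S \<subseteq> vertex_types q r"
  shows "trie_code r F ` S \<subseteq> (\<Pi>\<^sub>E i\<in>{..<r}. {..<q})"
  unfolding trie_code_def restrict_PiE_iff image_subset_iff
  using vertex_typesD[OF subsetD[OF assms]] by (simp del: split_paired_All)

lemma coherent_card_le:
  assumes "coherent q r S" "S \<subseteq> vertex_types q r"
  shows "card S \<le> q ^ r"
  using card_inj_on_le[OF trie_code_inj[OF assms] trie_code_range[OF assms(2)]]
  by (simp add: card_PiE finite_PiE)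

section \<open>Compatible types and the clique bound\<close>

definition compatible :: "nat \<Rightarrow> nat \<Rightarrow> vertex_type \<Rightarrow> vertex_type \<Rightarrow> bool" where
  "compatible q r s t \<longleftrightarrow> q dvd agreement_sum r s t"

lemma agreement_sum_commute: "agreement_sum r s t = agreement_sum r t s"
  unfolding agreement_sum_def by (intro sum.cong) auto

lemma compatible_commute: "compatible q r s t \<longleftrightarrow> compatible q r t s"
  unfolding compatible_def by (simp add: agreement_sum_commute)

lemma compatible_diff:
  assumes "compatible q r s t'" "compatible q r s' t'" "fst s = fst s'" "fst t' = fst t"
  shows "int q dvd (\<Sum>i<r. if fst s i = fst t i then int (snd s i) - int (snd s' i) else 0)"
proof -
  have "int q dvd int (agreement_sum r s t') - int (agreement_sum r s' t')"
    using assms(1,2) unfolding compatible_def by (intro dvd_diff) auto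
  also have "\<dots> = (\<Sum>i<r. if fst s i = fst t i then int (snd s i) - int (snd s' i) else 0)"
    unfolding agreement_sum_def of_nat_sum sum_subtractf[symmetric]
    using assms(3,4) by (intro sum.cong) auto
  finally show ?thesis .
qed

text \<open>As \<open>x\<close> may be incompatible with itself, the delicate case is
  \<open>t = x\<close> with \<open>x\<close> also among \<open>s\<close>, \<open>s'\<close>. The
  tested sum sees only the label of \<open>t\<close>, so the other one of \<open>s\<close>,
  \<open>s'\<close> can replace \<open>t\<close>: it has the same label and is compatible with
  both.\<close>

lemma clique_insert_coherent:
  assumes clique: "\<And>s t. s \<in> S \<Longrightarrow> t \<in> S \<Longrightarrow> compatible q r s t"
    and x: "\<And>s. s \<in> S \<Longrightarrow> compatible q r x s"
  shows "coherent q r (insert x S)"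
  unfolding coherent_def
proof (intro ballI impI)
  fix s s' t assume s: "s \<in> insert x S" "s' \<in> insert x S" "t \<in> insert x S" "fst s = fst s'"
  show "int q dvd (\<Sum>i<r. if fst s i = fst t i then int (snd s i) - int (snd s' i) else 0)"
  proof (cases "s = s'")
    case True
    then show ?thesis by (simp cong: if_cong)
  next
    case False
    have "\<exists>t'. fst t' = fst t \<and> compatible q r s t' \<and> compatible q r s' t'"
    proof (cases "t \<in> S")
      case True
      then show ?thesis using clique x s by blast
    next
      case t: False
      then have "t = x" using s by auto
      show ?thesis
      proof (cases "s \<in> S \<and> s' \<in> S")
        case True
        then show ?thesis using x compatible_commute \<open>t = x\<close> by blast
      next
        case mixed: False
        then consider "s = x" "s' \<in> S" | "s' = x" "s \<in> S" using False s by blast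
        then show ?thesis
        proof cases
          case 1
          then show ?thesis using clique x s \<open>t = x\<close> by (intro exI[of _ s']) auto
        next
          case 2
          then show ?thesis using clique x s \<open>t = x\<close> by (intro exI[of _ s]) auto
        qed
      qed
    qed
    then show ?thesis using compatible_diff s(4) by blast
  qed
qed

lemma clique_coherent:
  assumes "\<And>s t. s \<in> S \<Longrightarrow> t \<in> S \<Longrightarrow> compatible q r s t"
  shows "coherent q r S"
proof (cases "S = {}")
  case False
  then obtain x where "x \<in> S" by blast
  then show ?thesis using clique_insert_coherent[of S q r x] assms by (simp add: insert_absorb)
qed (simp add: coherent_def)

lemma clique_card_le:
  assumes "\<And>s t. s \<in> S \<Longrightarrow> t \<in> S \<Longrightarrow> compatible q r s t" "S \<subseteq> vertex_types q r"
  shows "card S \<le> q ^ r"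
  using coherent_card_le clique_coherent assms by blast

text \<open>\<open>insert x S\<close> need not be a clique, but it is coherent and so obeys the same
  bound. Consequently a type outside a clique of size \<open>q ^ r\<close> is incompatible with some
  member of it.\<close>

lemma extendable_clique_card_less:
  assumes "\<And>s t. s \<in> S \<Longrightarrow> t \<in> S \<Longrightarrow> compatible q r s t" "S \<subseteq> vertex_types q r"
    and "\<And>s. s \<in> S \<Longrightarrow> compatible q r x s" "x \<in> vertex_types q r" "x \<notin> S"
  shows "card S < q ^ r"
proof -
  have "card (insert x S) \<le> q ^ r"
    using assms by (intro coherent_card_le clique_insert_coherent) auto
  moreover have "finite S" using assms(2) finite_vertex_types finite_subset by blast
  ultimately show ?thesis using assms(5) by simp
qed

section \<open>Cliques of maximal size\<close>

lemma trie_code_surj: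
  assumes coh: "coherent q r S" and S: "S \<subseteq> vertex_types q r" and card: "card S = q ^ r"
  shows "trie_code r (fst ` S) ` S = (\<Pi>\<^sub>E i\<in>{..<r}. {..<q})"
proof (rule card_subset_eq)
  show "card (trie_code r (fst ` S) ` S) = card (\<Pi>\<^sub>E i\<in>{..<r}. {..<q})"
    using card_image[OF trie_code_inj[OF coh S]] card by (simp add: card_PiE)
qed (use trie_code_range[OF S] in \<open>auto intro: finite_PiE\<close>)

text \<open>With all words realised as codes, the code of \<open>f\<close> may be altered at the
  single place \<open>i\<close>. The owner of the altered code shares the first \<open>i\<close>
  letters with \<open>f\<close> and also branches at level \<open>i\<close>, so the new letter
  \<open>c\<close> belongs to its label.\<close>

lemma full_branching:
  assumes coh: "coherent q r S" and S: "S \<subseteq> vertex_types q r" and card: "card S = q ^ r"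
    and f: "f \<in> fst ` S" "i < r" "branches (fst ` S) f i" "c < q"
  shows "\<exists>f'\<in>fst ` S. (\<forall>j<i. f' j = f j) \<and> f' i = c"
proof -
  obtain s where s: "s \<in> S" "f = fst s" using f by auto
  define g where "g = (trie_code r (fst ` S) s)(i := c)"
  have "trie_code r (fst ` S) s \<in> (\<Pi>\<^sub>E i\<in>{..<r}. {..<q})"
    using trie_code_range[OF S] s(1) by blast
  then have "g \<in> (\<Pi>\<^sub>E i\<in>{..<r}. {..<q})"
    using f(2,4) unfolding g_def by (auto simp: PiE_iff extensional_def)
  then obtain s' where s': "s' \<in> S" "trie_code r (fst ` S) s' = g"
    using trie_code_surj[OF coh S card] by (metis imageE)
  have code: "(if branches (fst ` S) (fst s') j then fst s' j else snd s' j) =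
      (if branches (fst ` S) (fst s) j then fst s j else snd s j)" if "j < i" for j
    using fun_cong[OF s'(2), of j] that f(2) unfolding g_def trie_code_def by auto
  have pre: "fst s' j = fst s j" if "j < i" for j
    by (rule trie_walk[of "fst s'" "fst ` S" "fst s" i]) (use s s' that in \<open>auto dest!: code\<close>)
  \<comment> \<open>Either the two labels agree through level \<open>i\<close> and the branching is
    inherited, or \<open>s\<close> itself is the witness.\<close>
  have "branches (fst ` S) (fst s') i"
  proof (cases "fst s' i = fst s i")
    case True
    then show ?thesis
      using f(3) pre branches_cong[of i "fst s" "fst s'" "fst ` S"] unfolding s(2) by (metis le_less)
  next
    case False
    then show ?thesis
      unfolding branches_def using s(1) pre by (intro bexI[of _ "fst s"]) auto
  qed
  then have "fst s' i = c"
    using fun_cong[OF s'(2), of i] f(2) unfolding g_def trie_code_def by auto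
  then show ?thesis using pre s' s by blast
qed

text \<open>The word that reads \<open>f\<close> at its branching levels and \<open>\<gamma>\<close>
  elsewhere is a code, and walking down the trie shows that its owner has label
  \<open>f\<close>.\<close>

lemma free_coordinates:
  assumes coh: "coherent q r S" and S: "S \<subseteq> vertex_types q r" and card: "card S = q ^ r"
    and f: "f \<in> fst ` S" and \<gamma>: "\<And>i. i < r \<Longrightarrow> \<gamma> i < q"
  shows "\<exists>s\<in>S. fst s = f \<and> (\<forall>i<r. \<not> branches (fst ` S) f i \<longrightarrow> snd s i = \<gamma> i)"
proof -
  obtain s0 where s0: "s0 \<in> S" "f = fst s0" using f by auto
  define g where "g = (\<lambda>i\<in>{..<r}. if branches (fst ` S) f i then f i else \<gamma> i)"
  have "g \<in> (\<Pi>\<^sub>E i\<in>{..<r}. {..<q})"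
    using vertex_typesD(1)[OF subsetD[OF S s0(1)]] \<gamma> unfolding g_def restrict_PiE_iff s0(2) by auto
  then obtain s where s: "s \<in> S" "trie_code r (fst ` S) s = g"
    using trie_code_surj[OF coh S card] by (metis imageE)
  have code: "(if branches (fst ` S) (fst s) j then fst s j else snd s j) =
      (if branches (fst ` S) f j then f j else \<gamma> j)" if "j < r" for j
    using fun_cong[OF s(2), of j] that unfolding g_def trie_code_def by auto
  have pre: "fst s j = f j" if "j < r" for j
    by (rule trie_walk[of "fst s" "fst ` S" f r]) (use f s that in \<open>auto dest!: code\<close>)
  then have eq: "fst s = f"
    using vertex_types_ext(1)[OF subsetD[OF S s(1)]] vertex_types_ext(1)[OF subsetD[OF S s0(1)]] s0(2)
    by (intro extensionalityI[of _ "{..<r}"]) auto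
  then show ?thesis using code s(1) by (metis (full_types))
qed

lemma prefixes_full:
  assumes coh: "coherent q r S" and S: "S \<subseteq> vertex_types q r" and card: "card S = q ^ r"
    and q: "q > 0"
    and br: "\<And>f l. f \<in> fst ` S \<Longrightarrow> l < i \<Longrightarrow> branches (fst ` S) f l"
    and i: "i \<le> r" and p: "\<And>l. l < i \<Longrightarrow> p l < q"
  shows "\<exists>f\<in>fst ` S. \<forall>l<i. f l = p l"
proof -
  have "m \<le> i \<Longrightarrow> \<exists>f\<in>fst ` S. \<forall>l<m. f l = p l" for m
  proof (induction m)
    case 0
    have "card S > 0" using card q by simp
    then have "S \<noteq> {}" by (metis card.empty less_irrefl)
    then show ?case by auto
  next
    case (Suc m)
    then obtain f where f: "f \<in> fst ` S" "\<forall>l<m. f l = p l" by auto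
    have "m < i" using Suc.prems by simp
    then obtain f' where "f' \<in> fst ` S" "\<forall>j<m. f' j = f j" "f' m = p m"
      using full_branching[OF coh S card f(1), of m "p m"] br[OF f(1)] p i by fastforce
    then show ?case using f(2) by (intro bexI[of _ f']) (auto simp: less_Suc_eq)
  qed
  then show ?thesis by blast
qed

text \<open>Take two members with label \<open>f\<close> whose free phases differ only at
  \<open>i\<close>, and let \<open>d\<close> be their difference. All prefixes below
  \<open>i\<close> occur, so every set of lower levels is a disagreement set, and every subset sum
  of \<open>d\<close> below \<open>i\<close> is 0 or -1 modulo \<open>q\<close>. For
  \<open>q \<ge> 3\<close> exactly one entry \<open>d j\<close> is then -1 and the others vanish, so
  the divisibility of disagreement sums ties level \<open>i\<close> to level
  \<open>j\<close>.\<close>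

lemma nonbranching_level:
  assumes coh: "coherent q r S" and S: "S \<subseteq> vertex_types q r" and card: "card S = q ^ r"
    and q: "q \<ge> 3"
    and br: "\<And>f l. f \<in> fst ` S \<Longrightarrow> l < i \<Longrightarrow> branches (fst ` S) f l"
    and i: "i < r" and f: "f \<in> fst ` S" "\<not> branches (fst ` S) f i"
  shows "\<exists>j<i. \<forall>f'\<in>fst ` S. f' i = f i \<longleftrightarrow> f' j = f j"
proof -
  let ?F = "fst ` S"
  obtain s where s: "s \<in> S" "fst s = f" "\<And>l. l < r \<Longrightarrow> \<not> branches ?F f l \<Longrightarrow> snd s l = 0"
    using free_coordinates[OF coh S card f(1), of "\<lambda>_. 0"] q by auto
  obtain s' where s': "s' \<in> S" "fst s' = f"
      "\<And>l. l < r \<Longrightarrow> \<not> branches ?F f l \<Longrightarrow> snd s' l = (if l = i then 1 else 0)"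
  proof -
    have "(if l = i then 1 else 0) < q" for l using q by auto
    from free_coordinates[OF coh S card f(1), of "\<lambda>l. if l = i then 1 else 0", OF this]
    obtain u where "u \<in> S" "fst u = f"
        "\<forall>l<r. \<not> branches ?F f l \<longrightarrow> snd u l = (if l = i then 1 else 0)"
      by (elim bexE conjE)
    then show ?thesis by (intro that[of u]) simp_all
  qed
  define d where "d l = int (snd s' l) - int (snd s l)" for l
  have di: "d i = 1" using s(3) s'(3) i f(2) unfolding d_def by simp
  \<comment> \<open>Back substitution starts at \<open>Suc i\<close>, since the two phases are made
    to differ at level \<open>i\<close>.\<close>
  have dabove: "d l = 0" if "i < l" "l < r" for l
  proof -
    have "snd s' l = snd s l"
      by (rule coherent_back_substitution[OF coh S s'(1) s(1), of "Suc i"]) (use s s' that in auto)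
    then show ?thesis unfolding d_def by simp
  qed
  have cut: "(\<Sum>l<r. if P l then d l else 0) = (\<Sum>l\<in>{l. l < i \<and> P l}. d l) + (if P i then 1 else 0)" for P
  proof -
    have "(\<Sum>l<r. if P l then d l else 0) = (\<Sum>l<Suc i. if P l then d l else 0)"
      by (rule sum.mono_neutral_right) (use i dabove in auto)
    also have "\<dots> = (\<Sum>l<i. if P l then d l else 0) + (if P i then 1 else 0)"
      using di by simp
    also have "(\<Sum>l<i. if P l then d l else 0) = (\<Sum>l\<in>{l. l < i \<and> P l}. d l)"
      by (subst sum.inter_filter[symmetric]) auto
    finally show ?thesis .
  qed
  have dis: "int q dvd (\<Sum>l\<in>{l. l < i \<and> f l \<noteq> f' l}. d l) + (if f i \<noteq> f' i then 1 else 0)"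
    if f': "f' \<in> ?F" for f'
  proof -
    obtain t where "t \<in> S" "fst t = f'" using f' by blast
    then show ?thesis
      using coherent_disagreement[OF coh s'(1) s(1), of t] s(2) s'(2) cut[of "\<lambda>l. f l \<noteq> f' l"]
      unfolding d_def by simp
  qed
  have total: "int q dvd (\<Sum>l<i. d l) + 1"
  proof -
    have "int q dvd (\<Sum>l<r. if fst s' l = fst s l then d l else 0)"
      using coh[unfolded coherent_def, rule_format, OF s'(1) s(1) s(1)] s(2) s'(2) unfolding d_def by simp
    moreover have "{l. l < i} = {..<i}" by auto
    ultimately show ?thesis using cut[of "\<lambda>_. True"] s(2) s'(2) by simp
  qed
  have subset: "int q dvd (\<Sum>l\<in>L. d l) \<or> int q dvd (\<Sum>l\<in>L. d l) + 1" if L: "L \<subseteq> {..<i}" for L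
  proof -
    \<comment> \<open>\<open>p\<close> leaves \<open>f\<close> exactly on \<open>L\<close>, so a
      label with this prefix has disagreement set \<open>L\<close> below \<open>i\<close>.\<close>
    define p where "p l = (if l \<in> L then (if f l = 0 then 1 else 0) else f l)" for l
    have fq: "f l < q" if "l < r" for l
      using vertex_typesD(1)[OF subsetD[OF S s(1)]] s(2) that by simp
    obtain f' where f': "f' \<in> ?F" "\<forall>l<i. f' l = p l"
    proof -
      have p: "p l < q" if "l < i" for l using fq[of l] q i that unfolding p_def by auto
      have "\<exists>f'\<in>?F. \<forall>l<i. f' l = p l"
        by (rule prefixes_full[OF coh S card]) (use q br i p in auto)
      then show ?thesis using that by blast
    qed
    have "{l. l < i \<and> f l \<noteq> f' l} = L"
      using f'(2) L unfolding p_def by (auto split: if_splits)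
    then show ?thesis using dis[OF f'(1)] by (auto split: if_splits)
  qed
  \<comment> \<open>Here \<open>q \<ge> 3\<close> enters: two entries equal to -1 would sum to -2,
    which is neither 0 nor -1 modulo \<open>q\<close>.\<close>
  have not1: "\<not> int q dvd 1" "\<not> int q dvd 2"
    using q by (auto dest!: zdvd_imp_le)
  have "\<exists>j<i. \<not> int q dvd d j"
  proof (rule ccontr)
    assume "\<not> ?thesis"
    then have "int q dvd (\<Sum>l<i. d l)" by (intro dvd_sum) auto
    then show False using total not1 dvd_add_right_iff by blast
  qed
  then obtain j where j: "j < i" "\<not> int q dvd d j" by blast
  have dj: "int q dvd d j + 1" using subset[of "{j}"] j by auto
  have others: "int q dvd d l" if "l < i" "l \<noteq> j" for l
  proof (rule ccontr)
    assume l: "\<not> int q dvd d l"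
    then have dl: "int q dvd d l + 1" using subset[of "{l}"] that by auto
    have "int q dvd d l + d j \<or> int q dvd d l + d j + 1"
      using subset[of "{l, j}"] j that by auto
    then have "int q dvd (d l + 1 + (d j + 1)) - (d l + d j) \<or>
        int q dvd (d l + 1 + (d j + 1)) - (d l + d j + 1)"
      using dj dl by (meson dvd_add dvd_diff)
    then show False using not1 by auto
  qed
  have "f' i = f i \<longleftrightarrow> f' j = f j" if f': "f' \<in> ?F" for f'
  proof -
    have "(\<Sum>l\<in>{l. l < i \<and> f l \<noteq> f' l}. d l) =
        (\<Sum>l\<in>{l. l < i \<and> f l \<noteq> f' l} - {j}. d l) + (if f j \<noteq> f' j then d j else 0)"
      using j(1) by (auto simp: sum.remove)
    moreover have "int q dvd (\<Sum>l\<in>{l. l < i \<and> f l \<noteq> f' l} - {j}. d l)"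
      by (intro dvd_sum) (use others in auto)
    ultimately have "int q dvd (if f j \<noteq> f' j then d j else 0) + (if f i \<noteq> f' i then 1 else 0)"
      using dis[OF f'] by (simp add: add.assoc dvd_add_right_iff)
    then show ?thesis using j(2) not1 by (auto split: if_splits)
  qed
  then show ?thesis using j(1) by blast
qed

text \<open>Look at the least level \<open>i\<close> where some label fails to branch. If there is
  none, every prefix extends and all labels occur. Otherwise the level \<open>j < i\<close> supplied
  by \<open>nonbranching_level\<close> turns out to be the same for all labels, so coordinates
  \<open>i\<close> and \<open>j\<close> determine each other.\<close>

lemma maximal_clique_structure:
  assumes clique: "\<And>s t. s \<in> S \<Longrightarrow> t \<in> S \<Longrightarrow> compatible q r s t"
    and S: "S \<subseteq> vertex_types q r" and card: "card S = q ^ r" and q: "q \<ge> 3"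
  shows "(\<forall>p. (\<forall>i<r. p i < q) \<longrightarrow> (\<exists>s\<in>S. \<forall>i<r. fst s i = p i)) \<or>
    (\<exists>i<r. \<exists>j<r. i \<noteq> j \<and> (\<exists>\<pi>. bij_betw \<pi> {..<q} {..<q} \<and> (\<forall>s\<in>S. fst s i = \<pi> (fst s j))))"
proof -
  let ?F = "fst ` S"
  let ?P = "\<lambda>i. i < r \<and> (\<exists>f\<in>?F. \<not> branches ?F f i)"
  have coh: "coherent q r S" using clique by (rule clique_coherent)
  have q0: "q > 0" using q by simp
  have fq: "f l < q" if "f \<in> ?F" "l < r" for f l
    using vertex_typesD(1)[OF subsetD[OF S]] that by auto
  show ?thesis
  proof (cases "\<exists>i. ?P i")
    case False
    have "\<exists>s\<in>S. \<forall>i<r. fst s i = p i" if p: "\<forall>i<r. p i < q" for p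
    proof -
      have "\<exists>f\<in>?F. \<forall>i<r. f i = p i"
        by (rule prefixes_full[OF coh S card q0]) (use False p in auto)
      then show ?thesis by blast
    qed
    then show ?thesis by blast
  next
    case True
    define i where "i = (LEAST i. ?P i)"
    have Pi: "?P i" unfolding i_def by (rule LeastI_ex[OF True])
    then have ir: "i < r" by simp
    have br: "branches ?F f l" if "f \<in> ?F" "l < i" for f l
      using not_less_Least[of l ?P] that ir unfolding i_def[symmetric] by auto
    have single: "\<exists>j<i. \<forall>f'\<in>?F. f' i = f i \<longleftrightarrow> f' j = f j"
      if "f \<in> ?F" "\<not> branches ?F f i" for f
      by (rule nonbranching_level[OF coh S card q]) (use br ir that in auto)
    have prefix: "\<exists>f\<in>?F. \<forall>l<i. f l = p l" if "\<And>l. l < i \<Longrightarrow> p l < q" for p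
      by (rule prefixes_full[OF coh S card q0]) (use br ir that in auto)
    obtain f0 where f0: "f0 \<in> ?F" "\<not> branches ?F f0 i" using Pi by blast
    obtain j where j: "j < i" "\<And>f'. f' \<in> ?F \<Longrightarrow> f' i = f0 i \<longleftrightarrow> f' j = f0 j"
      using single[OF f0] by blast
    \<comment> \<open>Branching at \<open>i\<close> would allow the letter at \<open>i\<close> to
      change while the letter at \<open>j < i\<close> stays, which contradicts the equivalence found
      for \<open>f0\<close>.\<close>
    have nonbr: "\<not> branches ?F f i" if f: "f \<in> ?F" for f
    proof
      assume b: "branches ?F f i"
      then obtain f' where f': "f' \<in> ?F" "\<forall>j<i. f' j = f j" "f' i \<noteq> f i"
        unfolding branches_def by blast
      show False
      proof (cases "f j = f0 j")
        case True
        then show False using j f f' by metis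
      next
        case False
        obtain f1 where "f1 \<in> ?F" "\<forall>j<i. f1 j = f j" "f1 i = f0 i"
          using full_branching[OF coh S card f ir b fq[OF f0(1) ir]] by blast
        then show False using j False by metis
      qed
    qed
    have sep: "f' i = f i \<longleftrightarrow> f' j = f j" if f: "f \<in> ?F" "f' \<in> ?F" for f f'
    proof (cases "f i = f0 i")
      case True
      then show ?thesis using j f by metis
    next
      case False
      obtain l where l: "l < i" "\<And>f'. f' \<in> ?F \<Longrightarrow> f' i = f i \<longleftrightarrow> f' l = f l"
        using single[OF f(1) nonbr[OF f(1)]] by blast
      \<comment> \<open>Otherwise a prefix that follows \<open>f0\<close> at \<open>j\<close> and
        \<open>f\<close> elsewhere would force both letters \<open>f0 i\<close> and
        \<open>f i\<close> at level \<open>i\<close>.\<close>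
      have "l = j"
      proof (rule ccontr)
        assume "l \<noteq> j"
        define p where "p = (\<lambda>m. if m = j then f0 j else f m)"
        have "p m < q" if "m < i" for m
          using that fq[OF f0(1)] fq[OF f(1)] ir unfolding p_def by auto
        then obtain f2 where f2: "f2 \<in> ?F" "\<forall>m<i. f2 m = p m"
          using prefix[of p] by blast
        then have "f2 j = f0 j" "f2 l = f l" using j(1) l(1) \<open>l \<noteq> j\<close> unfolding p_def by auto
        then have "f2 i = f0 i" "f2 i = f i" using j(2) l(2) f2(1) by blast+
        then show False using False by simp
      qed
      then show ?thesis using l f by blast
    qed
    have ex: "\<exists>f\<in>?F. f j = c" if "c < q" for c
      using prefix[of "\<lambda>_. c"] that j(1) by blast
    \<comment> \<open>By \<open>sep\<close> the letter at \<open>i\<close> does not depend on the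
      chosen representative.\<close>
    define \<pi> where "\<pi> c = (SOME f. f \<in> ?F \<and> f j = c) i" for c
    have pi: "\<pi> (f j) = f i" if "f \<in> ?F" for f
    proof -
      let ?g = "SOME f'. f' \<in> ?F \<and> f' j = f j"
      have "?g \<in> ?F \<and> ?g j = f j" by (rule someI[of _ f]) (use that in auto)
      then show ?thesis unfolding \<pi>_def using sep that by blast
    qed
    have "inj_on \<pi> {..<q}"
    proof (rule inj_onI)
      fix c c' assume c: "c \<in> {..<q}" "c' \<in> {..<q}" "\<pi> c = \<pi> c'"
      obtain f f' where "f \<in> ?F" "f j = c" "f' \<in> ?F" "f' j = c'" using ex c by (metis lessThan_iff)
      then show "c = c'" using pi sep c(3) by metis
    qed
    moreover have "\<pi> ` {..<q} \<subseteq> {..<q}"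
    proof
      fix x assume "x \<in> \<pi> ` {..<q}"
      then obtain c where c: "c < q" "x = \<pi> c" by auto
      then obtain f where f: "f \<in> ?F" "f j = c" using ex by blast
      then have "x = f i" using pi[OF f(1)] c by simp
      then show "x \<in> {..<q}" using fq[OF f(1) ir] by simp
    qed
    ultimately have "bij_betw \<pi> {..<q} {..<q}"
      by (simp add: bij_betw_def endo_inj_surj)
    moreover have "\<forall>s\<in>S. fst s i = \<pi> (fst s j)" using pi by auto
    ultimately show ?thesis using ir j(1) less_trans[OF j(1) ir] by blast
  qed
qed

text \<open>As \<open>q \<ge> 3\<close>, every other coordinate has a letter different from those of
  both \<open>s\<close> and \<open>s'\<close>. A member \<open>u\<close> with these letters meets
  \<open>s\<close> and \<open>s'\<close> in coordinate \<open>i\<close> only, so compatibility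
  isolates the phases there: both are the negative of the phase of \<open>u\<close>.\<close>

lemma full_clique_labels:
  assumes clique: "\<And>s t. s \<in> S \<Longrightarrow> t \<in> S \<Longrightarrow> compatible q r s t"
    and S: "S \<subseteq> vertex_types q r" and q: "q \<ge> 3"
    and full: "\<And>p. (\<And>i. i < r \<Longrightarrow> p i < q) \<Longrightarrow> \<exists>s\<in>S. \<forall>i<r. fst s i = p i"
    and s: "s \<in> S" "s' \<in> S" "i < r" "fst s i = fst s' i"
  shows "snd s i = snd s' i" "q dvd 2 * snd s i"
proof -
  have common: "\<exists>u\<in>S. fst u i = fst s i \<and> q dvd snd s i + snd u i \<and> q dvd snd s' i + snd u i"
    if s: "s \<in> S" "s' \<in> S" "fst s i = fst s' i" for s s'
  proof -
    have "\<exists>c<q. c \<noteq> a \<and> c \<noteq> b" for a b :: nat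
    proof (rule ccontr)
      assume "\<not> ?thesis"
      then have "{..<q} \<subseteq> {a, b}" by auto
      then have "card {..<q} \<le> card {a, b}" by (intro card_mono) auto
      moreover have "card {a, b} \<le> 2" by (simp add: card_insert_if)
      ultimately show False using q by simp
    qed
    then obtain c where c: "\<And>a b. c a b < q \<and> c a b \<noteq> a \<and> c a b \<noteq> (b::nat)" by metis
    define p where "p = (\<lambda>l. if l = i then fst s i else c (fst s l) (fst s' l))"
    have "p l < q" if "l < r" for l
      using c vertex_typesD(1)[OF subsetD[OF S s(1)] that] unfolding p_def by auto
    then obtain u where u: "u \<in> S" "\<forall>l<r. fst u l = p l" using full by blast
    have "agreement_sum r t u = snd t i + snd u i" if "t = s \<or> t = s'" for t
    proof -
      have "agreement_sum r t u = (\<Sum>l<r. if l = i then snd t l + snd u l else 0)"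
        unfolding agreement_sum_def
      proof (intro sum.cong refl)
        fix l assume "l \<in> {..<r}"
        then show "(if fst t l = fst u l then snd t l + snd u l else 0) =
            (if l = i then snd t l + snd u l else 0)"
          using u(2) c[of "fst s l" "fst s' l"] that s(3) unfolding p_def by auto
      qed
      then show ?thesis using \<open>i < r\<close> by simp
    qed
    moreover have "compatible q r s u" "compatible q r s' u" using clique s u by blast+
    ultimately show ?thesis
      using u \<open>i < r\<close> unfolding compatible_def by (intro bexI[of _ u]) (auto simp: p_def)
  qed
  have same: "snd s i = snd s' i" if s: "s \<in> S" "s' \<in> S" "fst s i = fst s' i" for s s'
  proof -
    obtain u :: "vertex_type" where "q dvd snd s i + snd u i" "q dvd snd s' i + snd u i"
      using common[OF s] by blast
    then have "int q dvd int (snd s i + snd u i) - int (snd s' i + snd u i)"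
      by (intro dvd_diff) (simp_all only: int_dvd_int_iff)
    then have "int q dvd int (snd s i) - int (snd s' i)" by simp
    then show ?thesis
      using vertex_typesD(2)[OF subsetD[OF S s(1)] \<open>i < r\<close>] vertex_typesD(2)[OF subsetD[OF S s(2)] \<open>i < r\<close>]
      by (rule eq_of_int_dvd)
  qed
  show "snd s i = snd s' i" using same s by blast
  \<comment> \<open>For \<open>s = s'\<close> the partner \<open>u\<close> shares the letter at
    \<open>i\<close>, hence the phase of \<open>s\<close> by the first claim; that phase is
    therefore its own negative.\<close>
  obtain u where u: "u \<in> S" "fst u i = fst s i" "q dvd snd s i + snd u i"
    using common[OF s(1,1)] by blast
  moreover have "snd u i = snd s i" using same[OF u(1) s(1) u(2)] .
  ultimately show "q dvd 2 * snd s i" by (simp add: mult_2)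
qed

section \<open>Poisson limits from factorial moments\<close>

lemma real_alternating_binomial_sum:
  assumes "m > 0"
  shows "(\<Sum>j\<le>J. (-1) ^ j * real (m choose j)) = (-1) ^ J * real ((m - 1) choose J)"
proof -
  have "(\<Sum>j\<le>J. (-1) ^ j * real (m choose j)) = (\<Sum>j\<le>J. (real m gchoose j) * (-1) ^ j)"
    by (simp add: binomial_gbinomial mult.commute)
  also have "\<dots> = (-1) ^ J * (real m - 1 gchoose J)" by (rule gbinomial_sum_lower_neg)
  also have "real m - 1 = real (m - 1)" using assms by simp
  finally show ?thesis by (simp add: binomial_gbinomial)
qed

lemma choose_shift_product:
  assumes "k \<le> x"
  shows "((k + j) choose k) * (x choose (k + j)) = (x choose k) * ((x - k) choose j)"
proof (cases "k + j \<le> x")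
  case True
  then show ?thesis using choose_mult[of k "k + j" x] by (simp add: mult.commute)
next
  case False
  then have "x < k + j" "x - k < j" using assms by auto
  then show ?thesis by (simp add: binomial_eq_0)
qed

text \<open>With \<open>x choose k\<close> factored out, the truncated inclusion-exclusion sum is an
  alternating partial sum along row \<open>x - k\<close> of Pascal's triangle, which for
  \<open>x > k\<close> is plus or minus one entry of row \<open>x - k - 1\<close>. The error is thus
  bounded by a term whose expectation is again a binomial moment.\<close>

lemma bonferroni_indicator:
  fixes x k J :: nat
  shows "\<bar>of_bool (x = k) - (\<Sum>j\<le>J. (-1) ^ j * real ((k + j) choose k) * real (x choose (k + j)))\<bar>
    \<le> real ((k + J) choose k) * real (x choose (k + J))"
proof (cases "k \<le> x")
  case False
  then show ?thesis by (simp add: binomial_eq_0)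
next
  case True
  have "(\<Sum>j\<le>J. (-1) ^ j * real ((k + j) choose k) * real (x choose (k + j))) =
      real (x choose k) * (\<Sum>j\<le>J. (-1) ^ j * real ((x - k) choose j))"
    unfolding sum_distrib_left mult.assoc of_nat_mult[symmetric] choose_shift_product[OF True]
    by (simp add: mult_ac)
  also have "\<bar>of_bool (x = k) - \<dots>\<bar> \<le> real (x choose k) * real ((x - k) choose J)"
  proof (cases "x = k")
    case True
    have "(\<Sum>j\<le>J. (-1) ^ j * real (0 choose j)) = (\<Sum>j\<le>J. if j = 0 then 1 else 0)"
      by (intro sum.cong refl) (auto simp: binomial_eq_0)
    then show ?thesis using True by simp
  next
    case False
    then have "x - k > 0" using \<open>k \<le> x\<close> by simp
    moreover have "(x - k - 1 choose J) \<le> (x - k choose J)" by (rule binomial_right_mono) simp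
    ultimately show ?thesis
      using False real_alternating_binomial_sum[of "x - k" J]
      by (simp add: abs_mult mult_left_mono)
  qed
  finally show ?thesis
    unfolding of_nat_mult[symmetric] choose_shift_product[OF True] .
qed

text \<open>The truncation order \<open>J\<close> is fixed before \<open>n\<close> tends to
  infinity, so the speed of convergence in \<open>n\<close> may depend on \<open>J\<close>.\<close>

lemma tendsto_sandwich_family:
  fixes a :: "nat \<Rightarrow> real" and A e :: "nat \<Rightarrow> nat \<Rightarrow> real"
  assumes close: "\<And>J n. \<bar>a n - A J n\<bar> \<le> e J n"
    and A: "\<And>J. A J \<longlonglongrightarrow> \<alpha> J" and e: "\<And>J. e J \<longlonglongrightarrow> \<epsilon> J"
    and \<alpha>: "\<alpha> \<longlonglongrightarrow> l" and \<epsilon>: "\<epsilon> \<longlonglongrightarrow> 0"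
  shows "a \<longlonglongrightarrow> l"
proof (rule tendstoI)
  fix d :: real assume "d > 0"
  then have d: "d / 4 > 0" by simp
  have "eventually (\<lambda>J. dist (\<alpha> J) l < d / 4 \<and> dist (\<epsilon> J) 0 < d / 4) sequentially"
    using tendstoD[OF \<alpha> d] tendstoD[OF \<epsilon> d] by eventually_elim simp
  then obtain J where J: "dist (\<alpha> J) l < d / 4" "dist (\<epsilon> J) 0 < d / 4"
    using eventually_happens' by force
  show "eventually (\<lambda>n. dist (a n) l < d) sequentially"
    using tendstoD[OF A[of J] d] tendstoD[OF e[of J] d]
  proof eventually_elim
    case (elim n)
    then show ?case using J close[of n J] unfolding dist_real_def by linarith
  qed
qed

text \<open>Up to the factor \<open>rate ^ k / fact k\<close>, the truncated sums tend to partial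
  sums of the series of \<open>exp (- rate)\<close>, and the error bounds tend to single terms of
  the exponential series, which vanish as \<open>J\<close> grows.\<close>

theorem poisson_limit_of_factorial_moments:
  fixes P :: "nat \<Rightarrow> nat pmf"
  assumes fin: "\<And>n. finite (set_pmf (P n))" and rate: "rate > 0"
    and moments: "\<And>r. (\<lambda>n. measure_pmf.expectation (P n) (\<lambda>x. real (x choose r))) \<longlonglongrightarrow> rate ^ r / fact r"
  shows "(\<lambda>n. pmf (P n) k) \<longlonglongrightarrow> pmf (poisson_pmf rate) k"
proof -
  define B where "B r n = measure_pmf.expectation (P n) (\<lambda>x. real (x choose r))" for r n
  define c where "c j = real ((k + j) choose k)" for j
  have int: "integrable (measure_pmf (P n)) f" for n and f :: "nat \<Rightarrow> real"
    by (rule integrable_measure_pmf_finite[OF fin])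
  have lim: "B r \<longlonglongrightarrow> rate ^ r / fact r" for r using moments unfolding B_def .
  have coeff: "c j * (rate ^ (k + j) / fact (k + j)) = rate ^ k / fact k * (rate ^ j / fact j)" for j
    unfolding c_def using binomial_fact[of k "k + j", where ?'a = real] by (simp add: power_add)
  show ?thesis
  proof (rule tendsto_sandwich_family)
    fix J n
    have "\<bar>pmf (P n) k - (\<Sum>j\<le>J. (-1) ^ j * c j * B (k + j) n)\<bar> =
        \<bar>measure_pmf.expectation (P n) (\<lambda>x. of_bool (x = k) -
          (\<Sum>j\<le>J. (-1) ^ j * c j * real (x choose (k + j))))\<bar>"
    proof -
      have "measure_pmf.expectation (P n) (\<lambda>x. of_bool (x = k)) = pmf (P n) k"
      proof -
        have "(\<lambda>x. of_bool (x = k) :: real) = indicator {k}" by (auto simp: indicator_def)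
        then show ?thesis by (simp add: measure_pmf_single)
      qed
      then show ?thesis unfolding B_def by (simp add: Bochner_Integration.integral_diff int)
    qed
    also have "\<dots> \<le> measure_pmf.expectation (P n) (\<lambda>x. \<bar>of_bool (x = k) -
          (\<Sum>j\<le>J. (-1) ^ j * c j * real (x choose (k + j)))\<bar>)"
      by (rule integral_abs_bound)
    also have "\<dots> \<le> measure_pmf.expectation (P n) (\<lambda>x. c J * real (x choose (k + J)))"
      unfolding c_def by (intro integral_mono int bonferroni_indicator)
    also have "\<dots> = c J * B (k + J) n" unfolding B_def by simp
    finally show "\<bar>pmf (P n) k - (\<Sum>j\<le>J. (-1) ^ j * c j * B (k + j) n)\<bar> \<le> c J * B (k + J) n" .
  next
    fix J
    show "(\<lambda>n. \<Sum>j\<le>J. (-1) ^ j * c j * B (k + j) n)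
        \<longlonglongrightarrow> (\<Sum>j\<le>J. (-1) ^ j * c j * (rate ^ (k + j) / fact (k + j)))"
      by (intro tendsto_sum tendsto_mult tendsto_const lim)
    show "(\<lambda>n. c J * B (k + J) n) \<longlonglongrightarrow> c J * (rate ^ (k + J) / fact (k + J))"
      by (intro tendsto_mult tendsto_const lim)
  next
    have "(\<lambda>J. \<Sum>j\<le>J. (- rate) ^ j /\<^sub>R fact j) \<longlonglongrightarrow> exp (- rate)"
      using exp_converges[of "- rate"] unfolding sums_def_le .
    then have "(\<lambda>J. rate ^ k / fact k * (\<Sum>j\<le>J. (- rate) ^ j /\<^sub>R fact j)) \<longlonglongrightarrow> rate ^ k / fact k * exp (- rate)"
      by (intro tendsto_mult tendsto_const)
    moreover have "rate ^ k / fact k * (\<Sum>j\<le>J. (- rate) ^ j /\<^sub>R fact j) =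
        (\<Sum>j\<le>J. (-1) ^ j * c j * (rate ^ (k + j) / fact (k + j)))" for J
      unfolding sum_distrib_left mult.assoc coeff power_minus[of rate]
      by (intro sum.cong refl) (simp add: field_simps)
    ultimately show "(\<lambda>J. \<Sum>j\<le>J. (-1) ^ j * c j * (rate ^ (k + j) / fact (k + j)))
        \<longlonglongrightarrow> pmf (poisson_pmf rate) k"
      using rate by simp
    have "(\<lambda>J. rate ^ J /\<^sub>R fact J) \<longlonglongrightarrow> 0"
      by (rule summable_LIMSEQ_zero[OF summable_exp_generic])
    then have "(\<lambda>J. rate ^ k / fact k * (rate ^ J /\<^sub>R fact J)) \<longlonglongrightarrow> rate ^ k / fact k * 0"
      by (intro tendsto_mult tendsto_const)
    then show "(\<lambda>J. c J * (rate ^ (k + J) / fact (k + J))) \<longlonglongrightarrow> 0"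
      unfolding coeff by (simp add: divide_inverse mult_ac)
  qed
qed

text \<open>The distribution function of a natural-valued law is a finite sum of point masses at
  every real argument, so it converges everywhere, jumps included.\<close>

lemma weak_conv_of_pmf_limit:
  fixes P :: "nat \<Rightarrow> nat pmf" and Q :: "nat pmf"
  assumes "\<And>k. (\<lambda>n. pmf (P n) k) \<longlonglongrightarrow> pmf Q k"
  shows "weak_conv_m (\<lambda>n. distr (measure_pmf (P n)) borel real) (distr (measure_pmf Q) borel real)"
proof -
  have cdf: "cdf (distr (measure_pmf R) borel real) x = (\<Sum>k\<in>{k. real k \<le> x}. pmf R k)" for R :: "nat pmf" and x
  proof -
    have fin: "finite {k. real k \<le> x}"
      by (rule finite_subset[of _ "{..nat \<lfloor>x\<rfloor>}"]) (auto simp: le_nat_floor)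
    have "cdf (distr (measure_pmf R) borel real) x = measure (measure_pmf R) {k. real k \<le> x}"
      unfolding cdf_def by (subst measure_distr) (auto simp: vimage_def)
    then show ?thesis using measure_measure_pmf_finite[OF fin, of R] by simp
  qed
  show ?thesis
    unfolding weak_conv_m_def weak_conv_def cdf by (intro allI impI tendsto_sum assms)
qed

text \<open>Coupling on one probability space: the point masses differ by at most the probability
  that \<open>X\<close> and \<open>Y\<close> disagree.\<close>

lemma pmf_limit_transfer:
  fixes R :: "nat \<Rightarrow> 'a pmf" and X Y :: "nat \<Rightarrow> 'a \<Rightarrow> nat"
  assumes "(\<lambda>n. pmf (map_pmf (Y n) (R n)) k) \<longlonglongrightarrow> l"
    and "(\<lambda>n. measure_pmf.prob (R n) {w. X n w \<noteq> Y n w}) \<longlonglongrightarrow> 0"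
  shows "(\<lambda>n. pmf (map_pmf (X n) (R n)) k) \<longlonglongrightarrow> l"
proof -
  have bound: "\<bar>pmf (map_pmf (X n) (R n)) k - pmf (map_pmf (Y n) (R n)) k\<bar>
      \<le> measure_pmf.prob (R n) {w. X n w \<noteq> Y n w}" for n
  proof -
    have "measure_pmf.prob (R n) A \<le> measure_pmf.prob (R n) B + measure_pmf.prob (R n) {w. X n w \<noteq> Y n w}"
      if "A \<subseteq> B \<union> {w. X n w \<noteq> Y n w}" for A B
      using measure_pmf.finite_measure_mono[OF that, of "R n"]
        measure_Un_le[of B "measure_pmf (R n)" "{w. X n w \<noteq> Y n w}"] by simp
    note sub = this
    have "measure_pmf.prob (R n) (X n -` {k}) \<le> measure_pmf.prob (R n) (Y n -` {k})
          + measure_pmf.prob (R n) {w. X n w \<noteq> Y n w}"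
      by (rule sub) auto
    moreover have "measure_pmf.prob (R n) (Y n -` {k}) \<le> measure_pmf.prob (R n) (X n -` {k})
          + measure_pmf.prob (R n) {w. X n w \<noteq> Y n w}"
      by (rule sub) auto
    ultimately show ?thesis unfolding pmf_map by linarith
  qed
  have "(\<lambda>n. pmf (map_pmf (X n) (R n)) k - pmf (map_pmf (Y n) (R n)) k) \<longlonglongrightarrow> 0"
    by (rule Lim_null_comparison[OF _ assms(2)]) (use bound in auto)
  from tendsto_add[OF this assms(1)] show ?thesis by simp
qed

section \<open>Excited configurations of a spin system\<close>

lemma finite_all_edges: "finite (all_edges n)"
  unfolding all_edges_def by (rule finite_subset[of _ "Pow {1..n}"]) auto

lemma sum_prod_PiE_power:
  fixes g :: "'t \<Rightarrow> 'c :: comm_semiring_1"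
  assumes "finite T"
  shows "(\<Sum>\<tau>\<in>(\<Pi>\<^sub>E v\<in>{1..n::nat}. T). \<Prod>v\<in>{1..n}. g (\<tau> v)) = (\<Sum>t\<in>T. g t) ^ n"
  using prod_sum_PiE[of "{1..n}" "\<lambda>_. T" "\<lambda>_. g"] assms by simp

text \<open>Only the moduli of the edge weights enter here; phases matter only for the main term.
  \<open>compat\<close> need not be reflexive, so a type compatible with a whole clique need not
  enlarge it, and the strict bound is a separate assumption.\<close>

locale spin_system =
  fixes Types :: "'t set" and compat :: "'t \<Rightarrow> 't \<Rightarrow> bool" and h :: "'t \<Rightarrow> 't \<Rightarrow> real"
    and \<rho> :: real and N :: nat
  assumes finite_Types: "finite Types" and Types_nonempty: "Types \<noteq> {}"
    and h_nonneg: "\<And>s t. 0 \<le> h s t" and h_le_1: "\<And>s t. h s t \<le> 1"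
    and h_le: "\<And>s t. s \<in> Types \<Longrightarrow> t \<in> Types \<Longrightarrow> \<not> compat s t \<Longrightarrow> h s t \<le> \<rho>"
    and rho: "0 < \<rho>" "\<rho> < 1"
    and compat_commute: "\<And>s t. compat s t \<longleftrightarrow> compat t s"
    and N_pos: "N \<ge> 1"
    and clique_le: "\<And>S. S \<subseteq> Types \<Longrightarrow> (\<And>s t. s \<in> S \<Longrightarrow> t \<in> S \<Longrightarrow> compat s t) \<Longrightarrow> card S \<le> N"
    and extendable_clique_less: "\<And>S x. S \<subseteq> Types \<Longrightarrow> (\<And>s t. s \<in> S \<Longrightarrow> t \<in> S \<Longrightarrow> compat s t) \<Longrightarrow>
      x \<in> Types \<Longrightarrow> x \<notin> S \<Longrightarrow> (\<And>s. s \<in> S \<Longrightarrow> compat x s) \<Longrightarrow> card S < N"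
begin

definition configs :: "nat \<Rightarrow> (nat \<Rightarrow> 't) set" where
  "configs n = (\<Pi>\<^sub>E v\<in>{1..n}. Types)"

definition weight :: "nat \<Rightarrow> (nat \<Rightarrow> 't) \<Rightarrow> real" where
  "weight n \<tau> = (\<Prod>e\<in>all_edges n. h (\<tau> (Min e)) (\<tau> (Max e)))"

definition ground_clique :: "'t set \<Rightarrow> bool" where
  "ground_clique S \<longleftrightarrow> S \<subseteq> Types \<and> (\<forall>s\<in>S. \<forall>t\<in>S. compat s t) \<and> card S = N"

definition excited :: "nat \<Rightarrow> (nat \<Rightarrow> 't) set" where
  "excited n = {\<tau> \<in> configs n. \<not> (\<exists>S. ground_clique S \<and> \<tau> ` {1..n} \<subseteq> S)}"

definition frequent :: "real \<Rightarrow> nat \<Rightarrow> (nat \<Rightarrow> 't) \<Rightarrow> 't set" where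
  "frequent \<delta> n \<tau> = {t \<in> Types. \<delta> * n \<le> real (card {v \<in> {1..n}. \<tau> v = t})}"

lemma finite_configs: "finite (configs n)"
  unfolding configs_def using finite_Types by (intro finite_PiE) auto

lemma configsD: "\<tau> \<in> configs n \<Longrightarrow> v \<in> {1..n} \<Longrightarrow> \<tau> v \<in> Types"
  unfolding configs_def by (rule PiE_mem)

lemma weight_nonneg: "0 \<le> weight n \<tau>"
  unfolding weight_def by (intro prod_nonneg h_nonneg)

lemma weight_le_1: "weight n \<tau> \<le> 1"
  unfolding weight_def by (intro prod_le_1 conjI h_nonneg h_le_1)

lemma weight_le:
  assumes "\<tau> \<in> configs n" and P: "P \<subseteq> all_edges n"
    and inc: "\<And>u v. {u, v} \<in> P \<Longrightarrow> \<not> compat (\<tau> u) (\<tau> v)"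
    and x: "x \<le> real (card P)"
  shows "weight n \<tau> \<le> \<rho> powr x"
proof -
  have fin: "finite P" using P finite_all_edges finite_subset by blast
  have "weight n \<tau> = (\<Prod>e\<in>P. h (\<tau> (Min e)) (\<tau> (Max e))) * (\<Prod>e\<in>all_edges n - P. h (\<tau> (Min e)) (\<tau> (Max e)))"
    unfolding weight_def by (simp add: prod.subset_diff[OF P finite_all_edges] mult.commute)
  also have "\<dots> \<le> (\<Prod>e\<in>P. \<rho>) * 1"
  proof (intro mult_mono prod_mono conjI h_nonneg prod_le_1 prod_nonneg h_le_1)
    fix e assume e: "e \<in> P"
    then have "card e = 2" "e \<subseteq> {1..n}" using P unfolding all_edges_def by auto
    then obtain u v where uv: "e = {u, v}" "u \<noteq> v" "u \<in> {1..n}" "v \<in> {1..n}" by (auto simp: card_2_iff)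
    have "e = {Min e, Max e}" using uv by (auto simp: min_def max_def)
    then have "\<not> compat (\<tau> (Min e)) (\<tau> (Max e))" using inc e by metis
    moreover have "Min e \<in> {1..n}" "Max e \<in> {1..n}" using uv by (auto simp: min_def max_def)
    ultimately show "h (\<tau> (Min e)) (\<tau> (Max e)) \<le> \<rho>"
      using configsD[OF assms(1)] by (intro h_le)
  qed (use rho in auto)
  also have "\<dots> = \<rho> powr real (card P)" using rho by (simp add: powr_realpow)
  also have "\<dots> \<le> \<rho> powr x" using rho x by (intro powr_mono') auto
  finally show ?thesis .
qed

lemma weight_le_bipartite:
  assumes \<tau>: "\<tau> \<in> configs n" and A: "A \<subseteq> {1..n}" and B: "\<And>a. a \<in> A \<Longrightarrow> B a \<subseteq> {1..n} - A"
    and inc: "\<And>a b. a \<in> A \<Longrightarrow> b \<in> B a \<Longrightarrow> \<not> compat (\<tau> a) (\<tau> b)"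
    and m: "\<And>a. a \<in> A \<Longrightarrow> m \<le> real (card (B a))"
  shows "weight n \<tau> \<le> \<rho> powr (m * card A)"
proof -
  define P where "P = (\<lambda>(a, b). {a, b}) ` Sigma A B"
  have finA: "finite A" using A finite_subset by blast
  have finB: "finite (B a)" if "a \<in> A" for a using B[OF that] finite_subset by blast
  \<comment> \<open>\<open>B a\<close> avoids \<open>A\<close>, so an edge determines which of its
    ends lies in \<open>A\<close>, and no pair is counted twice.\<close>
  have "inj_on (\<lambda>(a, b). {a, b}) (Sigma A B)"
    using B by (auto simp: inj_on_def doubleton_eq_iff)
  then have "card P = (\<Sum>a\<in>A. card (B a))"
    unfolding P_def using finA finB by (simp add: card_image card_SigmaI)
  then have card: "m * card A \<le> real (card P)"
    using sum_bounded_below[of A m "\<lambda>a. real (card (B a))"] m by (simp add: mult.commute)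
  show ?thesis
  proof (rule weight_le[OF \<tau> _ _ card])
    show "P \<subseteq> all_edges n"
      using A B unfolding P_def all_edges_def by (fastforce simp: card_2_iff)
    fix u v assume "{u, v} \<in> P"
    then show "\<not> compat (\<tau> u) (\<tau> v)"
      using inc compat_commute[of "\<tau> u" "\<tau> v"] unfolding P_def by (auto simp: doubleton_eq_iff)
  qed
qed

lemma weight_le_monochromatic:
  assumes \<tau>: "\<tau> \<in> configs n" and A: "A \<subseteq> {1..n}"
    and inc: "\<And>a b. a \<in> A \<Longrightarrow> b \<in> A \<Longrightarrow> \<not> compat (\<tau> a) (\<tau> b)" and two: "card A \<ge> 2"
  shows "weight n \<tau> \<le> \<rho> powr (real (card A) ^ 2 / 4)"
proof (rule weight_le[OF \<tau>])
  let ?P = "{e. e \<subseteq> A \<and> card e = 2}"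
  show "?P \<subseteq> all_edges n" using A unfolding all_edges_def by auto
  show "\<not> compat (\<tau> u) (\<tau> v)" if "{u, v} \<in> ?P" for u v using that inc by auto
  have fin: "finite A" using A finite_subset by blast
  have "card ?P = card A choose 2" by (rule n_subsets[OF fin])
  then have "real (card ?P) = real (card A) * (real (card A) - 1) / 2"
    using two by (simp add: choose_two real_of_nat_div of_nat_diff)
  \<comment> \<open>\<open>k * (k - 1) / 2 \<ge> k^2 / 4\<close> holds for
    \<open>k \<ge> 2\<close>.\<close>
  also have "\<dots> \<ge> real (card A) ^ 2 / 4"
    using mult_left_mono[of 2 "real (card A)" "real (card A)"] two by (simp add: power2_eq_square field_simps)
  finally show "real (card A) ^ 2 / 4 \<le> real (card ?P)" .
qed

text \<open>Two incompatible classes of linear size give quadratically many penalised pairs, enough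
  to beat the exponential number of configurations. The factor 1/4 comes from the case
  \<open>s = t\<close>, where the pairs lie inside one class.\<close>

lemma weight_le_of_incompatible_frequent:
  assumes \<tau>: "\<tau> \<in> configs n" and s: "s \<in> frequent \<delta> n \<tau>" "t \<in> frequent \<delta> n \<tau>" "\<not> compat s t"
    and n: "\<delta> * n \<ge> 2"
  shows "weight n \<tau> \<le> \<rho> powr ((\<delta> * n) ^ 2 / 4)"
proof -
  let ?V = "\<lambda>s. {v \<in> {1..n}. \<tau> v = s}"
  have card: "\<delta> * n \<le> real (card (?V s))" "\<delta> * n \<le> real (card (?V t))"
    using s unfolding frequent_def by auto
  show ?thesis
  proof (cases "s = t")
    case True
    have "real (card (?V s)) \<ge> 2" using card(1) n by linarith
    then have "weight n \<tau> \<le> \<rho> powr (real (card (?V s)) ^ 2 / 4)"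
      using s(3) True by (intro weight_le_monochromatic[OF \<tau>]) auto
    also have "\<dots> \<le> \<rho> powr ((\<delta> * n) ^ 2 / 4)"
      using rho card(1) n by (intro powr_mono' divide_right_mono power_mono) auto
    finally show ?thesis .
  next
    case False
    have "weight n \<tau> \<le> \<rho> powr (\<delta> * n * card (?V s))"
      using s(3) False card(2) by (intro weight_le_bipartite[OF \<tau>, of _ "\<lambda>_. ?V t"]) auto
    also have "\<dots> \<le> \<rho> powr ((\<delta> * n) ^ 2 / 4)"
    proof (rule powr_mono')
      have "(\<delta> * n) ^ 2 / 4 \<le> (\<delta> * n) ^ 2" by simp
      also have "\<dots> \<le> \<delta> * n * card (?V s)"
        unfolding power2_eq_square using card(1) n by (intro mult_left_mono) auto
      finally show "(\<delta> * n) ^ 2 / 4 \<le> \<delta> * n * card (?V s)" .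
    qed (use rho in auto)
    finally show ?thesis .
  qed
qed

text \<open>A type outside a clique of size \<open>N\<close> is incompatible with one of its
  members, and that member occupies at least \<open>\<delta> * n\<close> vertices. Each stray vertex
  thus costs an exponentially small factor; the product form lets the sum over configurations
  factorise.\<close>

lemma weight_le_of_ground_frequent:
  assumes \<tau>: "\<tau> \<in> configs n" and ground: "ground_clique (frequent \<delta> n \<tau>)"
  shows "weight n \<tau> \<le> (\<Prod>v\<in>{1..n}. if \<tau> v \<in> frequent \<delta> n \<tau> then 1 else \<rho> powr (\<delta> * n))"
proof -
  let ?S = "frequent \<delta> n \<tau>"
  define A where "A = {v \<in> {1..n}. \<tau> v \<notin> ?S}"
  have "\<exists>s\<in>?S. \<not> compat (\<tau> a) s" if "a \<in> A" for a
  proof (rule ccontr)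
    assume "\<not> ?thesis"
    then have "card ?S < N"
      using ground that configsD[OF \<tau>] unfolding ground_clique_def A_def
      by (intro extendable_clique_less[of ?S "\<tau> a"]) auto
    then show False using ground unfolding ground_clique_def by simp
  qed
  then obtain s where s: "\<And>a. a \<in> A \<Longrightarrow> s a \<in> ?S \<and> \<not> compat (\<tau> a) (s a)" by metis
  have "weight n \<tau> \<le> \<rho> powr (\<delta> * n * card A)"
  proof (rule weight_le_bipartite[OF \<tau>, of A "\<lambda>a. {v \<in> {1..n}. \<tau> v = s a}"])
    show "\<delta> * n \<le> real (card {v \<in> {1..n}. \<tau> v = s a})" if "a \<in> A" for a
      using s[OF that] unfolding frequent_def by simp
  qed (use s in \<open>auto simp: A_def\<close>)
  also have "\<dots> = (\<Prod>v\<in>A. \<rho> powr (\<delta> * n))"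
    using rho by (simp add: powr_powr[symmetric] powr_realpow)
  also have "\<dots> = (\<Prod>v\<in>{1..n}. if \<tau> v \<in> ?S then 1 else \<rho> powr (\<delta> * n))"
  proof -
    have "(\<Prod>v\<in>A. \<rho> powr (\<delta> * n)) = (\<Prod>v\<in>{1..n}. if \<tau> v \<notin> ?S then \<rho> powr (\<delta> * n) else 1)"
      unfolding A_def by (rule prod.inter_filter) simp
    also have "\<dots> = (\<Prod>v\<in>{1..n}. if \<tau> v \<in> ?S then 1 else \<rho> powr (\<delta> * n))"
      by (intro prod.cong) auto
    finally show ?thesis .
  qed
  finally show ?thesis .
qed

lemma card_infrequent:
  fixes \<delta> :: real
  assumes \<tau>: "\<tau> \<in> configs n" and \<delta>: "\<delta> \<ge> 0"
  shows "real (card {v \<in> {1..n}. \<tau> v \<notin> frequent \<delta> n \<tau>}) \<le> card Types * (\<delta> * n)"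
proof -
  let ?R = "Types - frequent \<delta> n \<tau>"
  have "{v \<in> {1..n}. \<tau> v \<notin> frequent \<delta> n \<tau>} = (\<Union>t\<in>?R. {v \<in> {1..n}. \<tau> v = t})"
    using configsD[OF \<tau>] by auto
  then have "card {v \<in> {1..n}. \<tau> v \<notin> frequent \<delta> n \<tau>} \<le> (\<Sum>t\<in>?R. card {v \<in> {1..n}. \<tau> v = t})"
    using card_UN_le[of ?R "\<lambda>t. {v \<in> {1..n}. \<tau> v = t}"] finite_Types by simp
  then have "real (card {v \<in> {1..n}. \<tau> v \<notin> frequent \<delta> n \<tau>}) \<le> (\<Sum>t\<in>?R. real (card {v \<in> {1..n}. \<tau> v = t}))"
    unfolding of_nat_sum[symmetric] by (simp only: of_nat_le_iff)
  also have "\<dots> \<le> (\<Sum>t\<in>?R. \<delta> * n)"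
    by (intro sum_mono) (auto simp: frequent_def)
  also have "\<dots> \<le> card Types * (\<delta> * n)"
    using \<delta> finite_Types by (auto intro!: mult_right_mono card_mono)
  finally show ?thesis .
qed

text \<open>Rankin's device: the constraint that infrequent vertices are few is replaced by a
  penalty \<open>1 / z\<close> for each of them, at the price of a factor
  \<open>z powr (card Types * \<delta>)\<close> for every vertex. For a fixed set of frequent types
  the penalty is a product over vertices and can be summed.\<close>

lemma one_le_infrequent_product:
  fixes \<delta> z :: real
  assumes \<tau>: "\<tau> \<in> configs n" and \<delta>: "\<delta> \<ge> 0" and z: "z \<ge> 1"
  shows "1 \<le> (z powr (card Types * \<delta>)) ^ n * (\<Prod>v\<in>{1..n}. if \<tau> v \<in> frequent \<delta> n \<tau> then 1 else 1 / z)"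
proof -
  define A where "A = {v \<in> {1..n}. \<tau> v \<notin> frequent \<delta> n \<tau>}"
  have "(\<Prod>v\<in>{1..n}. if \<tau> v \<in> frequent \<delta> n \<tau> then 1 else 1 / z)
      = (\<Prod>v\<in>{1..n}. if \<tau> v \<notin> frequent \<delta> n \<tau> then 1 / z else 1)"
    by (intro prod.cong) auto
  also have "\<dots> = (\<Prod>v\<in>A. 1 / z)" unfolding A_def by (rule prod.inter_filter[symmetric]) simp
  also have "\<dots> = z powr (- real (card A))"
    using z by (simp add: powr_minus powr_realpow power_one_over inverse_eq_divide)
  moreover have "(z powr (card Types * \<delta>)) ^ n = z powr (card Types * (\<delta> * n))"
    using z by (simp add: powr_realpow[symmetric] powr_powr mult.assoc)
  ultimately have "(z powr (card Types * \<delta>)) ^ n * (\<Prod>v\<in>{1..n}. if \<tau> v \<in> frequent \<delta> n \<tau> then 1 else 1 / z)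
     = z powr (card Types * (\<delta> * n) - real (card A))"
    using z by (simp add: powr_add[symmetric])
  then show ?thesis
    using card_infrequent[OF \<tau> \<delta>] z unfolding A_def by (simp add: ge_one_powr_ge_zero)
qed

end

section \<open>Elementary limits\<close>

lemma power_to_zero_of_base_bound:
  fixes f :: "nat \<Rightarrow> real" and b :: "nat \<Rightarrow> real"
  assumes "\<And>n. 0 \<le> f n" "eventually (\<lambda>n. f n \<le> b n ^ n) sequentially"
    and "b \<longlonglongrightarrow> l" "l < 1" "\<And>n. 0 \<le> b n"
  shows "f \<longlonglongrightarrow> 0"
proof -
  have "l \<ge> 0" using assms(3) by (rule LIMSEQ_le_const) (use assms(5) in auto)
  define m where "m = (l + 1) / 2"
  have m: "l < m" "m < 1" "0 \<le> m" using assms(4) \<open>l \<ge> 0\<close> unfolding m_def by auto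
  have "eventually (\<lambda>n. norm (f n) \<le> m ^ n) sequentially"
    using assms(2) order_tendstoD(2)[OF assms(3) m(1)]
  proof eventually_elim
    case (elim n)
    then have "f n \<le> m ^ n" using power_mono[of "b n" m n] assms(5)[of n] by linarith
    then show ?case using assms(1) by simp
  qed
  moreover have "(\<lambda>n. m ^ n) \<longlonglongrightarrow> 0" by (rule LIMSEQ_realpow_zero) (use m in auto)
  ultimately show ?thesis by (rule Lim_null_comparison)
qed

lemma powr_of_nat_tendsto_0:
  fixes \<rho> c :: real
  assumes "0 < \<rho>" "\<rho> < 1" "c > 0"
  shows "(\<lambda>n. \<rho> powr (c * real n)) \<longlonglongrightarrow> 0" "(\<lambda>n. real n * \<rho> powr (c * real n)) \<longlonglongrightarrow> 0"
proof -
  define b where "b = - ln \<rho> * c"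
  have b: "b > 0" using assms unfolding b_def by (simp add: mult_neg_pos)
  have eq: "\<rho> powr (c * real n) = exp (- b * real n)" for n
    using assms(1) unfolding powr_def b_def by (simp add: mult_ac)
  show "(\<lambda>n. \<rho> powr (c * real n)) \<longlonglongrightarrow> 0" unfolding eq using b by real_asymp
  show "(\<lambda>n. real n * \<rho> powr (c * real n)) \<longlonglongrightarrow> 0" unfolding eq using b by real_asymp
qed

lemma exists_small_exponent:
  fixes z K :: real and M :: real
  assumes "0 < M" "M < K" "z > 0"
  shows "\<exists>\<delta>>0. z powr (T * \<delta>) * M < K"
proof -
  have "((\<lambda>\<delta>. z powr (T * \<delta>) * M) \<longlongrightarrow> z powr (T * 0) * M) (at_right 0)"
    using assms(3) by (intro tendsto_intros) auto
  then have "eventually (\<lambda>\<delta>. z powr (T * \<delta>) * M < K) (at_right 0)"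
    by (rule order_tendstoD(2)) (use assms in auto)
  then have "eventually (\<lambda>\<delta>. z powr (T * \<delta>) * M < K \<and> \<delta> > 0) (at_right 0)"
    using eventually_at_right_less[of 0] by eventually_elim auto
  then show ?thesis using eventually_happens'[of "at_right (0::real)"] by force
qed

section \<open>Negligibility of the excited configurations\<close>

context spin_system
begin

lemma sum_configs_product:
  fixes x :: real
  shows "(\<Sum>\<tau>\<in>configs n. \<Prod>v\<in>{1..n}. if \<tau> v \<in> S then 1 else x) = (card (Types \<inter> S) + card (Types - S) * x) ^ n"
proof -
  have "(\<Sum>t\<in>Types. if t \<in> S then 1 else x) = card (Types \<inter> S) + card (Types - S) * x"
  proof -
    have "Types \<inter> - S = Types - S" by auto
    then show ?thesis using finite_Types by (simp add: sum.If_cases)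
  qed
  then show ?thesis
    unfolding configs_def using sum_prod_PiE_power[OF finite_Types, of "\<lambda>t. if t \<in> S then 1 else x" n] by simp
qed

abbreviation level :: "real \<Rightarrow> nat \<Rightarrow> 't set \<Rightarrow> (nat \<Rightarrow> 't) set" where
  "level \<delta> n S \<equiv> {\<tau> \<in> excited n. frequent \<delta> n \<tau> = S}"

lemma card_configs: "card (configs n) = card Types ^ n"
  unfolding configs_def by (simp add: card_PiE)

text \<open>Split by the set \<open>S\<close> of frequent types. If \<open>S\<close> is not a
  clique, order \<open>n^2\<close> pairs are penalised. If it is a clique of fewer than
  \<open>N\<close> types, the count grows with a base below \<open>N\<close>. If it has size
  \<open>N\<close>, an excited configuration has a vertex outside \<open>S\<close>, and each such
  vertex costs \<open>\<rho> powr (\<delta> * n)\<close>.\<close>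

theorem excited_weight_tendsto_0:
  "(\<lambda>n. (\<Sum>\<tau>\<in>excited n. weight n \<tau>) / real N ^ n) \<longlonglongrightarrow> 0"
proof -
  let ?T = "real (card Types)"
  have T: "?T \<ge> 1" using finite_Types Types_nonempty by (simp add: Suc_leI card_gt_0_iff)
  have N: "real N \<ge> 1" using N_pos by simp
  have z: "4 * ?T \<ge> 1" using T by linarith
  \<comment> \<open>With penalty parameter \<open>4 * ?T\<close> the types outside a small clique
    add at most 1/4 to its size, and \<open>N - 1 + 1 / 4 = N - 3 / 4\<close>. The threshold
    \<open>\<delta>\<close> is small enough for the price of the penalty to keep this base below
    \<open>N\<close>.\<close>
  obtain \<delta> where \<delta>: "\<delta> > 0" "(4 * ?T) powr (?T * \<delta>) * (real N - 3 / 4) < real N"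
    using exists_small_exponent[of "real N - 3 / 4" "real N" "4 * ?T" ?T] T N by auto
  define f where "f S n = (\<Sum>\<tau>\<in>level \<delta> n S. weight n \<tau>) / real N ^ n" for S n
  have sub: "excited n \<subseteq> configs n" for n unfolding excited_def by auto
  have fin: "finite (excited n)" for n using sub finite_configs finite_subset by blast
  have split: "(\<Sum>\<tau>\<in>excited n. weight n \<tau>) / real N ^ n = (\<Sum>S\<in>Pow Types. f S n)" for n
  proof -
    have "(\<Sum>\<tau>\<in>excited n. weight n \<tau>) = (\<Sum>S\<in>Pow Types. \<Sum>\<tau>\<in>level \<delta> n S. weight n \<tau>)"
      by (rule sum.group[symmetric]) (use fin finite_Types in \<open>auto simp: frequent_def\<close>)
    then show ?thesis unfolding f_def by (simp add: sum_divide_distrib)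
  qed
  have f0: "0 \<le> f S n" for S n
    unfolding f_def by (intro divide_nonneg_nonneg sum_nonneg weight_nonneg) auto
  have "f S \<longlonglongrightarrow> 0" if S: "S \<subseteq> Types" for S
  proof (cases "\<forall>s\<in>S. \<forall>t\<in>S. compat s t")
    case False
    then obtain s t where st: "s \<in> S" "t \<in> S" "\<not> compat s t" by blast
    show ?thesis
    proof (rule power_to_zero_of_base_bound[OF f0])
      have "eventually (\<lambda>n. \<delta> * real n \<ge> 2) sequentially" using \<delta>(1) by real_asymp
      then show "eventually (\<lambda>n. f S n \<le> (?T * \<rho> powr (\<delta>\<^sup>2 / 4 * real n)) ^ n) sequentially"
      proof eventually_elim
        case (elim n)
        have "f S n \<le> (\<Sum>\<tau>\<in>level \<delta> n S. weight n \<tau>)"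
        proof -
          have "x / real N ^ n \<le> x" if "x \<ge> 0" for x
            using divide_left_mono[of 1 "real N ^ n" x] that N by (simp add: one_le_power)
          then show ?thesis unfolding f_def by (simp add: sum_nonneg weight_nonneg)
        qed
        also have "\<dots> \<le> (\<Sum>\<tau>\<in>level \<delta> n S. \<rho> powr ((\<delta> * n) ^ 2 / 4))"
          using sub st elim by (intro sum_mono weight_le_of_incompatible_frequent[of _ _ s _ t]) auto
        also have "\<dots> \<le> (\<Sum>\<tau>\<in>configs n. \<rho> powr ((\<delta> * n) ^ 2 / 4))"
          by (intro sum_mono2 finite_configs) (use sub in auto)
        also have "\<dots> = ?T ^ n * (\<rho> powr (\<delta>\<^sup>2 / 4 * n)) ^ n"
          using rho by (simp add: card_configs powr_realpow[symmetric] powr_powr power2_eq_square mult_ac)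
        finally show ?case by (simp add: power_mult_distrib)
      qed
      have "(\<lambda>n. ?T * \<rho> powr (\<delta>\<^sup>2 / 4 * real n)) \<longlonglongrightarrow> ?T * 0"
        by (intro tendsto_mult tendsto_const powr_of_nat_tendsto_0) (use rho \<delta> in auto)
      then show "(\<lambda>n. ?T * \<rho> powr (\<delta>\<^sup>2 / 4 * real n)) \<longlonglongrightarrow> 0" by simp
    qed auto
  next
    case True
    then have "card S \<le> N" using clique_le S by blast
    then consider "card S < N" | "card S = N" by linarith
    then show ?thesis
    proof cases
      case 1
      define b where "b = (4 * ?T) powr (?T * \<delta>) * (card S + card (Types - S) * (1 / (4 * ?T)))"
      have "card (Types - S) \<le> card Types" using finite_Types by (intro card_mono) auto
      then have "real (card (Types - S)) * (1 / (4 * ?T)) \<le> 1 / 4"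
        using T by (simp add: field_simps)
      then have "card S + card (Types - S) * (1 / (4 * ?T)) \<le> real N - 3 / 4"
        using 1 by linarith
      then have "b \<le> (4 * ?T) powr (?T * \<delta>) * (real N - 3 / 4)"
        unfolding b_def by (intro mult_left_mono) auto
      then have b: "b < real N" using \<delta>(2) by linarith
      have b0: "b \<ge> 0" unfolding b_def by (intro mult_nonneg_nonneg add_nonneg_nonneg) auto
      show ?thesis
      proof (rule power_to_zero_of_base_bound[OF f0])
        show "eventually (\<lambda>n. f S n \<le> (b / N) ^ n) sequentially"
        proof (intro always_eventually allI)
          fix n
          have "(\<Sum>\<tau>\<in>level \<delta> n S. weight n \<tau>)
              \<le> (\<Sum>\<tau>\<in>level \<delta> n S. ((4 * ?T) powr (?T * \<delta>)) ^ n *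
                (\<Prod>v\<in>{1..n}. if \<tau> v \<in> S then 1 else 1 / (4 * ?T)))"
          proof (rule sum_mono)
            fix \<tau> assume "\<tau> \<in> level \<delta> n S"
            then have \<tau>: "\<tau> \<in> configs n" "frequent \<delta> n \<tau> = S" using sub by auto
            show "weight n \<tau> \<le> ((4 * ?T) powr (?T * \<delta>)) ^ n *
                (\<Prod>v\<in>{1..n}. if \<tau> v \<in> S then 1 else 1 / (4 * ?T))"
              using weight_le_1[of n \<tau>] one_le_infrequent_product[OF \<tau>(1) less_imp_le[OF \<delta>(1)] z]
              unfolding \<tau>(2) by (rule order_trans)
          qed
          also have "\<dots> \<le> (\<Sum>\<tau>\<in>configs n. ((4 * ?T) powr (?T * \<delta>)) ^ n *
                (\<Prod>v\<in>{1..n}. if \<tau> v \<in> S then 1 else 1 / (4 * ?T)))"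
            by (intro sum_mono2 finite_configs mult_nonneg_nonneg prod_nonneg) (use sub in auto)
          also have "\<dots> = b ^ n"
            unfolding sum_distrib_left[symmetric] sum_configs_product b_def power_mult_distrib
            using S by (simp add: Int_absorb1)
          finally show "f S n \<le> (b / N) ^ n"
            unfolding f_def power_divide using N by (intro divide_right_mono) auto
        qed
        show "(\<lambda>n. b / real N) \<longlonglongrightarrow> b / real N" by simp
        show "b / real N < 1" using b N by simp
      qed (use b0 in auto)
    next
      case 2
      \<comment> \<open>Relative weight per vertex of the types outside \<open>S\<close>;
        \<open>(1 + x n) ^ n - 1\<close> then collects the configurations with at least one vertex
        outside \<open>S\<close>.\<close>
      define x where "x n = card (Types - S) / N * \<rho> powr (\<delta> * real n)" for n
      have ground: "ground_clique S" using 2 True S unfolding ground_clique_def by blast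
      have "eventually (\<lambda>n. norm (f S n) \<le> exp (real n * x n) - 1) sequentially"
      proof (intro always_eventually allI)
        fix n :: nat
        let ?g = "\<lambda>\<tau>. \<Prod>v\<in>{1..n}. if \<tau> v \<in> S then 1 else \<rho> powr (\<delta> * n)"
        define C where "C = (\<Pi>\<^sub>E v\<in>{1..n}. S)"
        have C: "C \<subseteq> configs n" unfolding C_def configs_def using S by (intro PiE_mono) auto
        have finC: "finite C" using C finite_configs finite_subset by blast
        have "(\<Sum>\<tau>\<in>level \<delta> n S. weight n \<tau>) \<le> (\<Sum>\<tau>\<in>level \<delta> n S. ?g \<tau>)"
          using sub ground weight_le_of_ground_frequent by (intro sum_mono) blast
        also have "\<dots> \<le> (\<Sum>\<tau>\<in>configs n - C. ?g \<tau>)"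
        proof (intro sum_mono2 prod_nonneg)
          show "level \<delta> n S \<subseteq> configs n - C"
            using ground unfolding excited_def C_def by fastforce
        qed (use finite_configs in auto)
        also have "\<dots> = (\<Sum>\<tau>\<in>configs n. ?g \<tau>) - (\<Sum>\<tau>\<in>C. ?g \<tau>)"
          by (rule sum_diff[OF finite_configs C])
        also have "(\<Sum>\<tau>\<in>C. ?g \<tau>) = (\<Sum>\<tau>\<in>C. 1)"
          unfolding C_def by (intro sum.cong prod.neutral refl) (auto dest: PiE_mem)
        also have "\<dots> = real N ^ n" unfolding C_def using 2 by (simp add: card_PiE)
        also have "(\<Sum>\<tau>\<in>configs n. ?g \<tau>) = (real N + card (Types - S) * \<rho> powr (\<delta> * n)) ^ n"
          unfolding sum_configs_product using S 2 by (simp add: Int_absorb1)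
        finally have "f S n \<le> ((real N + card (Types - S) * \<rho> powr (\<delta> * n)) ^ n - real N ^ n) / real N ^ n"
          unfolding f_def using N by (intro divide_right_mono) auto
        also have "\<dots> = (1 + x n) ^ n - 1"
        proof -
          have "1 + x n = (real N + card (Types - S) * \<rho> powr (\<delta> * n)) / N"
            unfolding x_def using N by (simp add: field_simps)
          then show ?thesis using N by (simp add: power_divide diff_divide_distrib)
        qed
        also have "\<dots> \<le> exp (real n * x n) - 1"
        proof -
          have "x n \<ge> 0" unfolding x_def using N by simp
          then have "(1 + x n) ^ n \<le> exp (x n) ^ n" by (intro power_mono exp_ge_add_one_self) auto
          then show ?thesis by (simp add: exp_of_nat_mult)
        qed
        finally show "norm (f S n) \<le> exp (real n * x n) - 1" using f0[of S n] by simp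
      qed
      moreover have "(\<lambda>n. exp (real n * x n) - 1) \<longlonglongrightarrow> 0"
      proof -
        have "(\<lambda>n. card (Types - S) / N * (real n * \<rho> powr (\<delta> * real n))) \<longlonglongrightarrow> card (Types - S) / N * 0"
          by (intro tendsto_mult tendsto_const powr_of_nat_tendsto_0) (use rho \<delta> in auto)
        then have "(\<lambda>n. real n * x n) \<longlonglongrightarrow> 0" unfolding x_def by (simp add: mult_ac)
        then have "(\<lambda>n. exp (real n * x n) - 1) \<longlonglongrightarrow> exp 0 - 1" by (intro tendsto_intros)
        then show ?thesis by simp
      qed
      ultimately show ?thesis by (rule Lim_null_comparison)
    qed
  qed
  then have "(\<lambda>n. \<Sum>S\<in>Pow Types. f S n) \<longlonglongrightarrow> (\<Sum>S\<in>Pow Types. 0)"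
    by (intro tendsto_sum) auto
  then show ?thesis unfolding split by simp
qed

end

section \<open>Fourier expansion of the joint probabilities\<close>

definition unit_root :: "nat \<Rightarrow> complex" where
  "unit_root q = exp (2 * of_real pi * \<i> / of_nat q)"

text \<open>Mean of the factor contributed by a fair edge: \<open>unit_root q ^ k\<close> if it is
  present and 1 if it is absent.\<close>

definition edge_mean :: "nat \<Rightarrow> nat \<Rightarrow> complex" where
  "edge_mean q k = (1 + unit_root q ^ k) / 2"

definition label_degree :: "nat set set \<Rightarrow> (nat \<Rightarrow> nat) \<Rightarrow> nat \<Rightarrow> nat" where
  "label_degree G f v = card {e \<in> G. v \<in> e \<and> (\<forall>u\<in>e. f u = f v)}"

definition valid_labelling :: "nat \<Rightarrow> (nat \<Rightarrow> nat) \<Rightarrow> nat \<Rightarrow> nat set set \<Rightarrow> (nat \<Rightarrow> nat) \<Rightarrow> bool" where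
  "valid_labelling q x n G f \<longleftrightarrow> (\<forall>v\<in>{1..n}. [label_degree G f v = x (f v)] (mod q))"

definition valid_prob :: "nat \<Rightarrow> (nat \<Rightarrow> nat) \<Rightarrow> nat \<Rightarrow> nat \<Rightarrow> (nat \<Rightarrow> nat \<Rightarrow> nat) \<Rightarrow> real" where
  "valid_prob q x r n F = real (card {G \<in> Pow (all_edges n). \<forall>i<r. valid_labelling q x n G (\<lambda>v. F v i)})
     / 2 ^ card (all_edges n)"

text \<open>The factor \<open>(q - 1) * x\<close> stands for \<open>- x\<close> modulo \<open>q\<close>, so that all exponents are natural numbers.\<close>

definition phase :: "nat \<Rightarrow> (nat \<Rightarrow> nat) \<Rightarrow> nat \<Rightarrow> vertex_type \<Rightarrow> complex" where
  "phase q x r s = (\<Prod>i<r. unit_root q ^ (snd s i * ((q - 1) * x (fst s i))))"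

lemma unit_root_power: "unit_root q ^ m = exp (2 * of_real pi * \<i> * of_nat m / of_nat q)"
  unfolding unit_root_def exp_of_nat_mult[symmetric] by (simp add: mult_ac)

lemma unit_root_power_eq_1_iff: "q > 0 \<Longrightarrow> unit_root q ^ m = 1 \<longleftrightarrow> q dvd m"
  unfolding unit_root_power by (rule complex_root_unity_eq_1) simp

lemma norm_unit_root: "norm (unit_root q) = 1"
  using norm_exp_i_times[of "2 * pi / q"] unfolding unit_root_def by (simp add: mult_ac)

lemma dvd_indicator_fourier:
  assumes "q > 0"
  shows "(of_bool (q dvd m) :: complex) = (\<Sum>a<q. unit_root q ^ (a * m) / of_nat q)"
proof (cases "q dvd m")
  case True
  then have "unit_root q ^ (a * m) = 1" for a using unit_root_power_eq_1_iff assms by simp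
  then show ?thesis using True assms by simp
next
  case False
  have "(unit_root q ^ m) ^ q = 1"
    unfolding power_mult[symmetric] using unit_root_power_eq_1_iff[OF assms, of "m * q"] by simp
  then have "(\<Sum>a<q. (unit_root q ^ m) ^ a) = 0"
    using False unit_root_power_eq_1_iff[OF assms, of m] by (subst geometric_sum) auto
  then show ?thesis
    using False by (simp add: sum_divide_distrib[symmetric] power_mult[symmetric] mult.commute)
qed

lemma norm_edge_mean_le_1: "norm (edge_mean q k) \<le> 1"
proof -
  have "norm (1 + unit_root q ^ k) \<le> 1 + 1"
    using norm_triangle_ineq[of 1 "unit_root q ^ k"] by (simp add: norm_power norm_unit_root)
  then show ?thesis unfolding edge_mean_def by (simp add: norm_divide)
qed

lemma edge_mean_eq_1: "q > 0 \<Longrightarrow> q dvd k \<Longrightarrow> edge_mean q k = 1"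
  unfolding edge_mean_def using unit_root_power_eq_1_iff by simp

lemma norm_one_plus_unit_less:
  fixes z :: complex
  assumes "norm z = 1" "z \<noteq> 1"
  shows "norm (1 + z) < 2"
proof -
  have sq: "(Re z)\<^sup>2 + (Im z)\<^sup>2 = 1" using assms(1) unfolding cmod_def by (simp add: power2_eq_square)
  have "Re z \<noteq> 1"
  proof
    assume "Re z = 1"
    then show False using sq assms(2) by (auto simp: complex_eq_iff)
  qed
  then have "Re z < 1" using complex_Re_le_cmod[of z] assms(1) by linarith
  have "(norm (1 + z))\<^sup>2 = (1 + Re z)\<^sup>2 + (Im z)\<^sup>2" by (simp add: cmod_power2)
  also have "\<dots> = 2 + 2 * Re z" using sq by (simp add: power2_eq_square algebra_simps)
  also have "\<dots> < 2\<^sup>2" using \<open>Re z < 1\<close> by simp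
  finally show ?thesis by (rule power2_less_imp_less) simp
qed

lemma edge_mean_mod: "q > 0 \<Longrightarrow> edge_mean q k = edge_mean q (k mod q)"
proof -
  assume q: "q > 0"
  have "unit_root q ^ k = unit_root q ^ (k mod q) * unit_root q ^ (q * (k div q))"
    by (simp add: power_add[symmetric])
  also have "unit_root q ^ (q * (k div q)) = 1" using unit_root_power_eq_1_iff[OF q] by simp
  finally show ?thesis unfolding edge_mean_def by simp
qed

lemma edge_mean_gap:
  assumes "q > 0"
  shows "\<exists>\<rho>. 0 < \<rho> \<and> \<rho> < 1 \<and> (\<forall>k. \<not> q dvd k \<longrightarrow> norm (edge_mean q k) \<le> \<rho>)"
proof -
  \<comment> \<open>The entry \<open>1 / 2\<close> keeps the set nonempty and its maximum
    positive.\<close>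
  define R where "R = insert (1 / 2) ((\<lambda>k. norm (edge_mean q k)) ` {k. k < q \<and> \<not> q dvd k})"
  have fin: "finite R" unfolding R_def by auto
  have "norm (edge_mean q k) < 1" if "\<not> q dvd k" for k
    using norm_one_plus_unit_less[of "unit_root q ^ k"] unit_root_power_eq_1_iff[OF assms, of k] that
    unfolding edge_mean_def by (simp add: norm_power norm_unit_root norm_divide)
  then have "Max R < 1" using fin unfolding R_def by (subst Max_less_iff) auto
  moreover have "1 / 2 \<le> Max R" using fin unfolding R_def by (intro Max_ge) auto
  moreover have "norm (edge_mean q k) \<le> Max R" if "\<not> q dvd k" for k
  proof -
    have "norm (edge_mean q (k mod q)) \<in> R"
      using that assms unfolding R_def by (auto intro!: imageI simp: dvd_eq_mod_eq_0)
    then show ?thesis using fin edge_mean_mod[OF assms, of k] by simp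
  qed
  ultimately show ?thesis by (intro exI[of _ "Max R"]) auto
qed

lemma cong_iff_dvd_shift:
  fixes q :: nat
  assumes "q > 0"
  shows "[d = x] (mod q) \<longleftrightarrow> q dvd d + (q - 1) * x"
proof -
  obtain p where p: "q = Suc p" using assms by (cases q) auto
  have "int (d + (q - 1) * x) = (int d - int x) + int q * int x"
    unfolding p by (simp add: algebra_simps)
  then have "q dvd d + (q - 1) * x \<longleftrightarrow> int q dvd int d - int x"
    by (metis dvd_add_left_iff dvd_triv_left int_dvd_int_iff)
  then show ?thesis by (simp add: cong_int_iff[symmetric] cong_iff_dvd_diff)
qed

lemma all_edgesE:
  assumes "e \<in> all_edges n"
  obtains u v where "u < v" "e = {u, v}" "u \<in> {1..n}" "v \<in> {1..n}" "Min e = u" "Max e = v"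
proof -
  have "card e = 2" "e \<subseteq> {1..n}" using assms unfolding all_edges_def by auto
  then obtain a b where ab: "e = {a, b}" "a \<noteq> b" "a \<in> {1..n}" "b \<in> {1..n}" by (auto simp: card_2_iff)
  show ?thesis
  proof (cases "a < b")
    case True
    then show ?thesis using ab by (intro that[of a b]) auto
  next
    case False
    then show ?thesis using ab by (intro that[of b a]) auto
  qed
qed

text \<open>Double counting: an edge inside a part of the \<open>i\<close>-th labelling is seen from
  both ends and collects both phases.\<close>

lemma sum_weighted_degrees:
  assumes G: "G \<subseteq> all_edges n" and fin: "finite G"
  shows "(\<Sum>v\<in>{1..n}. \<Sum>i<r. snd (\<tau> v) i * label_degree G (\<lambda>v. fst (\<tau> v) i) v)
    = (\<Sum>e\<in>G. agreement_sum r (\<tau> (Min e)) (\<tau> (Max e)))"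
proof -
  let ?m = "\<lambda>e v i. v \<in> e \<and> (\<forall>u\<in>e. fst (\<tau> u) i = fst (\<tau> v) i)"
  have deg: "snd (\<tau> v) i * label_degree G (\<lambda>v. fst (\<tau> v) i) v = (\<Sum>e\<in>G. if ?m e v i then snd (\<tau> v) i else 0)" for v i
    unfolding label_degree_def using fin by (simp add: sum.If_cases Int_def mult.commute)
  have edge: "(\<Sum>v\<in>{1..n}. \<Sum>i<r. if ?m e v i then snd (\<tau> v) i else 0) = agreement_sum r (\<tau> (Min e)) (\<tau> (Max e))"
    if e: "e \<in> G" for e
  proof -
    obtain a b where ab: "a < b" "e = {a, b}" "a \<in> {1..n}" "b \<in> {1..n}" "Min e = a" "Max e = b"
      using all_edgesE e G by blast
    have "(\<Sum>v\<in>{1..n}. \<Sum>i<r. if ?m e v i then snd (\<tau> v) i else 0)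
        = (\<Sum>v\<in>{a, b}. \<Sum>i<r. if ?m e v i then snd (\<tau> v) i else 0)"
      by (rule sum.mono_neutral_right) (use ab in auto)
    also have "\<dots> = agreement_sum r (\<tau> a) (\<tau> b)"
      using ab unfolding agreement_sum_def by (auto simp: sum.distrib[symmetric] intro!: sum.cong)
    finally show ?thesis using ab by simp
  qed
  have "(\<Sum>v\<in>{1..n}. \<Sum>i<r. snd (\<tau> v) i * label_degree G (\<lambda>v. fst (\<tau> v) i) v)
    = (\<Sum>v\<in>{1..n}. \<Sum>e\<in>G. \<Sum>i<r. if ?m e v i then snd (\<tau> v) i else 0)"
    unfolding deg by (intro sum.cong refl sum.swap)
  also have "\<dots> = (\<Sum>e\<in>G. \<Sum>v\<in>{1..n}. \<Sum>i<r. if ?m e v i then snd (\<tau> v) i else 0)"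
    by (rule sum.swap)
  finally show ?thesis using edge by simp
qed

lemma sum_subsets_prod:
  fixes z :: "'a \<Rightarrow> complex"
  assumes "finite E"
  shows "(\<Sum>G\<in>Pow E. \<Prod>e\<in>G. z e) / 2 ^ card E = (\<Prod>e\<in>E. (1 + z e) / 2)"
proof -
  have "(\<Prod>e\<in>E. z e + 1) = (\<Sum>G\<in>Pow E. \<Prod>e\<in>G. z e)"
    using prod_add[OF assms, of z "\<lambda>_. 1"] by simp
  then show ?thesis by (simp add: prod_dividef add.commute)
qed

definition pair_config :: "nat \<Rightarrow> (nat \<Rightarrow> nat \<Rightarrow> nat) \<Rightarrow> (nat \<Rightarrow> nat \<Rightarrow> nat) \<Rightarrow> nat \<Rightarrow> vertex_type" where
  "pair_config n F A = (\<lambda>v\<in>{1..n}. (F v, A v))"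

definition config_term :: "nat \<Rightarrow> (nat \<Rightarrow> nat) \<Rightarrow> nat \<Rightarrow> nat \<Rightarrow> (nat \<Rightarrow> vertex_type) \<Rightarrow> complex" where
  "config_term q x r n \<tau> = (\<Prod>v\<in>{1..n}. phase q x r (\<tau> v)) *
     (\<Prod>e\<in>all_edges n. edge_mean q (agreement_sum r (\<tau> (Min e)) (\<tau> (Max e))))"

text \<open>Each of the \<open>r * n\<close> congruences is expanded in characters of Z/q.
  Distributing the product selects one phase per vertex and coordinate, which is the function
  \<open>A\<close>; regrouping the exponents by edges makes the summand multiplicative over
  \<open>G\<close>, ready for averaging.\<close>

lemma valid_indicator_fourier:
  assumes q: "q > 0" and G: "G \<subseteq> all_edges n"
  shows "(of_bool (\<forall>i<r. valid_labelling q x n G (\<lambda>v. F v i)) :: complex) =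
    (\<Sum>A\<in>(\<Pi>\<^sub>E v\<in>{1..n}. \<Pi>\<^sub>E i\<in>{..<r}. {..<q}).
      (\<Prod>v\<in>{1..n}. phase q x r (F v, A v)) *
      (\<Prod>e\<in>G. unit_root q ^ agreement_sum r (pair_config n F A (Min e)) (pair_config n F A (Max e)))) / of_nat q ^ (r * n)"
proof -
  let ?w = "unit_root q"
  let ?d = "\<lambda>v i. label_degree G (\<lambda>v. F v i) v"
  let ?y = "\<lambda>v i. (q - 1) * x (F v i)"
  have finG: "finite G" using G finite_subset[OF _ finite_all_edges] by blast
  have "(of_bool (\<forall>i<r. valid_labelling q x n G (\<lambda>v. F v i)) :: complex) =
      (\<Prod>v\<in>{1..n}. \<Prod>i<r. of_bool (q dvd ?d v i + ?y v i))"
  proof (cases "\<forall>i<r. valid_labelling q x n G (\<lambda>v. F v i)")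
    case True
    then have "\<forall>v\<in>{1..n}. \<forall>i<r. q dvd ?d v i + ?y v i"
      unfolding valid_labelling_def using cong_iff_dvd_shift[OF q] by auto
    then show ?thesis using True by (auto intro!: prod.neutral[symmetric])
  next
    case False
    then obtain i v where "i < r" "v \<in> {1..n}" "\<not> q dvd ?d v i + ?y v i"
      unfolding valid_labelling_def using cong_iff_dvd_shift[OF q] by auto
    then have v: "v \<in> {1..n}" "(\<Prod>i<r. (of_bool (q dvd ?d v i + ?y v i) :: complex)) = 0"
      by auto
    have "(\<Prod>v\<in>{1..n}. \<Prod>i<r. (of_bool (q dvd ?d v i + ?y v i) :: complex)) = 0"
    proof (rule prod_zero)
      show "\<exists>v\<in>{1..n}. (\<Prod>i<r. (of_bool (q dvd ?d v i + ?y v i) :: complex)) = 0" using v by blast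
    qed simp
    moreover have "(of_bool (\<forall>i<r. valid_labelling q x n G (\<lambda>v. F v i)) :: complex) = 0"
      using False by simp
    ultimately show ?thesis by (simp only:)
  qed
  also have "\<dots> = (\<Prod>v\<in>{1..n}. \<Prod>i<r. \<Sum>a<q. ?w ^ (a * (?d v i + ?y v i)) / of_nat q)"
    unfolding dvd_indicator_fourier[OF q] ..
  also have "\<dots> = (\<Prod>v\<in>{1..n}. \<Sum>\<alpha>\<in>(\<Pi>\<^sub>E i\<in>{..<r}. {..<q}). \<Prod>i<r. ?w ^ (\<alpha> i * (?d v i + ?y v i)) / of_nat q)"
    by (intro prod.cong refl prod_sum_PiE) auto
  also have "\<dots> = (\<Sum>A\<in>(\<Pi>\<^sub>E v\<in>{1..n}. \<Pi>\<^sub>E i\<in>{..<r}. {..<q}). \<Prod>v\<in>{1..n}. \<Prod>i<r. ?w ^ (A v i * (?d v i + ?y v i)) / of_nat q)"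
    by (intro prod_sum_PiE) (auto intro: finite_PiE)
  also have "\<dots> = (\<Sum>A\<in>(\<Pi>\<^sub>E v\<in>{1..n}. \<Pi>\<^sub>E i\<in>{..<r}. {..<q}).
      (\<Prod>v\<in>{1..n}. phase q x r (F v, A v)) *
      (\<Prod>e\<in>G. ?w ^ agreement_sum r (pair_config n F A (Min e)) (pair_config n F A (Max e))) / of_nat q ^ (r * n))"
  proof (intro sum.cong refl)
    fix A
    let ?\<tau> = "pair_config n F A"
    have "(\<Prod>v\<in>{1..n}. \<Prod>i<r. ?w ^ (A v i * (?d v i + ?y v i)) / of_nat q)
        = (\<Prod>v\<in>{1..n}. (\<Prod>i<r. ?w ^ (A v i * ?y v i)) * (\<Prod>i<r. ?w ^ (A v i * ?d v i)) / of_nat q ^ r)"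
      by (simp add: prod_dividef prod.distrib[symmetric] distrib_left power_add mult.commute)
    also have "\<dots> = (\<Prod>v\<in>{1..n}. phase q x r (F v, A v)) * (\<Prod>v\<in>{1..n}. \<Prod>i<r. ?w ^ (A v i * ?d v i)) / of_nat q ^ (r * n)"
      unfolding phase_def by (simp add: prod_dividef prod.distrib power_mult)
    also have "(\<Prod>v\<in>{1..n}. \<Prod>i<r. ?w ^ (A v i * ?d v i)) = ?w ^ (\<Sum>v\<in>{1..n}. \<Sum>i<r. A v i * ?d v i)"
      by (simp add: power_sum)
    also have "(\<Sum>v\<in>{1..n}. \<Sum>i<r. A v i * ?d v i) =
        (\<Sum>v\<in>{1..n}. \<Sum>i<r. snd (?\<tau> v) i * label_degree G (\<lambda>v. fst (?\<tau> v) i) v)"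
    proof (intro sum.cong refl)
      fix v i assume v: "v \<in> {1..n}"
      \<comment> \<open>\<open>pair_config\<close> agrees with \<open>F\<close> only on
        \<open>{1..n}\<close>; edges stay inside this set, so comparing labels along an edge is
        unaffected.\<close>
      have "{e \<in> G. v \<in> e \<and> (\<forall>u\<in>e. F u i = F v i)} = {e \<in> G. v \<in> e \<and> (\<forall>u\<in>e. fst (?\<tau> u) i = fst (?\<tau> v) i)}"
      proof (intro Collect_cong conj_cong refl ball_cong)
        fix e u assume e: "e \<in> G" "v \<in> e" "u \<in> e"
        then have "e \<subseteq> {1..n}" using G unfolding all_edges_def by blast
        then have "u \<in> {1..n}" using e(3) by blast
        then show "(F u i = F v i) = (fst (?\<tau> u) i = fst (?\<tau> v) i)"
          using v unfolding pair_config_def by simp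
      qed
      then show "A v i * ?d v i = snd (?\<tau> v) i * label_degree G (\<lambda>v. fst (?\<tau> v) i) v"
        using v unfolding label_degree_def pair_config_def by simp
    qed
    also have "\<dots> = (\<Sum>e\<in>G. agreement_sum r (?\<tau> (Min e)) (?\<tau> (Max e)))"
      by (rule sum_weighted_degrees[OF G finG])
    finally show "(\<Prod>v\<in>{1..n}. \<Prod>i<r. ?w ^ (A v i * (?d v i + ?y v i)) / of_nat q) =
      (\<Prod>v\<in>{1..n}. phase q x r (F v, A v)) *
      (\<Prod>e\<in>G. ?w ^ agreement_sum r (?\<tau> (Min e)) (?\<tau> (Max e))) / of_nat q ^ (r * n)"
      by (simp add: power_sum)
  qed
  finally show ?thesis by (simp add: sum_divide_distrib)
qed

lemma valid_prob_fourier: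
  assumes q: "q > 0"
  shows "of_real (valid_prob q x r n F) =
    (\<Sum>A\<in>(\<Pi>\<^sub>E v\<in>{1..n}. \<Pi>\<^sub>E i\<in>{..<r}. {..<q}). config_term q x r n (pair_config n F A)) / of_nat q ^ (r * n)"
proof -
  let ?E = "all_edges n"
  let ?A = "\<Pi>\<^sub>E v\<in>{1..n}. \<Pi>\<^sub>E i\<in>{..<r}. {..<q}"
  let ?k = "\<lambda>A e. agreement_sum r (pair_config n F A (Min e)) (pair_config n F A (Max e))"
  have fin: "finite ?E" by (rule finite_all_edges)
  have "of_real (valid_prob q x r n F) = (\<Sum>G\<in>Pow ?E. of_bool (\<forall>i<r. valid_labelling q x n G (\<lambda>v. F v i)) :: complex) / 2 ^ card ?E"
    unfolding valid_prob_def using fin by (simp add: of_bool_def sum.If_cases Int_def)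
  also have "(\<Sum>G\<in>Pow ?E. of_bool (\<forall>i<r. valid_labelling q x n G (\<lambda>v. F v i)) :: complex) =
      (\<Sum>G\<in>Pow ?E. \<Sum>A\<in>?A. (\<Prod>v\<in>{1..n}. phase q x r (F v, A v)) * (\<Prod>e\<in>G. unit_root q ^ ?k A e)) / of_nat q ^ (r * n)"
    using valid_indicator_fourier[OF q] by (simp add: sum_divide_distrib)
  also have "\<dots> = (\<Sum>A\<in>?A. (\<Prod>v\<in>{1..n}. phase q x r (F v, A v)) * (\<Sum>G\<in>Pow ?E. \<Prod>e\<in>G. unit_root q ^ ?k A e)) / of_nat q ^ (r * n)"
    by (subst sum.swap) (simp add: sum_distrib_left)
  also have "\<dots> / 2 ^ card ?E = (\<Sum>A\<in>?A. (\<Prod>v\<in>{1..n}. phase q x r (F v, A v)) * ((\<Sum>G\<in>Pow ?E. \<Prod>e\<in>G. unit_root q ^ ?k A e) / 2 ^ card ?E)) / of_nat q ^ (r * n)"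
  proof -
    have "(\<Sum>A\<in>?A. c A * S A) / Q / M = (\<Sum>A\<in>?A. c A * (S A / M)) / Q" for c S :: "(nat \<Rightarrow> nat \<Rightarrow> nat) \<Rightarrow> complex" and Q M
      by (simp add: sum_divide_distrib mult.commute)
    then show ?thesis .
  qed
  also have "\<dots> = (\<Sum>A\<in>?A. config_term q x r n (pair_config n F A)) / of_nat q ^ (r * n)"
    unfolding sum_subsets_prod[OF fin] config_term_def edge_mean_def pair_config_def by simp
  finally show ?thesis .
qed

section \<open>Limits of the joint moments\<close>

definition edge_gap :: "nat \<Rightarrow> real" where
  "edge_gap q = (SOME \<rho>. 0 < \<rho> \<and> \<rho> < 1 \<and> (\<forall>k. \<not> q dvd k \<longrightarrow> norm (edge_mean q k) \<le> \<rho>))"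

lemma edge_gap:
  assumes "q > 0"
  shows "0 < edge_gap q" "edge_gap q < 1" "\<not> q dvd k \<Longrightarrow> norm (edge_mean q k) \<le> edge_gap q"
  using someI_ex[OF edge_mean_gap[OF assms]] unfolding edge_gap_def by blast+

text \<open>Union bound over the missed value \<open>p\<close>: since \<open>p\<close> is attained
  on \<open>S\<close>, avoiding it leaves at most \<open>card S - 1\<close> choices per vertex, an
  exponentially small share of all \<open>card S ^ n\<close> functions.\<close>

lemma card_missing_value:
  fixes g :: "'t \<Rightarrow> 'l"
  assumes "finite S" "finite L" "L \<subseteq> g ` S"
  shows "card {\<tau> \<in> (\<Pi>\<^sub>E v\<in>{1..n::nat}. S). \<exists>p\<in>L. \<forall>v\<in>{1..n}. g (\<tau> v) \<noteq> p} \<le> card L * (card S - 1) ^ n"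
proof -
  have "{\<tau> \<in> (\<Pi>\<^sub>E v\<in>{1..n}. S). \<exists>p\<in>L. \<forall>v\<in>{1..n}. g (\<tau> v) \<noteq> p}
      \<subseteq> (\<Union>p\<in>L. \<Pi>\<^sub>E v\<in>{1..n}. {s \<in> S. g s \<noteq> p})"
  proof
    fix \<tau> assume "\<tau> \<in> {\<tau> \<in> (\<Pi>\<^sub>E v\<in>{1..n}. S). \<exists>p\<in>L. \<forall>v\<in>{1..n}. g (\<tau> v) \<noteq> p}"
    then obtain p where "\<tau> \<in> (\<Pi>\<^sub>E v\<in>{1..n}. S)" "p \<in> L" "\<forall>v\<in>{1..n}. g (\<tau> v) \<noteq> p" by blast
    then show "\<tau> \<in> (\<Union>p\<in>L. \<Pi>\<^sub>E v\<in>{1..n}. {s \<in> S. g s \<noteq> p})"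
      by (intro UN_I[of p]) (auto simp: PiE_iff)
  qed
  then have "card {\<tau> \<in> (\<Pi>\<^sub>E v\<in>{1..n}. S). \<exists>p\<in>L. \<forall>v\<in>{1..n}. g (\<tau> v) \<noteq> p}
      \<le> card (\<Union>p\<in>L. \<Pi>\<^sub>E v\<in>{1..n}. {s \<in> S. g s \<noteq> p})"
    using assms by (intro card_mono) (auto intro!: finite_PiE)
  also have "\<dots> \<le> (\<Sum>p\<in>L. card (\<Pi>\<^sub>E v\<in>{1..n}. {s \<in> S. g s \<noteq> p}))"
    by (rule card_UN_le[OF assms(2)])
  also have "\<dots> \<le> (\<Sum>p\<in>L. (card S - 1) ^ n)"
  proof (rule sum_mono)
    fix p assume "p \<in> L"
    then obtain s where s: "s \<in> S" "g s = p" using assms(3) by blast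
    have "card {s \<in> S. g s \<noteq> p} \<le> card (S - {s})"
      using assms(1) s by (intro card_mono) auto
    then show "card (\<Pi>\<^sub>E v\<in>{1..n}. {s \<in> S. g s \<noteq> p}) \<le> (card S - 1) ^ n"
      using s assms(1) by (simp add: card_PiE power_mono)
  qed
  finally show ?thesis by simp
qed

lemma missing_value_ratio_tendsto_0:
  fixes M :: nat
  assumes "M \<ge> 1"
  shows "(\<lambda>n. K * real (M - 1) ^ n / real M ^ n) \<longlonglongrightarrow> 0"
proof -
  have "(\<lambda>n. K * (real (M - 1) / real M) ^ n) \<longlonglongrightarrow> K * 0"
    using assms by (intro tendsto_mult tendsto_const LIMSEQ_realpow_zero) auto
  then show ?thesis by (simp add: power_divide)
qed

text \<open>\<open>x j\<close> is the degree residue prescribed for label \<open>j\<close>, and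
  \<open>r\<close> is the order of the moment.\<close>

locale degree_moments =
  fixes q r :: nat and x :: "nat \<Rightarrow> nat"
  assumes q_ge_3: "q \<ge> 3"
begin

lemma q_pos: "q > 0" using q_ge_3 by simp

sublocale spin_system "vertex_types q r" "compatible q r"
  "\<lambda>s t. norm (edge_mean q (agreement_sum r s t))" "edge_gap q" "q ^ r"
proof
  show "vertex_types q r \<noteq> {}"
    unfolding vertex_types_def using q_pos by (auto simp: PiE_eq_empty_iff)
  show "q ^ r \<ge> 1" using q_pos by simp
  show "card S \<le> q ^ r" if "S \<subseteq> vertex_types q r" "\<And>s t. s \<in> S \<Longrightarrow> t \<in> S \<Longrightarrow> compatible q r s t" for S
    using clique_card_le that by blast
  show "card S < q ^ r"
    if "S \<subseteq> vertex_types q r" "\<And>s t. s \<in> S \<Longrightarrow> t \<in> S \<Longrightarrow> compatible q r s t"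
      "u \<in> vertex_types q r" "u \<notin> S" "\<And>s. s \<in> S \<Longrightarrow> compatible q r u s" for S u
    using extendable_clique_card_less[of S q r u] that by blast
qed (use edge_gap[OF q_pos] norm_edge_mean_le_1 finite_vertex_types compatible_commute in \<open>auto simp: compatible_def\<close>)

definition labels :: "(nat \<Rightarrow> nat) set" where
  "labels = (\<Pi>\<^sub>E i\<in>{..<r}. {..<q})"

definition families :: "nat \<Rightarrow> (nat \<Rightarrow> nat \<Rightarrow> nat) set" where
  "families n = (\<Pi>\<^sub>E v\<in>{1..n}. labels)"

definition label_part :: "nat \<Rightarrow> (nat \<Rightarrow> vertex_type) \<Rightarrow> nat \<Rightarrow> nat \<Rightarrow> nat" where
  "label_part n \<tau> = (\<lambda>v\<in>{1..n}. fst (\<tau> v))"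

definition onto_families :: "nat \<Rightarrow> (nat \<Rightarrow> nat \<Rightarrow> nat) set" where
  "onto_families n = {F \<in> families n. labels \<subseteq> F ` {1..n}}"

definition inequivalent :: "nat \<Rightarrow> (nat \<Rightarrow> nat \<Rightarrow> nat) \<Rightarrow> bool" where
  "inequivalent n F \<longleftrightarrow> \<not> (\<exists>i<r. \<exists>j<r. i \<noteq> j \<and>
     (\<exists>\<pi>. bij_betw \<pi> {..<q} {..<q} \<and> (\<forall>v\<in>{1..n}. F v i = \<pi> (F v j))))"

text \<open>The error families of the factorial moments. Families with tied coordinates are left
  out, since they can carry the weight of a lower moment.\<close>

definition sparse_families :: "nat \<Rightarrow> (nat \<Rightarrow> nat \<Rightarrow> nat) set" where
  "sparse_families n = {F \<in> families n. \<not> labels \<subseteq> F ` {1..n} \<and> inequivalent n F}"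

abbreviation "prob n F \<equiv> valid_prob q x r n F"

abbreviation "cterm n \<tau> \<equiv> config_term q x r n \<tau>"

lemma finite_labels: "finite labels" unfolding labels_def by (intro finite_PiE) auto

lemma card_labels: "card labels = q ^ r" unfolding labels_def by (simp add: card_PiE)

lemma finite_families: "finite (families n)"
  unfolding families_def by (intro finite_PiE finite_labels) auto

lemma vertex_types_eq: "vertex_types q r = labels \<times> labels"
  unfolding vertex_types_def labels_def ..

lemma configs_eq: "configs n = (\<Pi>\<^sub>E v\<in>{1..n}. labels \<times> labels)"
  by (simp only: configs_def) (simp only: vertex_types_eq)

lemma norm_phase: "norm (phase q x r s) = 1"
  unfolding phase_def by (simp add: prod_norm[symmetric] norm_power norm_unit_root)

lemma norm_config_term: "norm (cterm n \<tau>) = weight n \<tau>"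
  unfolding config_term_def weight_def norm_mult prod_norm[symmetric] norm_phase by simp

lemma sum_pair_config:
  assumes "\<F> \<subseteq> families n"
  shows "(\<Sum>F\<in>\<F>. \<Sum>A\<in>families n. g (pair_config n F A)) = (\<Sum>\<tau>\<in>{\<tau> \<in> configs n. label_part n \<tau> \<in> \<F>}. g \<tau>)"
  unfolding sum.cartesian_product
proof (rule sum.reindex_bij_witness[where i = "\<lambda>\<tau>. (label_part n \<tau>, \<lambda>v\<in>{1..n}. snd (\<tau> v))"
      and j = "\<lambda>(F, A). pair_config n F A"], goal_cases)
  case (1 p)
  then have "fst p \<in> extensional {1..n}" "snd p \<in> extensional {1..n}"
    using assms unfolding families_def by (auto simp: PiE_def)
  then have "label_part n (pair_config n (fst p) (snd p)) = fst p"
      "(\<lambda>v\<in>{1..n}. snd (pair_config n (fst p) (snd p) v)) = snd p"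
    unfolding label_part_def pair_config_def by (auto simp: extensional_def)
  then show ?case by (auto split: prod.splits)
next
  case (2 p)
  obtain F A where p: "p = (F, A)" "F \<in> \<F>" "F \<in> families n" "A \<in> families n" using 2 assms by auto
  have "label_part n (pair_config n F A) = F"
    using p(3) unfolding label_part_def pair_config_def families_def by (auto simp: extensional_def PiE_def)
  moreover have "pair_config n F A \<in> configs n"
    using p(3,4) unfolding pair_config_def configs_eq families_def
    by (auto simp: PiE_iff)
  ultimately show ?case using p by simp
next
  case (3 \<tau>)
  then show ?case
    unfolding label_part_def pair_config_def configs_def by (auto simp: PiE_def extensional_def)
next
  case (4 \<tau>)
  then show ?case
    unfolding configs_eq families_def by (auto simp: PiE_iff mem_Times_iff)
next
  case (5 p)
  then show ?case by (auto split: prod.splits)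
qed

lemma sum_valid_prob:
  assumes "\<F> \<subseteq> families n"
  shows "of_real (\<Sum>F\<in>\<F>. prob n F) =
    (\<Sum>\<tau>\<in>{\<tau> \<in> configs n. label_part n \<tau> \<in> \<F>}. cterm n \<tau>) / of_real (real (q ^ r) ^ n)"
proof -
  have "of_real (\<Sum>F\<in>\<F>. prob n F) =
     (\<Sum>F\<in>\<F>. \<Sum>A\<in>families n. cterm n (pair_config n F A)) / of_nat q ^ (r * n)"
    unfolding of_real_sum valid_prob_fourier[OF q_pos] families_def labels_def
    by (simp add: sum_divide_distrib)
  also have "\<dots> = (\<Sum>\<tau>\<in>{\<tau> \<in> configs n. label_part n \<tau> \<in> \<F>}. cterm n \<tau>) / of_nat q ^ (r * n)"
    unfolding sum_pair_config[OF assms] ..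
  finally show ?thesis by (simp add: power_mult)
qed

lemma valid_prob_nonneg: "0 \<le> prob n F"
  unfolding valid_prob_def by simp

lemma sum_valid_prob_le:
  assumes "\<F> \<subseteq> families n"
  shows "(\<Sum>F\<in>\<F>. prob n F) \<le>
    (\<Sum>\<tau>\<in>{\<tau> \<in> configs n. label_part n \<tau> \<in> \<F>}. weight n \<tau>) / real (q ^ r) ^ n"
proof -
  have "(\<Sum>F\<in>\<F>. prob n F) = norm (complex_of_real (\<Sum>F\<in>\<F>. prob n F))"
    unfolding norm_of_real using valid_prob_nonneg by (simp add: sum_nonneg)
  also have "\<dots> = norm (\<Sum>\<tau>\<in>{\<tau> \<in> configs n. label_part n \<tau> \<in> \<F>}. cterm n \<tau>) / real (q ^ r) ^ n"
    unfolding sum_valid_prob[OF assms] norm_divide norm_of_real by simp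
  also have "\<dots> \<le> (\<Sum>\<tau>\<in>{\<tau> \<in> configs n. label_part n \<tau> \<in> \<F>}. weight n \<tau>) / real (q ^ r) ^ n"
    unfolding norm_config_term[symmetric] by (intro divide_right_mono norm_sum) auto
  finally show ?thesis .
qed

lemma ground_cliqueD:
  assumes "ground_clique S"
  shows "S \<subseteq> vertex_types q r" "card S = q ^ r" "s \<in> S \<Longrightarrow> t \<in> S \<Longrightarrow> compatible q r s t" "finite S"
  using assms finite_subset[OF _ finite_vertex_types] unfolding ground_clique_def by blast+

text \<open>A permutation tying two coordinates throughout \<open>S\<close> would tie them in
  \<open>\<tau>\<close> as well, so only the first alternative of
  \<open>maximal_clique_structure\<close> is left. As the family is not onto, a label vector
  available in \<open>S\<close> is missed, and such configurations are rare.\<close>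

lemma sparse_ground_configs:
  assumes "\<tau> \<in> configs n" "label_part n \<tau> \<in> sparse_families n" "ground_clique S" "\<tau> ` {1..n} \<subseteq> S"
  shows "labels \<subseteq> fst ` S" "\<exists>p\<in>labels. \<forall>v\<in>{1..n}. fst (\<tau> v) \<noteq> p"
proof -
  note S = ground_cliqueD[OF assms(3)]
  have "\<not> (\<exists>i<r. \<exists>j<r. i \<noteq> j \<and> (\<exists>\<pi>. bij_betw \<pi> {..<q} {..<q} \<and> (\<forall>s\<in>S. fst s i = \<pi> (fst s j))))"
  proof (rule notI, elim exE conjE)
    fix i j \<pi> assume ij: "i < r" "j < r" "i \<noteq> j" "bij_betw \<pi> {..<q} {..<q}" "\<forall>s\<in>S. fst s i = \<pi> (fst s j)"
    have "\<forall>v\<in>{1..n}. label_part n \<tau> v i = \<pi> (label_part n \<tau> v j)"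
    proof
      fix v assume v: "v \<in> {1..n}"
      then have "\<tau> v \<in> S" using assms(4) by blast
      then show "label_part n \<tau> v i = \<pi> (label_part n \<tau> v j)"
        using ij(5) v unfolding label_part_def by simp
    qed
    then show False using assms(2) ij(1-4) unfolding sparse_families_def inequivalent_def by blast
  qed
  then have full: "\<forall>p. (\<forall>i<r. p i < q) \<longrightarrow> (\<exists>s\<in>S. \<forall>i<r. fst s i = p i)"
    using maximal_clique_structure[OF S(3) S(1) S(2) q_ge_3] by blast
  show "labels \<subseteq> fst ` S"
  proof
    fix p assume p: "p \<in> labels"
    then have "\<forall>i<r. p i < q" unfolding labels_def by (auto simp: PiE_iff)
    then obtain s where s: "s \<in> S" "\<forall>i<r. fst s i = p i" using full by blast
    then have "fst s = p"
      using p vertex_types_ext(1)[OF subsetD[OF S(1) s(1)]] unfolding labels_def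
      by (intro extensionalityI[of _ "{..<r}"]) (auto simp: PiE_iff)
    then show "p \<in> fst ` S" using s by blast
  qed
  obtain p where p: "p \<in> labels" "p \<notin> label_part n \<tau> ` {1..n}"
    using assms(2) unfolding sparse_families_def by blast
  have "fst (\<tau> v) \<noteq> p" if "v \<in> {1..n}" for v
    using p(2) that unfolding label_part_def by auto
  then show "\<exists>p\<in>labels. \<forall>v\<in>{1..n}. fst (\<tau> v) \<noteq> p" using p(1) by blast
qed

theorem sparse_families_tendsto_0:
  "(\<lambda>n. \<Sum>F\<in>sparse_families n. prob n F) \<longlonglongrightarrow> 0"
proof -
  let ?N = "real (q ^ r)"
  \<comment> \<open>At most \<open>2 ^ card (vertex_types q r)\<close> ground cliques, and
    \<open>q ^ r\<close> label vectors that can be missed.\<close>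
  let ?K = "real (2 ^ card (vertex_types q r) * q ^ r)"
  define \<G> where "\<G> = {S. ground_clique S \<and> labels \<subseteq> fst ` S}"
  have G: "\<G> \<subseteq> Pow (vertex_types q r)" unfolding \<G>_def using ground_cliqueD(1) by blast
  have finG: "finite \<G>" using G finite_vertex_types finite_subset by (metis finite_Pow_iff)
  have cardG: "card \<G> \<le> 2 ^ card (vertex_types q r)"
    using card_mono[OF _ G] finite_vertex_types by (simp add: card_Pow)
  have "(\<Sum>F\<in>sparse_families n. prob n F) \<le>
      (\<Sum>\<tau>\<in>excited n. weight n \<tau>) / ?N ^ n + ?K * real (q ^ r - 1) ^ n / ?N ^ n" for n
  proof -
    let ?A = "{\<tau> \<in> configs n. label_part n \<tau> \<in> sparse_families n}"
    let ?M = "\<lambda>S. {\<tau> \<in> (\<Pi>\<^sub>E v\<in>{1..n}. S). \<exists>p\<in>labels. \<forall>v\<in>{1..n}. fst (\<tau> v) \<noteq> p}"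
    have finM: "finite (?M S)" if "S \<in> \<G>" for S
      using that ground_cliqueD(4)[of S] unfolding \<G>_def by (auto intro!: finite_PiE)
    have finE: "finite (excited n)" using finite_configs unfolding excited_def by auto
    have finU: "finite (\<Union>S\<in>\<G>. ?M S)" using finG finM by blast
    have "?A \<subseteq> excited n \<union> (\<Union>S\<in>\<G>. ?M S)"
    proof
      fix \<tau> assume \<tau>: "\<tau> \<in> ?A"
      show "\<tau> \<in> excited n \<union> (\<Union>S\<in>\<G>. ?M S)"
      proof (cases "\<tau> \<in> excited n")
        case False
        then obtain S where S: "ground_clique S" "\<tau> ` {1..n} \<subseteq> S"
          using \<tau> unfolding excited_def by blast
        have "\<tau> \<in> (\<Pi>\<^sub>E v\<in>{1..n}. S)" using \<tau> S(2) unfolding configs_def by (auto simp: PiE_iff)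
        then show ?thesis using sparse_ground_configs[OF _ _ S] \<tau> S(1) unfolding \<G>_def by blast
      qed simp
    qed
    then have "(\<Sum>\<tau>\<in>?A. weight n \<tau>) \<le> (\<Sum>\<tau>\<in>excited n \<union> (\<Union>S\<in>\<G>. ?M S). weight n \<tau>)"
      using finE finU weight_nonneg by (intro sum_mono2) auto
    also have "\<dots> \<le> (\<Sum>\<tau>\<in>excited n. weight n \<tau>) + (\<Sum>\<tau>\<in>(\<Union>S\<in>\<G>. ?M S). weight n \<tau>)"
      using sum.union_inter[OF finE finU, of "weight n"]
        sum_nonneg[of "excited n \<inter> (\<Union>S\<in>\<G>. ?M S)" "weight n"] weight_nonneg by simp
    also have "(\<Sum>\<tau>\<in>(\<Union>S\<in>\<G>. ?M S). weight n \<tau>) \<le> (\<Sum>\<tau>\<in>(\<Union>S\<in>\<G>. ?M S). 1)"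
      by (intro sum_mono weight_le_1)
    also have "\<dots> = real (card (\<Union>S\<in>\<G>. ?M S))" by simp
    also have "\<dots> \<le> ?K * real (q ^ r - 1) ^ n"
    proof -
      have "card (\<Union>S\<in>\<G>. ?M S) \<le> (\<Sum>S\<in>\<G>. card (?M S))" by (rule card_UN_le[OF finG])
      also have "\<dots> \<le> (\<Sum>S\<in>\<G>. q ^ r * (q ^ r - 1) ^ n)"
      proof (rule sum_mono)
        fix S assume "S \<in> \<G>"
        then have S: "ground_clique S" "labels \<subseteq> fst ` S" unfolding \<G>_def by auto
        show "card (?M S) \<le> q ^ r * (q ^ r - 1) ^ n"
          using card_missing_value[OF ground_cliqueD(4)[OF S(1)] finite_labels S(2), of n]
          unfolding card_labels ground_cliqueD(2)[OF S(1)] .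
      qed
      also have "\<dots> \<le> 2 ^ card (vertex_types q r) * (q ^ r * (q ^ r - 1) ^ n)"
        using cardG by simp
      finally have "real (card (\<Union>S\<in>\<G>. ?M S)) \<le> real (2 ^ card (vertex_types q r) * (q ^ r * (q ^ r - 1) ^ n))"
        by (simp only: of_nat_le_iff)
      then show ?thesis by (simp add: mult.assoc)
    qed
    finally have "(\<Sum>\<tau>\<in>?A. weight n \<tau>) / ?N ^ n \<le>
        ((\<Sum>\<tau>\<in>excited n. weight n \<tau>) + ?K * real (q ^ r - 1) ^ n) / ?N ^ n"
      by (intro divide_right_mono) auto
    then show ?thesis
      using sum_valid_prob_le[of "sparse_families n" n] unfolding add_divide_distrib
      by (auto simp: sparse_families_def)
  qed
  then have bound: "eventually (\<lambda>n. norm (\<Sum>F\<in>sparse_families n. prob n F) \<le>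
      (\<Sum>\<tau>\<in>excited n. weight n \<tau>) / ?N ^ n + ?K * real (q ^ r - 1) ^ n / ?N ^ n) sequentially"
    using valid_prob_nonneg by (simp add: sum_nonneg)
  have "(\<lambda>n. (\<Sum>\<tau>\<in>excited n. weight n \<tau>) / ?N ^ n + ?K * real (q ^ r - 1) ^ n / ?N ^ n) \<longlonglongrightarrow> 0 + 0"
    using q_pos by (intro tendsto_add excited_weight_tendsto_0 missing_value_ratio_tendsto_0) simp
  then show ?thesis using Lim_null_comparison[OF bound] by simp
qed

end

section \<open>Two-torsion phases and the main term\<close>

definition half_elements :: "nat \<Rightarrow> nat set" where
  "half_elements q = {b \<in> {..<q}. q dvd 2 * b}"

text \<open>Its \<open>r\<close>-th power is the main term of the \<open>r\<close>-th joint moment.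
  Each \<open>b\<close> assigns a 2-torsion phase to every label, and the base of the power is the
  mean of the resulting character over a uniform label.\<close>

definition character_sum :: "nat \<Rightarrow> (nat \<Rightarrow> nat) \<Rightarrow> nat \<Rightarrow> complex" where
  "character_sum q x n = (\<Sum>b\<in>(\<Pi>\<^sub>E j\<in>{..<q}. half_elements q).
     ((\<Sum>j<q. unit_root q ^ (b j * ((q - 1) * x j))) / of_nat q) ^ n)"

lemma finite_half_elements: "finite (half_elements q)"
  unfolding half_elements_def by simp

lemma not_subset_image_iff: "\<not> L \<subseteq> f ` V \<longleftrightarrow> (\<exists>p\<in>L. \<forall>v\<in>V. f v \<noteq> p)"
  unfolding subset_iff image_iff by metis

context degree_moments
begin

definition twists :: "(nat \<Rightarrow> nat \<Rightarrow> nat) set" where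
  "twists = (\<Pi>\<^sub>E i\<in>{..<r}. \<Pi>\<^sub>E j\<in>{..<q}. half_elements q)"

definition twist :: "nat \<Rightarrow> (nat \<Rightarrow> nat \<Rightarrow> nat) \<Rightarrow> (nat \<Rightarrow> nat \<Rightarrow> nat) \<Rightarrow> nat \<Rightarrow> vertex_type" where
  "twist n \<beta> F = (\<lambda>v\<in>{1..n}. (F v, \<lambda>i\<in>{..<r}. \<beta> i (F v i)))"

abbreviation twist_phase :: "nat \<Rightarrow> (nat \<Rightarrow> nat \<Rightarrow> nat) \<Rightarrow> (nat \<Rightarrow> nat \<Rightarrow> nat) \<Rightarrow> complex" where
  "twist_phase n \<beta> F \<equiv> \<Prod>v\<in>{1..n}. \<Prod>i<r. unit_root q ^ (\<beta> i (F v i) * ((q - 1) * x (F v i)))"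

lemma familiesD: "F \<in> families n \<Longrightarrow> v \<in> {1..n} \<Longrightarrow> F v \<in> labels"
    "F \<in> families n \<Longrightarrow> v \<in> {1..n} \<Longrightarrow> i < r \<Longrightarrow> F v i < q"
  unfolding families_def labels_def by (blast dest: PiE_mem)+

lemma twistsD:
  assumes "\<beta> \<in> twists" "i < r" "j < q"
  shows "\<beta> i j < q" "q dvd 2 * \<beta> i j"
  using PiE_mem[OF PiE_mem[OF assms(1)[unfolded twists_def]], of i j] assms(2,3)
  unfolding half_elements_def by auto

lemma label_part_twist: "F \<in> families n \<Longrightarrow> label_part n (twist n \<beta> F) = F"
  unfolding label_part_def twist_def families_def by (auto simp: PiE_def extensional_def)

lemma twist_configs:
  assumes "\<beta> \<in> twists" "F \<in> families n"
  shows "twist n \<beta> F \<in> configs n"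
proof -
  have "(\<lambda>i\<in>{..<r}. \<beta> i (F v i)) \<in> labels" if "v \<in> {1..n}" for v
    using twistsD(1)[OF assms(1)] familiesD(2)[OF assms(2) that] unfolding labels_def by simp
  then show ?thesis
    using familiesD(1)[OF assms(2)] unfolding twist_def configs_eq by simp
qed

text \<open>Ends that share a label carry the same phase, and twice a 2-torsion phase is 0 modulo
  \<open>q\<close>; so every edge mean equals 1 and only the vertex phases remain.\<close>

lemma config_term_twist:
  assumes \<beta>: "\<beta> \<in> twists" and F: "F \<in> families n"
  shows "cterm n (twist n \<beta> F) =
    twist_phase n \<beta> F"
proof -
  have "edge_mean q (agreement_sum r (twist n \<beta> F (Min e)) (twist n \<beta> F (Max e))) = 1"
    if e: "e \<in> all_edges n" for e
  proof -
    obtain a b where ab: "a \<in> {1..n}" "b \<in> {1..n}" "Min e = a" "Max e = b"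
      using all_edgesE[OF e] by metis
    have "q dvd agreement_sum r (twist n \<beta> F a) (twist n \<beta> F b)"
      unfolding agreement_sum_def
    proof (rule dvd_sum)
      fix i assume "i \<in> {..<r}"
      then show "q dvd (if fst (twist n \<beta> F a) i = fst (twist n \<beta> F b) i
           then snd (twist n \<beta> F a) i + snd (twist n \<beta> F b) i else 0)"
        using ab(1,2) twistsD(2)[OF \<beta>, of i "F a i"] familiesD(2)[OF F]
        unfolding twist_def by (auto simp: mult_2)
    qed
    then show ?thesis using edge_mean_eq_1[OF q_pos] ab by simp
  qed
  then show ?thesis unfolding config_term_def phase_def twist_def by simp
qed

text \<open>An onto family forces the surrounding clique to contain every label vector, and
  \<open>full_clique_labels\<close> then makes each phase a 2-torsion function of the label
  alone.\<close>

lemma ground_onto_twist: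
  assumes \<tau>: "\<tau> \<in> configs n" "label_part n \<tau> \<in> onto_families n"
    and S: "ground_clique S" "\<tau> ` {1..n} \<subseteq> S"
  shows "\<exists>\<beta>\<in>twists. \<tau> = twist n \<beta> (label_part n \<tau>)"
proof -
  note G = ground_cliqueD[OF S(1)]
  have full: "\<exists>s\<in>S. \<forall>i<r. fst s i = p i" if p: "\<And>i. i < r \<Longrightarrow> p i < q" for p
  proof -
    have "(\<lambda>i\<in>{..<r}. p i) \<in> labels" using p unfolding labels_def by auto
    then obtain v where v: "v \<in> {1..n}" "label_part n \<tau> v = (\<lambda>i\<in>{..<r}. p i)"
      using \<tau>(2) unfolding onto_families_def by (auto simp: image_iff)
    then have "\<forall>i<r. fst (\<tau> v) i = p i" unfolding label_part_def by simp
    then show ?thesis using v(1) S(2) by blast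
  qed
  have const: "snd s i = snd s' i" "q dvd 2 * snd s i"
    if "s \<in> S" "s' \<in> S" "i < r" "fst s i = fst s' i" for s s' i
    by (rule full_clique_labels[OF G(3) G(1) q_ge_3 full]; use that in blast)+
  \<comment> \<open>Any member of \<open>S\<close> with label \<open>j\<close> at coordinate
    \<open>i\<close> reveals the phase; \<open>const\<close> makes the choice immaterial.\<close>
  define s where "s i j = (SOME s. s \<in> S \<and> fst s i = j)" for i j
  have s: "s i j \<in> S \<and> fst (s i j) i = j" if ij: "i < r" "j < q" for i j
  proof -
    obtain u where "u \<in> S" "\<forall>l<r. fst u l = j" using full[of "\<lambda>_. j"] ij by blast
    then have "u \<in> S \<and> fst u i = j" using ij by blast
    then show ?thesis unfolding s_def by (rule someI)
  qed
  define \<beta> where "\<beta> = (\<lambda>i\<in>{..<r}. \<lambda>j\<in>{..<q}. snd (s i j) i)"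
  have "\<beta> \<in> twists"
  proof -
    have "snd (s i j) i \<in> half_elements q" if ij: "i < r" "j < q" for i j
    proof -
      have "s i j \<in> S" using s[OF ij] by simp
      then show ?thesis
        using const(2)[of "s i j" "s i j" i] vertex_typesD(2)[OF subsetD[OF G(1)]] ij
        unfolding half_elements_def by auto
    qed
    then show ?thesis unfolding \<beta>_def twists_def by auto
  qed
  moreover have "\<tau> = twist n \<beta> (label_part n \<tau>)"
  proof (rule extensionalityI[of _ "{1..n}"])
    show "\<tau> \<in> extensional {1..n}" using \<tau>(1) unfolding configs_eq by (simp add: PiE_def)
    show "twist n \<beta> (label_part n \<tau>) \<in> extensional {1..n}" unfolding twist_def by simp
    fix v assume v: "v \<in> {1..n}"
    have \<tau>v: "\<tau> v \<in> S" using v S(2) by blast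
    have ty: "\<tau> v \<in> vertex_types q r" using \<tau>v G(1) by blast
    have "snd (\<tau> v) i = \<beta> i (fst (\<tau> v) i)" if i: "i < r" for i
    proof -
      have j: "fst (\<tau> v) i < q" using vertex_typesD(1)[OF ty i] .
      have "snd (\<tau> v) i = snd (s i (fst (\<tau> v) i)) i"
        using s[OF i j] \<tau>v i by (intro const(1)) auto
      then show ?thesis using i j unfolding \<beta>_def by simp
    qed
    then have "snd (\<tau> v) = (\<lambda>i\<in>{..<r}. \<beta> i (fst (\<tau> v) i))"
      using vertex_types_ext(2)[OF ty] by (intro extensionalityI[of _ "{..<r}"]) auto
    then show "\<tau> v = twist n \<beta> (label_part n \<tau>) v"
      using v unfolding twist_def label_part_def by (simp add: prod_eq_iff)
  qed
  ultimately show ?thesis by blast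
qed

text \<open>Each value \<open>\<beta> i j\<close> can be read off at a vertex whose label vector is
  constantly \<open>j\<close>; such a vertex exists because \<open>F\<close> is onto.\<close>

lemma twist_inj: "inj_on (\<lambda>(\<beta>, F). twist n \<beta> F) (twists \<times> onto_families n)"
proof (rule inj_onI, clarify)
  fix \<beta> F \<beta>' F' assume \<beta>: "\<beta> \<in> twists" "\<beta>' \<in> twists" and F: "F \<in> onto_families n" "F' \<in> onto_families n"
    and eq: "twist n \<beta> F = twist n \<beta>' F'"
  have FF: "F \<in> families n" "F' \<in> families n" using F unfolding onto_families_def by auto
  then have "F = F'" using label_part_twist eq by metis
  moreover have "\<beta> i j = \<beta>' i j" if ij: "i < r" "j < q" for i j
  proof -
    have "(\<lambda>_\<in>{..<r}. j) \<in> labels" using ij unfolding labels_def by auto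
    then obtain v where v: "v \<in> {1..n}" "F v = (\<lambda>_\<in>{..<r}. j)"
      using F(1) unfolding onto_families_def by (auto simp: image_iff)
    have "snd (twist n \<beta> F v) i = snd (twist n \<beta>' F v) i" using eq \<open>F = F'\<close> by simp
    then show ?thesis using v ij unfolding twist_def by simp
  qed
  then have "\<beta> i = \<beta>' i" if i: "i < r" for i
    using PiE_mem[OF \<beta>(1)[unfolded twists_def], of i] PiE_mem[OF \<beta>(2)[unfolded twists_def], of i] i
    by (intro PiE_ext[of "\<beta> i" "{..<q}" "\<lambda>_. half_elements q" "\<beta>' i"]) auto
  then have "\<beta> = \<beta>'"
    using \<beta> unfolding twists_def by (intro PiE_ext[of \<beta> _ _ \<beta>']) auto
  ultimately show "\<beta> = \<beta>' \<and> F = F'" by simp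
qed

text \<open>Over all families, onto or not, the vertices decouple and then the coordinates, which
  yields an \<open>r\<close>-th power.\<close>

lemma sum_families_twist:
  "(\<Sum>\<beta>\<in>twists. \<Sum>F\<in>families n. twist_phase n \<beta> F)
    = character_sum q x n ^ r * of_real (real (q ^ r) ^ n)"
proof -
  let ?c = "\<lambda>b. \<Sum>j<q. unit_root q ^ (b j * ((q - 1) * x j))"
  have "(\<Sum>F\<in>families n. twist_phase n \<beta> F)
      = (\<Prod>i<r. ?c (\<beta> i)) ^ n" for \<beta>
  proof -
    have "(\<Sum>F\<in>families n. twist_phase n \<beta> F)
      = (\<Sum>p\<in>labels. \<Prod>i<r. unit_root q ^ (\<beta> i (p i) * ((q - 1) * x (p i)))) ^ n"
      unfolding families_def
      by (rule sum_prod_PiE_power[OF finite_labels, of "\<lambda>p. \<Prod>i<r. unit_root q ^ (\<beta> i (p i) * ((q - 1) * x (p i)))"])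
    also have "(\<Sum>p\<in>labels. \<Prod>i<r. unit_root q ^ (\<beta> i (p i) * ((q - 1) * x (p i)))) = (\<Prod>i<r. ?c (\<beta> i))"
      unfolding labels_def by (rule prod_sum_PiE[symmetric]) auto
    finally show ?thesis .
  qed
  then have "(\<Sum>\<beta>\<in>twists. \<Sum>F\<in>families n. twist_phase n \<beta> F)
    = (\<Sum>\<beta>\<in>twists. \<Prod>i<r. ?c (\<beta> i) ^ n)"
    by (simp add: prod_power_distrib)
  also have "\<dots> = (\<Prod>i<r. \<Sum>b\<in>(\<Pi>\<^sub>E j\<in>{..<q}. half_elements q). ?c b ^ n)"
    unfolding twists_def by (rule prod_sum_PiE[symmetric]) (auto intro!: finite_PiE finite_half_elements)
  also have "\<dots> = (\<Sum>b\<in>(\<Pi>\<^sub>E j\<in>{..<q}. half_elements q). ?c b ^ n) ^ r" by simp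
  also have "(\<Sum>b\<in>(\<Pi>\<^sub>E j\<in>{..<q}. half_elements q). ?c b ^ n) = character_sum q x n * of_nat q ^ n"
    using q_pos unfolding character_sum_def by (simp add: power_divide sum_divide_distrib[symmetric])
  finally show ?thesis by (simp add: power_mult_distrib power_mult[symmetric] mult.commute)
qed

text \<open>A configuration with onto labels is a 2-torsion twist or excited. The twists are summed
  over all families, where the sum factorises; the families added for this purpose are exponentially
  rare.\<close>

theorem onto_families_limit:
  "(\<lambda>n. of_real (\<Sum>F\<in>onto_families n. prob n F) - character_sum q x n ^ r) \<longlonglongrightarrow> 0"
proof -
  let ?N = "real (q ^ r)"
  let ?K = "real (card twists * q ^ r)"
  have "norm (of_real (\<Sum>F\<in>onto_families n. prob n F) - character_sum q x n ^ r)
      \<le> (\<Sum>\<tau>\<in>excited n. weight n \<tau>) / ?N ^ n + ?K * real (q ^ r - 1) ^ n / ?N ^ n" for n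
  proof -
    let ?T = "{\<tau> \<in> configs n. label_part n \<tau> \<in> onto_families n}"
    let ?M = "(\<lambda>(\<beta>, F). twist n \<beta> F) ` (twists \<times> onto_families n)"
    have sub: "onto_families n \<subseteq> families n" unfolding onto_families_def by auto
    have MT: "?M \<subseteq> ?T"
      using sub twist_configs label_part_twist by auto
    have finT: "finite ?T" using finite_configs by simp
    have rest: "?T - ?M \<subseteq> excited n"
    proof
      fix \<tau> assume \<tau>: "\<tau> \<in> ?T - ?M"
      show "\<tau> \<in> excited n"
      proof (rule ccontr)
        assume "\<tau> \<notin> excited n"
        then obtain S where S: "ground_clique S" "\<tau> ` {1..n} \<subseteq> S"
          using \<tau> unfolding excited_def by blast
        then obtain \<beta> where "\<beta> \<in> twists" "\<tau> = twist n \<beta> (label_part n \<tau>)"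
          using ground_onto_twist[OF _ _ S] \<tau> by blast
        then have "\<tau> \<in> ?M" using \<tau> by (intro image_eqI[of _ _ "(\<beta>, label_part n \<tau>)"]) auto
        then show False using \<tau> by blast
      qed
    qed
    have main: "(\<Sum>\<tau>\<in>?M. cterm n \<tau>) = (\<Sum>\<beta>\<in>twists. \<Sum>F\<in>onto_families n. twist_phase n \<beta> F)"
    proof -
      have "(\<Sum>\<tau>\<in>?M. cterm n \<tau>) = (\<Sum>(\<beta>, F)\<in>twists \<times> onto_families n. cterm n (twist n \<beta> F))"
        by (subst sum.reindex[OF twist_inj]) (simp add: case_prod_unfold)
      also have "\<dots> = (\<Sum>\<beta>\<in>twists. \<Sum>F\<in>onto_families n. cterm n (twist n \<beta> F))"
        by (rule sum.cartesian_product[symmetric])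
      also have "\<dots> = (\<Sum>\<beta>\<in>twists. \<Sum>F\<in>onto_families n. twist_phase n \<beta> F)"
        using sub by (intro sum.cong refl config_term_twist) auto
      finally show ?thesis .
    qed
    let ?D = "\<Sum>\<beta>\<in>twists. \<Sum>F\<in>families n - onto_families n. twist_phase n \<beta> F"
    have "(\<Sum>\<beta>\<in>twists. \<Sum>F\<in>onto_families n. twist_phase n \<beta> F) =
        (\<Sum>\<beta>\<in>twists. (\<Sum>F\<in>families n. twist_phase n \<beta> F) - (\<Sum>F\<in>families n - onto_families n. twist_phase n \<beta> F))"
      by (intro sum.cong refl) (simp add: sum.subset_diff[OF sub finite_families])
    also have "\<dots> = character_sum q x n ^ r * of_real (?N ^ n) - ?D"
      unfolding sum_subtractf sum_families_twist ..
    finally have M: "(\<Sum>\<tau>\<in>?M. cterm n \<tau>) = character_sum q x n ^ r * of_real (?N ^ n) - ?D"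
      unfolding main .
    have N0: "complex_of_real (?N ^ n) \<noteq> 0" using q_pos by simp
    have "of_real (\<Sum>F\<in>onto_families n. prob n F) =
        ((\<Sum>\<tau>\<in>?T - ?M. cterm n \<tau>) + (\<Sum>\<tau>\<in>?M. cterm n \<tau>)) / of_real (?N ^ n)"
      unfolding sum_valid_prob[OF sub] sum.subset_diff[OF MT finT] ..
    then have "of_real (\<Sum>F\<in>onto_families n. prob n F) - character_sum q x n ^ r =
        ((\<Sum>\<tau>\<in>?T - ?M. cterm n \<tau>) - ?D) / of_real (?N ^ n)"
      unfolding M using N0 by (simp add: field_simps)
    then have "norm (of_real (\<Sum>F\<in>onto_families n. prob n F) - character_sum q x n ^ r) =
        norm ((\<Sum>\<tau>\<in>?T - ?M. cterm n \<tau>) - ?D) / ?N ^ n"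
      by (simp only: norm_divide norm_of_real abs_of_nonneg zero_le_power of_nat_0_le_iff)
    also have "\<dots> \<le> ((\<Sum>\<tau>\<in>excited n. weight n \<tau>) + ?K * real (q ^ r - 1) ^ n) / ?N ^ n"
    proof (rule divide_right_mono)
      have "norm (\<Sum>\<tau>\<in>?T - ?M. cterm n \<tau>) \<le> (\<Sum>\<tau>\<in>?T - ?M. weight n \<tau>)"
        unfolding norm_config_term[symmetric] by (rule norm_sum)
      also have "\<dots> \<le> (\<Sum>\<tau>\<in>excited n. weight n \<tau>)"
        using rest weight_nonneg finite_configs by (intro sum_mono2) (auto simp: excited_def)
      finally have 1: "norm (\<Sum>\<tau>\<in>?T - ?M. cterm n \<tau>) \<le> (\<Sum>\<tau>\<in>excited n. weight n \<tau>)" .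
      have "norm ?D \<le> (\<Sum>\<beta>\<in>twists. \<Sum>F\<in>families n - onto_families n. norm (twist_phase n \<beta> F))"
        by (intro order_trans[OF norm_sum] sum_mono norm_sum)
      also have "\<dots> = real (card twists * card (families n - onto_families n))"
        by (simp add: prod_norm[symmetric] norm_power norm_unit_root)
      also have "\<dots> \<le> real (card twists * (q ^ r * (q ^ r - 1) ^ n))"
      proof -
        have "families n - onto_families n = {F \<in> (\<Pi>\<^sub>E v\<in>{1..n}. labels). \<exists>p\<in>labels. \<forall>v\<in>{1..n}. id (F v) \<noteq> p}"
          unfolding families_def onto_families_def id_def not_subset_image_iff[symmetric] by blast
        then have "card (families n - onto_families n) \<le> q ^ r * (q ^ r - 1) ^ n"
          using card_missing_value[OF finite_labels finite_labels, of id n] card_labels by simp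
        then show ?thesis unfolding of_nat_le_iff by (rule mult_le_mono2)
      qed
      finally have 2: "norm ?D \<le> ?K * real (q ^ r - 1) ^ n" by (simp add: mult.assoc)
      show "norm ((\<Sum>\<tau>\<in>?T - ?M. cterm n \<tau>) - ?D) \<le>
          (\<Sum>\<tau>\<in>excited n. weight n \<tau>) + ?K * real (q ^ r - 1) ^ n"
        using norm_triangle_ineq4[of "\<Sum>\<tau>\<in>?T - ?M. cterm n \<tau>" ?D] 1 2 by linarith
    qed simp
    finally show ?thesis unfolding add_divide_distrib .
  qed
  then have bound: "eventually (\<lambda>n. norm (of_real (\<Sum>F\<in>onto_families n. prob n F) - character_sum q x n ^ r)
      \<le> (\<Sum>\<tau>\<in>excited n. weight n \<tau>) / ?N ^ n + ?K * real (q ^ r - 1) ^ n / ?N ^ n) sequentially"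
    by simp
  have "(\<lambda>n. (\<Sum>\<tau>\<in>excited n. weight n \<tau>) / ?N ^ n + ?K * real (q ^ r - 1) ^ n / ?N ^ n) \<longlonglongrightarrow> 0 + 0"
    using q_pos by (intro tendsto_add excited_weight_tendsto_0 missing_value_ratio_tendsto_0) simp
  then show ?thesis using Lim_null_comparison[OF bound] by simp
qed

end

section \<open>Evaluating the character sum by the parity of \<open>q\<close>\<close>

lemma half_elements_odd:
  assumes "odd q"
  shows "half_elements q = {0}"
proof -
  have "b = 0" if "b < q" "q dvd 2 * b" for b
  proof -
    have "coprime q 2" using assms by simp
    then have "q dvd b" using that(2) coprime_dvd_mult_right_iff by blast
    then show "b = 0" using that(1) nat_dvd_not_less by blast
  qed
  then show ?thesis using assms unfolding half_elements_def by (auto simp: odd_pos)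
qed

lemma half_elements_even:
  assumes "even q" "q > 0"
  shows "half_elements q = {0, q div 2}"
proof -
  obtain k where k: "q = 2 * k" "k > 0" using assms by (auto elim!: evenE)
  have "b = 0 \<or> b = k" if b: "b < 2 * k" "2 * k dvd 2 * b" for b
  proof -
    obtain c where c: "b = k * c" using b(2) k(2) by (auto elim!: dvdE)
    then have "c < 2" using b(1) k(2) by (metis mult.commute nat_mult_less_cancel1)
    then show ?thesis using c by (cases c) auto
  qed
  then show ?thesis using k unfolding half_elements_def by auto
qed

text \<open>Odd \<open>q\<close> has no nonzero 2-torsion, so the trivial twist stands alone and no
  parity condition appears.\<close>

lemma character_sum_odd:
  assumes "odd q"
  shows "character_sum q x n = 1"
proof -
  have "q > 0" using assms by (rule odd_pos)
  have "(\<Pi>\<^sub>E j\<in>{..<q}. half_elements q) = {\<lambda>j\<in>{..<q}. 0}"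
    unfolding half_elements_odd[OF assms] by (auto simp: PiE_iff extensional_def fun_eq_iff)
  then show ?thesis using \<open>q > 0\<close> unfolding character_sum_def by simp
qed

lemma unit_root_half:
  assumes "even q" "q > 0"
  shows "unit_root q ^ (q div 2 * m) = (-1) ^ m"
proof -
  have "unit_root q ^ (q div 2) = exp (of_real pi * \<i>)"
    using assms unfolding unit_root_power by (auto elim!: evenE)
  also have "\<dots> = -1" by (simp add: exp_pi_i)
  finally show ?thesis by (simp add: power_mult)
qed

text \<open>For a twist \<open>b\<close> by 2-torsion phases, the labels with character value -1;
  the phase \<open>q div 2\<close> at an even residue is invisible.\<close>

definition flipped :: "nat \<Rightarrow> (nat \<Rightarrow> nat) \<Rightarrow> (nat \<Rightarrow> nat) \<Rightarrow> nat set" where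
  "flipped q x b = {j \<in> {..<q}. b j \<noteq> 0 \<and> odd (x j)}"

lemma character_mean_even:
  assumes q: "even q" "q > 0" and b: "b \<in> (\<Pi>\<^sub>E j\<in>{..<q}. half_elements q)"
  shows "(\<Sum>j<q. unit_root q ^ (b j * ((q - 1) * x j))) / of_nat q
    = of_real (1 - 2 * real (card (flipped q x b)) / real q)"
proof -
  have summand: "unit_root q ^ (b j * ((q - 1) * x j)) = (if j \<in> flipped q x b then -1 else 1)" if "j < q" for j
  proof -
    have "b j = 0 \<or> b j = q div 2" using PiE_mem[OF b] that half_elements_even[OF q] by auto
    then show ?thesis
    proof
      assume "b j = q div 2"
      moreover have "q div 2 \<noteq> 0" using q by (auto elim!: evenE)
      \<comment> \<open>\<open>q - 1\<close> is odd, so the sign depends on the parity of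
        \<open>x j\<close> alone.\<close>
      ultimately show ?thesis
        using unit_root_half[OF q, of "(q - 1) * x j"] that q unfolding flipped_def by simp
    qed (simp add: flipped_def)
  qed
  have sub: "flipped q x b \<subseteq> {..<q}" unfolding flipped_def by auto
  have "(\<Sum>j<q. unit_root q ^ (b j * ((q - 1) * x j))) = (\<Sum>j<q. if j \<in> flipped q x b then -1 else (1::complex))"
    using summand by simp
  also have "\<dots> = (\<Sum>j<q. 1 - (if j \<in> flipped q x b then 2 else (0::complex)))"
    by (intro sum.cong) auto
  also have "\<dots> = of_nat q - 2 * of_nat (card (flipped q x b))"
    using sub by (simp add: sum_subtractf sum.If_cases Int_absorb1)
  finally show ?thesis using q(2) by (simp add: field_simps)
qed

text \<open>The mean of the signs lies strictly between -1 and 1 unless all signs agree.\<close>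

lemma flipped_mean_power_tendsto_0:
  assumes "q > 0" "flipped q x b \<noteq> {}" "flipped q x b \<noteq> {..<q}"
  shows "(\<lambda>n. complex_of_real (1 - 2 * real (card (flipped q x b)) / real q) ^ n) \<longlonglongrightarrow> 0"
proof -
  let ?c = "card (flipped q x b)"
  have sub: "flipped q x b \<subseteq> {..<q}" unfolding flipped_def by auto
  have fin: "finite (flipped q x b)" using sub finite_subset by blast
  have "?c < card {..<q}" using sub assms(3) by (intro psubset_card_mono) auto
  then have "?c < q" by simp
  moreover have "?c > 0" using assms(2) fin by (simp add: card_gt_0_iff)
  ultimately have "\<bar>1 - 2 * real ?c / real q\<bar> < 1" by (simp add: abs_less_iff field_simps)
  then have "norm (complex_of_real (1 - 2 * real ?c / real q)) < 1" by (simp only: norm_of_real)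
  then show ?thesis by (rule LIMSEQ_power_zero)
qed

text \<open>A twist is invisible exactly when it is supported on labels of even residue, where it is
  free.\<close>

lemma card_unflipped:
  assumes q: "even q" "q > 0"
  shows "card {b \<in> (\<Pi>\<^sub>E j\<in>{..<q}. half_elements q). flipped q x b = {}} = 2 ^ card {j \<in> {..<q}. even (x j)}"
proof -
  have "{b \<in> (\<Pi>\<^sub>E j\<in>{..<q}. half_elements q). flipped q x b = {}}
      = (\<Pi>\<^sub>E j\<in>{..<q}. if even (x j) then {0, q div 2} else {0})"
  proof -
    have "b \<in> (\<Pi>\<^sub>E j\<in>{..<q}. {0, q div 2}) \<and> flipped q x b = {} \<longleftrightarrow>
        b \<in> (\<Pi>\<^sub>E j\<in>{..<q}. if even (x j) then {0, q div 2} else {0})" for b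
    proof -
      have "(\<forall>j\<in>{..<q}. b j \<in> {0, q div 2}) \<and> (\<forall>j\<in>{..<q}. \<not> (b j \<noteq> 0 \<and> odd (x j))) \<longleftrightarrow>
          (\<forall>j\<in>{..<q}. b j \<in> (if even (x j) then {0, q div 2} else {0}))"
        unfolding ball_conj_distrib[symmetric] by (intro ball_cong refl) auto
      then show ?thesis unfolding PiE_iff flipped_def by blast
    qed
    then show ?thesis unfolding half_elements_even[OF q] by blast
  qed
  moreover have "q div 2 \<noteq> 0" using q by (auto elim!: evenE)
  then have "card (if even (x j) then {0, q div 2} else {0}) = (if even (x j) then 2 else 1)" for j
    by simp
  ultimately show ?thesis by (simp add: card_PiE prod.If_cases Int_def)
qed

lemma character_sum_even:
  assumes q: "even q" "q > 0"
  shows "character_sum q x n = (\<Sum>b\<in>(\<Pi>\<^sub>E j\<in>{..<q}. half_elements q).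
    complex_of_real (1 - 2 * real (card (flipped q x b)) / real q) ^ n)"
  unfolding character_sum_def using character_mean_even[OF q] by simp

lemma finite_twist_functions: "finite (\<Pi>\<^sub>E j\<in>{..<q}. half_elements q)"
  by (intro finite_PiE finite_half_elements) auto

text \<open>A label of even residue never flips, so no twist has mean -1; only the invisible twists
  survive, each contributing 1.\<close>

lemma character_sum_limit_even_label:
  assumes q: "even q" "q > 0" and j: "j < q" "even (x j)"
  shows "character_sum q x \<longlonglongrightarrow> 2 ^ card {j \<in> {..<q}. even (x j)}"
proof -
  let ?B = "\<Pi>\<^sub>E j\<in>{..<q}. half_elements q"
  have "(\<lambda>n. complex_of_real (1 - 2 * real (card (flipped q x b)) / real q) ^ n)
      \<longlonglongrightarrow> (if flipped q x b = {} then 1 else 0)" for b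
  proof -
    have "flipped q x b \<noteq> {..<q}" using j unfolding flipped_def by auto
    then show ?thesis using flipped_mean_power_tendsto_0[OF q(2), of x b] by auto
  qed
  then have "(\<lambda>n. \<Sum>b\<in>?B. complex_of_real (1 - 2 * real (card (flipped q x b)) / real q) ^ n)
      \<longlonglongrightarrow> (\<Sum>b\<in>?B. if flipped q x b = {} then 1 else 0)"
    by (intro tendsto_sum)
  moreover have "(\<Sum>b\<in>?B. if flipped q x b = {} then 1 else (0::complex)) = 2 ^ card {j \<in> {..<q}. even (x j)}"
  proof -
    have "(\<Sum>b\<in>?B. if flipped q x b = {} then 1 else (0::complex)) = of_nat (card {b \<in> ?B. flipped q x b = {}})"
      using finite_twist_functions by (simp add: sum.If_cases Int_def)
    then show ?thesis unfolding card_unflipped[OF q] by simp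
  qed
  ultimately show ?thesis unfolding character_sum_even[OF q, abs_def] by simp
qed

text \<open>Besides the trivial twist, the constant twist \<open>q div 2\<close> flips every label
  and has mean -1. Its powers are 1 at even and -1 at odd exponents, hence the restriction to even
  arguments.\<close>

lemma character_sum_limit_odd_labels:
  assumes q: "even q" "q > 0" and odd: "\<And>j. j < q \<Longrightarrow> odd (x j)"
  shows "(\<lambda>m. character_sum q x (2 * m)) \<longlonglongrightarrow> 2"
proof -
  let ?B = "\<Pi>\<^sub>E j\<in>{..<q}. half_elements q"
  let ?z = "\<lambda>b. complex_of_real (1 - 2 * real (card (flipped q x b)) / real q)"
  let ?b = "\<lambda>j\<in>{..<q}. q div 2"
  have half: "q div 2 \<noteq> 0" using q by (auto elim!: evenE)
  have full: "flipped q x b = {..<q} \<longleftrightarrow> b = ?b" if b: "b \<in> ?B" for b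
  proof
    assume f: "flipped q x b = {..<q}"
    show "b = ?b"
    proof (rule PiE_ext[OF b])
      show "?b \<in> ?B" using half_elements_even[OF q] by auto
      fix j assume j: "j \<in> {..<q}"
      then have "b j \<noteq> 0" using f unfolding flipped_def by blast
      then show "b j = ?b j" using PiE_mem[OF b j] half_elements_even[OF q] j by auto
    qed
  qed (use half odd in \<open>auto simp: flipped_def\<close>)
  have "(\<lambda>m. ?z b ^ (2 * m)) \<longlonglongrightarrow> (if flipped q x b = {} then 1 else 0) + (if flipped q x b = {..<q} then 1 else 0)" for b
  proof -
    consider "flipped q x b = {}" | "flipped q x b = {..<q}" | "flipped q x b \<noteq> {}" "flipped q x b \<noteq> {..<q}" by blast
    then show ?thesis
    proof cases
      case 3
      have "filterlim (\<lambda>m::nat. 2 * m) at_top at_top" by (rule filterlim_subseq) (simp add: strict_mono_def)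
      from filterlim_compose[OF flipped_mean_power_tendsto_0[OF q(2) 3] this] show ?thesis using 3 by simp
    qed (use q(2) in \<open>auto simp: lessThan_empty_iff power_mult\<close>)
  qed
  then have "(\<lambda>m. \<Sum>b\<in>?B. ?z b ^ (2 * m))
      \<longlonglongrightarrow> (\<Sum>b\<in>?B. (if flipped q x b = {} then 1 else 0) + (if flipped q x b = {..<q} then 1 else 0))"
    by (intro tendsto_sum)
  moreover have "(\<Sum>b\<in>?B. (if flipped q x b = {} then 1 else 0) + (if flipped q x b = {..<q} then 1 else (0::complex))) = 2"
  proof -
    have 1: "(\<Sum>b\<in>?B. if flipped q x b = {} then 1 else (0::complex)) = of_nat (card {b \<in> ?B. flipped q x b = {}})"
      using finite_twist_functions by (simp add: sum.If_cases Int_def)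
    have "{j \<in> {..<q}. even (x j)} = {}" using odd by auto
    then have 2: "card {b \<in> ?B. flipped q x b = {}} = 1" unfolding card_unflipped[OF q] by simp
    have "(\<Sum>b\<in>?B. if flipped q x b = {..<q} then 1 else (0::complex)) = (\<Sum>b\<in>?B. if b = ?b then 1 else 0)"
      using full by (intro sum.cong) auto
    also have "\<dots> = 1" using finite_twist_functions[of q] half_elements_even[OF q] by (subst sum.delta) (simp_all del: finite_PiE)
    finally show ?thesis unfolding sum.distrib 1 2 by simp
  qed
  ultimately show ?thesis unfolding character_sum_even[OF q] by simp
qed

section \<open>Tuples of parts as labellings\<close>

text \<open>Such a permutation splits into independent permutations of the fibres. For the residue
  map the product is the order of the group of admissible relabellings.\<close>

lemma card_fibre_preserving_permutations:
  fixes x :: "'s \<Rightarrow> 'c"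
  assumes "finite S" "finite C" "x ` S \<subseteq> C"
  shows "card {\<rho>. \<rho> permutes S \<and> (\<forall>s\<in>S. x (\<rho> s) = x s)} = (\<Prod>c\<in>C. fact (card {s \<in> S. x s = c}))"
proof -
  let ?S = "\<lambda>c. {s \<in> S. x s = c}"
  let ?P = "{\<rho>. \<rho> permutes S \<and> (\<forall>s\<in>S. x (\<rho> s) = x s)}"
  let ?Q = "\<Pi>\<^sub>E c\<in>C. {p. p permutes ?S c}"
  let ?join = "\<lambda>p s. if s \<in> S then p (x s) s else s"
  let ?split = "\<lambda>\<rho>. \<lambda>c\<in>C. \<lambda>s. if s \<in> ?S c then \<rho> s else s"
  have split: "?split \<rho> \<in> ?Q" if \<rho>: "\<rho> \<in> ?P" for \<rho>
  proof -
    have "(\<lambda>s. if s \<in> ?S c then \<rho> s else s) permutes ?S c" for c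
    proof (rule bij_imp_permutes)
      have inj: "inj_on \<rho> (?S c)" using \<rho> permutes_inj_on[of \<rho> S "?S c"] by blast
      have "\<rho> ` ?S c \<subseteq> ?S c"
      proof
        fix t assume "t \<in> \<rho> ` ?S c"
        then obtain s where s: "s \<in> S" "x s = c" "t = \<rho> s" by blast
        then show "t \<in> ?S c" using \<rho> permutes_in_image[of \<rho> S s] by simp
      qed
      then have "\<rho> ` ?S c = ?S c" using inj assms(1) by (intro endo_inj_surj) auto
      then have "bij_betw \<rho> (?S c) (?S c)" using inj unfolding bij_betw_def by blast
      then show "bij_betw (\<lambda>s. if s \<in> ?S c then \<rho> s else s) (?S c) (?S c)"
        by (rule bij_betw_cong[THEN iffD1, rotated]) simp
    qed auto
    then show ?thesis by simp
  qed
  have join: "?join p \<in> ?P" if p: "p \<in> ?Q" for p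
  proof -
    have pc: "p (x s) permutes ?S (x s)" if "s \<in> S" for s
      using PiE_mem[OF p, of "x s"] that assms(3) by blast
    have mem: "p (x s) s \<in> S" "x (p (x s) s) = x s" if "s \<in> S" for s
      using permutes_in_image[OF pc[OF that], of s] that by auto
    have "inj_on (?join p) S"
    proof (rule inj_onI)
      fix s t assume st: "s \<in> S" "t \<in> S" "?join p s = ?join p t"
      then have eq: "p (x s) s = p (x t) t" by simp
      then have "x s = x t" using mem(2) st by metis
      then show "s = t" using eq permutes_inj[OF pc[OF st(1)]] by (simp add: inj_eq)
    qed
    moreover have "?join p ` S \<subseteq> S" using mem by auto
    ultimately have "bij_betw (?join p) S S"
      using endo_inj_surj[OF assms(1), of "?join p"] unfolding bij_betw_def by blast
    then have "?join p permutes S" by (rule bij_imp_permutes) simp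
    then show ?thesis using mem by simp
  qed
  have "bij_betw ?split ?P ?Q"
  proof (rule bij_betw_byWitness[where f' = ?join])
    show "\<forall>\<rho>\<in>?P. ?join (?split \<rho>) = \<rho>"
    proof (intro ballI ext)
      fix \<rho> s assume \<rho>: "\<rho> \<in> ?P"
      show "?join (?split \<rho>) s = \<rho> s"
      proof (cases "s \<in> S")
        case True
        then have "x s \<in> C" using assms(3) by blast
        then show ?thesis using True by simp
      next
        case False
        then show ?thesis using \<rho> permutes_not_in[of \<rho> S s] by simp
      qed
    qed
    show "\<forall>p\<in>?Q. ?split (?join p) = p"
    proof
      fix p assume p: "p \<in> ?Q"
      show "?split (?join p) = p"
      proof (rule extensionalityI[of _ C])
        fix c assume c: "c \<in> C"
        then have "p c permutes ?S c" using PiE_mem[OF p] by blast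
        then show "?split (?join p) c = p c"
          using c permutes_not_in[of "p c" "?S c"] by (auto simp: fun_eq_iff)
      qed (use p in \<open>auto simp: PiE_def\<close>)
    qed
  qed (use split join in blast)+
  then have "card ?P = card ?Q" by (rule bij_betw_same_card)
  also have "\<dots> = (\<Prod>c\<in>C. fact (card (?S c)))"
    using assms(1,2) card_permutations[OF refl, of "?S _"] by (simp add: card_PiE)
  finally show ?thesis .
qed

definition blocks :: "nat \<Rightarrow> (nat \<Rightarrow> nat) \<Rightarrow> nat \<Rightarrow> nat set" where
  "blocks n f j = {v \<in> {1..n}. f v = j}"

definition block_tuple :: "nat \<Rightarrow> (nat \<Rightarrow> nat) \<Rightarrow> nat \<Rightarrow> (nat \<Rightarrow> nat) \<Rightarrow> nat set multiset list" where
  "block_tuple q x n f = map (\<lambda>c. image_mset (blocks n f) (mset_set {j \<in> {..<q}. x j = c})) [0..<q]"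

definition valid_labellings :: "nat \<Rightarrow> (nat \<Rightarrow> nat) \<Rightarrow> nat \<Rightarrow> nat set set \<Rightarrow> (nat \<Rightarrow> nat) set" where
  "valid_labellings q x n G = {f \<in> (\<Pi>\<^sub>E v\<in>{1..n}. {..<q}). valid_labelling q x n G f}"

text \<open>Every part is nonempty; relabelling then acts freely, so that all tuples obtained have
  equally many labellings.\<close>

definition onto_labellings :: "nat \<Rightarrow> (nat \<Rightarrow> nat) \<Rightarrow> nat \<Rightarrow> nat set set \<Rightarrow> (nat \<Rightarrow> nat) set" where
  "onto_labellings q x n G = {f \<in> valid_labellings q x n G. {..<q} \<subseteq> f ` {1..n}}"

lemma label_degree_cong:
  assumes "G \<subseteq> all_edges n" "v \<in> {1..n}" "\<And>u. u \<in> {1..n} \<Longrightarrow> f u = f v \<longleftrightarrow> g u = g v"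
  shows "label_degree G f v = label_degree G g v"
proof -
  have "{e \<in> G. v \<in> e \<and> (\<forall>u\<in>e. f u = f v)} = {e \<in> G. v \<in> e \<and> (\<forall>u\<in>e. g u = g v)}"
  proof (intro Collect_cong conj_cong refl ball_cong)
    fix e u assume e: "e \<in> G" "u \<in> e"
    then have "e \<subseteq> {1..n}" using assms(1) unfolding all_edges_def by blast
    then show "f u = f v \<longleftrightarrow> g u = g v" using assms(3) e by blast
  qed
  then show ?thesis unfolding label_degree_def by simp
qed

lemma block_tuple_relabel:
  assumes \<pi>: "bij_betw \<pi> {..<q} {..<q}" "\<And>j. j < q \<Longrightarrow> x (\<pi> j) = x j"
    and f: "g \<in> {1..n} \<rightarrow> {..<q}" "\<And>v. v \<in> {1..n} \<Longrightarrow> f v = \<pi> (g v)"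
  shows "block_tuple q x n f = block_tuple q x n g"
proof -
  have "image_mset (blocks n f) (mset_set {j \<in> {..<q}. x j = c}) = image_mset (blocks n g) (mset_set {j \<in> {..<q}. x j = c})" for c
  proof -
    let ?J = "{j \<in> {..<q}. x j = c}"
    have inj: "inj_on \<pi> {..<q}" and im: "\<pi> ` {..<q} = {..<q}" using \<pi>(1) unfolding bij_betw_def by auto
    have J: "\<pi> ` ?J = ?J"
    proof -
      have "\<pi> ` ?J \<subseteq> ?J" using im \<pi>(2) by auto
      moreover have "inj_on \<pi> ?J" using inj by (rule inj_on_subset) auto
      ultimately show ?thesis by (intro endo_inj_surj) auto
    qed
    have blk: "blocks n f (\<pi> j) = blocks n g j" if "j < q" for j
      unfolding blocks_def
    proof (intro Collect_cong conj_cong refl)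
      fix v assume v: "v \<in> {1..n}"
      then have "g v < q" using f(1) by auto
      then show "f v = \<pi> j \<longleftrightarrow> g v = j" using f(2)[OF v] inj that by (auto simp: inj_on_eq_iff)
    qed
    have "inj_on \<pi> ?J" using inj by (rule inj_on_subset) auto
    then have "image_mset \<pi> (mset_set ?J) = mset_set ?J"
      by (simp only: image_mset_mset_set J)
    then have "image_mset (blocks n f) (mset_set ?J) = image_mset (blocks n f) (image_mset \<pi> (mset_set ?J))"
      by (simp only:)
    also have "\<dots> = image_mset (\<lambda>j. blocks n f (\<pi> j)) (mset_set ?J)"
      by (simp only: multiset.map_comp comp_def)
    also have "\<dots> = image_mset (blocks n g) (mset_set ?J)"
      using blk by (intro image_mset_cong) auto
    finally show ?thesis .
  qed
  then show ?thesis unfolding block_tuple_def by simp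
qed

text \<open>Comparing the supports of the multisets suffices: as \<open>g\<close> is onto, its
  blocks are nonempty and pairwise distinct, so matching equal blocks of equal residue gives an
  injective relabelling.\<close>

lemma block_tuple_eq_imp_relabel:
  assumes eq: "block_tuple q x n f = block_tuple q x n g" and x: "\<And>j. j < q \<Longrightarrow> x j < q"
    and g: "g \<in> {1..n} \<rightarrow> {..<q}" "{..<q} \<subseteq> g ` {1..n}"
  shows "\<exists>\<pi>. bij_betw \<pi> {..<q} {..<q} \<and> (\<forall>j<q. x (\<pi> j) = x j) \<and> (\<forall>v\<in>{1..n}. f v = \<pi> (g v))"
proof -
  have "\<exists>k<q. x k = x j \<and> blocks n f k = blocks n g j" if j: "j < q" for j
  proof -
    let ?J = "{k \<in> {..<q}. x k = x j}"
    have "block_tuple q x n f ! x j = block_tuple q x n g ! x j" using eq by simp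
    then have "image_mset (blocks n f) (mset_set ?J) = image_mset (blocks n g) (mset_set ?J)"
      unfolding block_tuple_def using x[OF j] by simp
    then have "set_mset (image_mset (blocks n f) (mset_set ?J)) = set_mset (image_mset (blocks n g) (mset_set ?J))"
      by simp
    then have "blocks n f ` ?J = blocks n g ` ?J" by simp
    moreover have "blocks n g j \<in> blocks n g ` ?J" using j by simp
    ultimately have "blocks n g j \<in> blocks n f ` ?J" by simp
    then obtain k where "k \<in> ?J" "blocks n g j = blocks n f k" by (rule imageE)
    then show ?thesis by (intro exI[of _ k]) simp
  qed
  then obtain \<pi> where \<pi>: "\<And>j. j < q \<Longrightarrow> \<pi> j < q \<and> x (\<pi> j) = x j \<and> blocks n f (\<pi> j) = blocks n g j"
    by metis
  have "inj_on \<pi> {..<q}"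
  proof (rule inj_onI)
    fix j k assume jk: "j \<in> {..<q}" "k \<in> {..<q}" "\<pi> j = \<pi> k"
    then have "blocks n g j = blocks n g k" using \<pi> by (metis lessThan_iff)
    moreover obtain v where "v \<in> {1..n}" "g v = j" using g(2) jk(1) by blast
    ultimately show "j = k" unfolding blocks_def by blast
  qed
  moreover have "\<pi> ` {..<q} \<subseteq> {..<q}" using \<pi> by auto
  ultimately have "bij_betw \<pi> {..<q} {..<q}" by (simp add: bij_betw_def endo_inj_surj)
  moreover have "f v = \<pi> (g v)" if v: "v \<in> {1..n}" for v
  proof -
    have "g v < q" using g(1) v by auto
    moreover have "v \<in> blocks n g (g v)" using v unfolding blocks_def by simp
    ultimately show ?thesis using \<pi>[of "g v"] unfolding blocks_def by auto
  qed
  ultimately show ?thesis using \<pi> by blast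
qed

lemma onto_labellingsD:
  assumes "f \<in> onto_labellings q x n G"
  shows "f \<in> (\<Pi>\<^sub>E v\<in>{1..n}. {..<q})" "f \<in> {1..n} \<rightarrow> {..<q}" "valid_labelling q x n G f" "{..<q} \<subseteq> f ` {1..n}"
  using assms unfolding onto_labellings_def valid_labellings_def by (auto simp: PiE_def)

context
  fixes q n :: nat and x :: "nat \<Rightarrow> nat" and G :: "nat set set"
  assumes G: "G \<subseteq> all_edges n" and x: "\<And>j. j < q \<Longrightarrow> x j < q"
begin

text \<open>Relabelling keeps the blocks, so degrees inside them agree, and residues below
  \<open>q\<close> congruent to the same degree are equal. Hence equivalence of valid onto
  labellings can be tested with arbitrary permutations of \<open>{..<q}\<close>, as
  \<open>inequivalent\<close> does.\<close>

lemma valid_relabel_preserves_residues: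
  assumes f: "f \<in> onto_labellings q x n G" and g: "g \<in> onto_labellings q x n G"
    and \<pi>: "bij_betw \<pi> {..<q} {..<q}" "\<And>v. v \<in> {1..n} \<Longrightarrow> f v = \<pi> (g v)" and j: "j < q"
  shows "x (\<pi> j) = x j"
proof -
  obtain v where v: "v \<in> {1..n}" "g v = j" using onto_labellingsD(4)[OF g] j by blast
  have inj: "inj_on \<pi> {..<q}" using \<pi>(1) unfolding bij_betw_def by blast
  have gq: "g u < q" if "u \<in> {1..n}" for u using onto_labellingsD(2)[OF g] that by auto
  have "label_degree G f v = label_degree G g v"
    by (rule label_degree_cong[OF G v(1)]) (use \<pi>(2) v(1) gq inj in \<open>simp add: inj_on_eq_iff\<close>)
  moreover have "[label_degree G f v = x (f v)] (mod q)" "[label_degree G g v = x (g v)] (mod q)"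
    using onto_labellingsD(3)[OF f] onto_labellingsD(3)[OF g] v(1) unfolding valid_labelling_def by blast+
  ultimately have "[x (f v) = x (g v)] (mod q)" by (metis cong_sym cong_trans)
  moreover have "f v < q" using onto_labellingsD(2)[OF f] v(1) by auto
  ultimately have "x (f v) = x (g v)" using x gq[OF v(1)] by (metis cong_less_modulus_unique_nat)
  then show ?thesis using \<pi>(2)[OF v(1)] v(2) by simp
qed

lemma block_tuple_eq_iff:
  assumes "f \<in> onto_labellings q x n G" "g \<in> onto_labellings q x n G"
  shows "block_tuple q x n f = block_tuple q x n g \<longleftrightarrow>
    (\<exists>\<pi>. bij_betw \<pi> {..<q} {..<q} \<and> (\<forall>v\<in>{1..n}. f v = \<pi> (g v)))"
proof
  assume "block_tuple q x n f = block_tuple q x n g"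
  then show "\<exists>\<pi>. bij_betw \<pi> {..<q} {..<q} \<and> (\<forall>v\<in>{1..n}. f v = \<pi> (g v))"
    using block_tuple_eq_imp_relabel[where x = x, OF _ x onto_labellingsD(2,4)[OF assms(2)]] by blast
next
  assume "\<exists>\<pi>. bij_betw \<pi> {..<q} {..<q} \<and> (\<forall>v\<in>{1..n}. f v = \<pi> (g v))"
  then obtain \<pi> where \<pi>: "bij_betw \<pi> {..<q} {..<q}" "\<And>v. v \<in> {1..n} \<Longrightarrow> f v = \<pi> (g v)" by blast
  show "block_tuple q x n f = block_tuple q x n g"
    using valid_relabel_preserves_residues[OF assms \<pi>] \<pi> onto_labellingsD(2)[OF assms(2)]
    by (intro block_tuple_relabel[of \<pi>]) auto
qed

text \<open>The residue-preserving permutations act simply transitively on the onto labellings of a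
  tuple; freeness holds because \<open>f\<close> attains every label.\<close>

lemma card_block_tuple_fibre:
  assumes f: "f \<in> onto_labellings q x n G"
  shows "card {g \<in> onto_labellings q x n G. block_tuple q x n g = block_tuple q x n f}
    = (\<Prod>c<q. fact (card {j \<in> {..<q}. x j = c}))"
proof -
  let ?E = "{g \<in> onto_labellings q x n G. block_tuple q x n g = block_tuple q x n f}"
  let ?P = "{\<rho>. \<rho> permutes {..<q} \<and> (\<forall>j\<in>{..<q}. x (\<rho> j) = x j)}"
  let ?act = "\<lambda>\<rho>. \<lambda>v\<in>{1..n}. \<rho> (f v)"
  note fD = onto_labellingsD[OF f]
  have fq: "f v < q" if "v \<in> {1..n}" for v using fD(2) that by auto
  have "bij_betw ?act ?P ?E"
    unfolding bij_betw_def
  proof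
    show "inj_on ?act ?P"
    proof (rule inj_onI)
      fix \<rho> \<sigma> assume \<rho>: "\<rho> \<in> ?P" "\<sigma> \<in> ?P" "?act \<rho> = ?act \<sigma>"
      show "\<rho> = \<sigma>"
      proof
        fix j show "\<rho> j = \<sigma> j"
        proof (cases "j < q")
          case True
          then obtain v where "v \<in> {1..n}" "f v = j" using fD(4) by blast
          then show ?thesis using fun_cong[OF \<rho>(3), of v] by simp
        next
          case False
          then have "\<rho> j = j" "\<sigma> j = j"
            using \<rho>(1,2) permutes_not_in[of \<rho> "{..<q}" j] permutes_not_in[of \<sigma> "{..<q}" j] by simp_all
          then show ?thesis by simp
        qed
      qed
    qed
    show "?act ` ?P = ?E"
    proof (intro equalityI subsetI)
      fix g assume "g \<in> ?act ` ?P"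
      then obtain \<rho> where \<rho>: "\<rho> permutes {..<q}" "\<And>j. j < q \<Longrightarrow> x (\<rho> j) = x j" "g = ?act \<rho>" by auto
      have bij: "bij_betw \<rho> {..<q} {..<q}" by (rule permutes_imp_bij[OF \<rho>(1)])
      have gq: "\<rho> j < q" if "j < q" for j using permutes_in_image[OF \<rho>(1), of j] that by simp
      have "valid_labelling q x n G g"
        unfolding valid_labelling_def
      proof
        fix v assume v: "v \<in> {1..n}"
        have "label_degree G g v = label_degree G f v"
          by (rule label_degree_cong[OF G v]) (use v permutes_inj[OF \<rho>(1)] in \<open>simp add: \<rho>(3) inj_eq\<close>)
        then show "[label_degree G g v = x (g v)] (mod q)"
          using fD(3) v \<rho>(2)[OF fq[OF v]] unfolding valid_labelling_def by (simp add: \<rho>(3))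
      qed
      moreover have "g \<in> (\<Pi>\<^sub>E v\<in>{1..n}. {..<q})" using gq fq by (auto simp: \<rho>(3))
      moreover have "{..<q} \<subseteq> g ` {1..n}"
      proof
        fix j assume "j \<in> {..<q}"
        then have "j \<in> \<rho> ` {..<q}" using bij unfolding bij_betw_def by simp
        then obtain k where k: "k < q" "j = \<rho> k" by auto
        then obtain v where "v \<in> {1..n}" "f v = k" using fD(4) by blast
        then show "j \<in> g ` {1..n}" using k by (intro image_eqI[of _ _ v]) (auto simp: \<rho>(3))
      qed
      ultimately have "g \<in> onto_labellings q x n G"
        unfolding onto_labellings_def valid_labellings_def by blast
      moreover have "block_tuple q x n g = block_tuple q x n f"
        by (rule block_tuple_relabel[where x = x and \<pi> = \<rho>, OF bij \<rho>(2) fD(2)]) (auto simp: \<rho>(3))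
      ultimately show "g \<in> ?E" by blast
    next
      fix g assume g: "g \<in> ?E"
      then obtain \<pi> where \<pi>: "bij_betw \<pi> {..<q} {..<q}" "\<forall>j<q. x (\<pi> j) = x j" "\<forall>v\<in>{1..n}. g v = \<pi> (f v)"
        using block_tuple_eq_imp_relabel[where x = x, OF _ x fD(2) fD(4)] by blast
      \<comment> \<open>\<open>\<pi>\<close> is uncontrolled outside \<open>{..<q}\<close>;
        extending by the identity makes it a permutation.\<close>
      define \<rho> where "\<rho> j = (if j < q then \<pi> j else j)" for j
      have "bij_betw \<rho> {..<q} {..<q}"
        using \<pi>(1) by (rule bij_betw_cong[THEN iffD1, rotated]) (simp add: \<rho>_def)
      then have "\<rho> permutes {..<q}" by (rule bij_imp_permutes) (simp add: \<rho>_def)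
      then have "\<rho> \<in> ?P" using \<pi>(2) by (simp add: \<rho>_def)
      moreover have "g = ?act \<rho>"
      proof (rule extensionalityI[of _ "{1..n}"])
        have "g \<in> onto_labellings q x n G" using g by blast
        then show "g \<in> extensional {1..n}" unfolding onto_labellings_def valid_labellings_def PiE_def by blast
      qed (use \<pi>(3) fq in \<open>auto simp: \<rho>_def\<close>)
      ultimately show "g \<in> ?act ` ?P" by blast
    qed
  qed
  then have "card ?E = card ?P"
    by (simp add: bij_betw_same_card)
  also have "\<dots> = (\<Prod>c<q. fact (card {j \<in> {..<q}. x j = c}))"
    by (rule card_fibre_preserving_permutations) (use x in auto)
  finally show ?thesis .
qed

end

section \<open>Counting selections with distinct images\<close>

lemma falling_factorial_binomial: "(\<Prod>i = 0..<r. k - i) = fact r * (k choose r)" for k :: nat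
proof (induction r)
  case (Suc r)
  have "Suc r * (k choose Suc r) = (k - r) * (k choose r)"
    using Suc_times_binomial_eq binomial_absorb_comp binomial_absorption by metis
  then have "fact (Suc r) * (k choose Suc r) = fact r * ((k - r) * (k choose r))"
    by (simp only: fact_Suc of_nat_id mult.assoc mult.left_commute)
  then show ?case using Suc by (simp add: mult_ac)
qed simp

text \<open>Choosing \<open>r\<close> distinct images in order and lifting each to one of its
  \<open>m\<close> preimages expresses a binomial coefficient of the number of images by a count of
  selections upstairs.\<close>

lemma card_injective_selections:
  fixes t :: "'l \<Rightarrow> 'b"
  assumes L: "finite L" and fibre: "\<And>l. l \<in> L \<Longrightarrow> card {l' \<in> L. t l' = t l} = m"
  shows "card {h \<in> (\<Pi>\<^sub>E i\<in>{..<r}. L). inj_on (t \<circ> h) {..<r}} = m ^ r * (fact r * (card (t ` L) choose r))"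
proof -
  let ?I = "{g \<in> (\<Pi>\<^sub>E i\<in>{..<r}. t ` L). inj_on g {..<r}}"
  let ?H = "\<lambda>g. \<Pi>\<^sub>E i\<in>{..<r}. {l \<in> L. t l = g i}"
  have "{h \<in> (\<Pi>\<^sub>E i\<in>{..<r}. L). inj_on (t \<circ> h) {..<r}} = (\<Union>g\<in>?I. ?H g)"
  proof (intro equalityI subsetI)
    fix h assume h: "h \<in> {h \<in> (\<Pi>\<^sub>E i\<in>{..<r}. L). inj_on (t \<circ> h) {..<r}}"
    let ?g = "\<lambda>i\<in>{..<r}. t (h i)"
    have "?g \<in> ?I" using h by (auto simp: inj_on_def PiE_iff)
    moreover have "h \<in> ?H ?g" using h by (auto simp: PiE_iff)
    ultimately show "h \<in> (\<Union>g\<in>?I. ?H g)" by blast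
  next
    fix h assume "h \<in> (\<Union>g\<in>?I. ?H g)"
    then obtain g where g: "g \<in> ?I" "h \<in> ?H g" by blast
    have "inj_on (t \<circ> h) {..<r} \<longleftrightarrow> inj_on g {..<r}"
      using g(2) by (intro inj_on_cong) (auto simp: PiE_iff)
    then show "h \<in> {h \<in> (\<Pi>\<^sub>E i\<in>{..<r}. L). inj_on (t \<circ> h) {..<r}}"
      using g by (auto simp: PiE_iff)
  qed
  then have "card {h \<in> (\<Pi>\<^sub>E i\<in>{..<r}. L). inj_on (t \<circ> h) {..<r}} = card (\<Union>g\<in>?I. ?H g)" by simp
  also have "\<dots> = (\<Sum>g\<in>?I. card (?H g))"
  proof (rule card_UN_disjoint)
    show "finite ?I"
      using L by (intro finite_subset[of ?I "\<Pi>\<^sub>E i\<in>{..<r}. t ` L"]) (auto intro!: finite_PiE)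
    show "\<forall>g\<in>?I. finite (?H g)" using L by (intro ballI finite_PiE) auto
    show "\<forall>g\<in>?I. \<forall>g'\<in>?I. g \<noteq> g' \<longrightarrow> ?H g \<inter> ?H g' = {}"
    proof (intro ballI impI equals0I)
      fix g g' h assume g: "g \<in> ?I" "g' \<in> ?I" "g \<noteq> g'" "h \<in> ?H g \<inter> ?H g'"
      have "g i = g' i" if "i \<in> {..<r}" for i
        using PiE_mem[of h "{..<r}" "\<lambda>i. {l \<in> L. t l = g i}" i] PiE_mem[of h "{..<r}" "\<lambda>i. {l \<in> L. t l = g' i}" i] g(4) that by simp
      then have "g = g'" using g(1,2) by (intro PiE_ext[of g "{..<r}" "\<lambda>_. t ` L" g']) simp_all
      then show False using g(3) by simp
    qed
  qed
  also have "\<dots> = (\<Sum>g\<in>?I. m ^ r)"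
  proof (rule sum.cong)
    fix g assume g: "g \<in> ?I"
    have "card {l \<in> L. t l = g i} = m" if "i < r" for i
    proof -
      have "g i \<in> t ` L" using g that by (auto simp: PiE_iff)
      then obtain l where "l \<in> L" "g i = t l" by blast
      then show ?thesis using fibre by simp
    qed
    then show "card (?H g) = m ^ r" by (simp add: card_PiE)
  qed simp
  also have "\<dots> = m ^ r * card ?I" by simp
  also have "card ?I = fact r * (card (t ` L) choose r)"
    using card_inj_on_subset_funcset[of "{..<r}" "t ` L" "{..<r}"] L by (simp add: falling_factorial_binomial)
  finally show ?thesis .
qed

section \<open>Uniform random graphs\<close>

lemma random_graph_half: "random_graph n (1 / 2) = pmf_of_set (Pow (all_edges n))"
proof -
  have "random_graph n (1 / 2) = map_pmf (\<lambda>f. {e \<in> all_edges n. f e}) (Pi_pmf (all_edges n) False (\<lambda>_. bernoulli_pmf (1 / 2)))"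
    unfolding random_graph_def
  proof (rule map_pmf_cong[OF refl])
    fix f assume "f \<in> set_pmf (Pi_pmf (all_edges n) False (\<lambda>_. bernoulli_pmf (1 / 2)))"
    then have "e \<notin> all_edges n \<Longrightarrow> \<not> f e" for e
      using set_Pi_pmf_subset[OF finite_all_edges] by fastforce
    then show "{e. f e} = {e \<in> all_edges n. f e}" by auto
  qed
  then show ?thesis using pmf_of_set_Pow_conv_bernoulli[OF finite_all_edges] by simp
qed

lemma expectation_random_graph:
  fixes f :: "nat set set \<Rightarrow> real"
  shows "measure_pmf.expectation (random_graph n (1 / 2)) f = (\<Sum>G\<in>Pow (all_edges n). f G) / 2 ^ card (all_edges n)"
  unfolding random_graph_half using finite_all_edges by (subst integral_pmf_of_set) (auto simp: card_Pow)

lemma finite_valid_labellings: "finite (valid_labellings q x n G)"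
  by (rule finite_subset[of _ "\<Pi>\<^sub>E v\<in>{1..n}. {..<q}"]) (auto simp: valid_labellings_def intro!: finite_PiE)

lemma valid_labelling_cong:
  assumes "G \<subseteq> all_edges n" "\<And>v. v \<in> {1..n} \<Longrightarrow> f v = g v"
  shows "valid_labelling q x n G f \<longleftrightarrow> valid_labelling q x n G g"
  unfolding valid_labelling_def
  using assms label_degree_cong[OF assms(1), of _ f g] by simp

section \<open>Families of parts indexed by single labels\<close>

context
  fixes q n :: nat and a :: "nat \<Rightarrow> nat" and lab :: "nat \<Rightarrow> nat \<times> nat"
  assumes lab: "bij_betw lab {..<q} (part_indices q a)"
begin

lemma
  shows lab_mem: "j < q \<Longrightarrow> lab j \<in> part_indices q a"
    and lab_eq_iff: "j < q \<Longrightarrow> k < q \<Longrightarrow> lab j = lab k \<longleftrightarrow> j = k"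
    and lab_surj: "t \<in> part_indices q a \<Longrightarrow> \<exists>j<q. lab j = t"
    and lab_residue: "j < q \<Longrightarrow> fst (lab j) < q"
proof -
  show mem: "j < q \<Longrightarrow> lab j \<in> part_indices q a" for j using lab unfolding bij_betw_def by auto
  show "j < q \<Longrightarrow> k < q \<Longrightarrow> lab j = lab k \<longleftrightarrow> j = k"
    using lab unfolding bij_betw_def inj_on_def by auto
  show "t \<in> part_indices q a \<Longrightarrow> \<exists>j<q. lab j = t"
    using lab unfolding bij_betw_def by (metis imageE lessThan_iff)
  show "j < q \<Longrightarrow> fst (lab j) < q" using mem[of j] unfolding part_indices_def by auto
qed

lemma bij_betw_label_class:
  assumes "c < q"
  shows "bij_betw (\<lambda>j. snd (lab j)) {j \<in> {..<q}. fst (lab j) = c} {1..a c}"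
  unfolding bij_betw_def
proof
  show "inj_on (\<lambda>j. snd (lab j)) {j \<in> {..<q}. fst (lab j) = c}"
  proof (rule inj_onI)
    fix j k assume jk: "j \<in> {j \<in> {..<q}. fst (lab j) = c}" "k \<in> {j \<in> {..<q}. fst (lab j) = c}" "snd (lab j) = snd (lab k)"
    then have "lab j = lab k" by (simp add: prod_eq_iff)
    then show "j = k" using jk lab_eq_iff by simp
  qed
  show "(\<lambda>j. snd (lab j)) ` {j \<in> {..<q}. fst (lab j) = c} = {1..a c}"
  proof (intro equalityI subsetI)
    fix y assume "y \<in> (\<lambda>j. snd (lab j)) ` {j \<in> {..<q}. fst (lab j) = c}"
    then obtain j where j: "j < q" "fst (lab j) = c" "y = snd (lab j)" by auto
    then show "y \<in> {1..a c}" using lab_mem[OF j(1)] unfolding part_indices_def by auto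
  next
    fix y assume "y \<in> {1..a c}"
    then have "(c, y) \<in> part_indices q a" using assms unfolding part_indices_def by simp
    then obtain j where "j < q" "lab j = (c, y)" using lab_surj by blast
    then show "y \<in> (\<lambda>j. snd (lab j)) ` {j \<in> {..<q}. fst (lab j) = c}"
      by (intro image_eqI[of _ _ j]) auto
  qed
qed

lemma tuple_of_family_eq_block_tuple:
  assumes A: "\<And>j. j < q \<Longrightarrow> A (lab j) = blocks n f j"
  shows "tuple_of_family q a A = block_tuple q (\<lambda>j. fst (lab j)) n f"
  unfolding tuple_of_family_def block_tuple_def
proof (intro map_cong refl)
  fix c assume "c \<in> set [0..<q]"
  then have c: "c < q" by simp
  let ?J = "{j \<in> {..<q}. fst (lab j) = c}"
  have "mset_set {1..a c} = image_mset (\<lambda>j. snd (lab j)) (mset_set ?J)"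
    using bij_betw_label_class[OF c] unfolding bij_betw_def by (simp add: image_mset_mset_set)
  then have "{#A (c, y). y \<in># mset_set {1..a c}#} = {#A (c, snd (lab j)). j \<in># mset_set ?J#}"
    by (simp add: multiset.map_comp comp_def)
  also have "\<dots> = image_mset (blocks n f) (mset_set ?J)"
  proof (rule image_mset_cong)
    fix j assume "j \<in># mset_set ?J"
    then have j: "j < q" "fst (lab j) = c" by auto
    then have "(c, snd (lab j)) = lab j" by (simp add: prod_eq_iff)
    then show "A (c, snd (lab j)) = blocks n f j" using A j by simp
  qed
  finally show "{#A (c, y). y \<in># mset_set {1..a c}#} = image_mset (blocks n f) (mset_set ?J)" .
qed

lemma degree_in_block:
  assumes "G \<subseteq> all_edges n" "v \<in> blocks n f j"
  shows "degree_in (induced_edges G (blocks n f j)) v = label_degree G f v"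
proof -
  have "{e \<in> induced_edges G (blocks n f j). v \<in> e} = {e \<in> G. v \<in> e \<and> (\<forall>u\<in>e. f u = f v)}"
  proof (intro set_eqI iffI)
    fix e assume "e \<in> {e \<in> G. v \<in> e \<and> (\<forall>u\<in>e. f u = f v)}"
    moreover from this have "e \<subseteq> {1..n}" using assms(1) unfolding all_edges_def by blast
    ultimately show "e \<in> {e \<in> induced_edges G (blocks n f j). v \<in> e}"
      using assms(2) unfolding induced_edges_def blocks_def by blast
  qed (use assms(2) in \<open>auto simp: induced_edges_def blocks_def\<close>)
  then show ?thesis unfolding degree_in_def label_degree_def by simp
qed

lemma valid_family_iff:
  assumes G: "G \<subseteq> all_edges n" and A: "\<And>j. j < q \<Longrightarrow> A (lab j) = blocks n f j"
    and f: "f \<in> {1..n} \<rightarrow> {..<q}"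
  shows "valid_family q a n G A \<longleftrightarrow> valid_labelling q (\<lambda>j. fst (lab j)) n G f"
proof -
  have "disjoint_family_on A (part_indices q a)"
    unfolding disjoint_family_on_def
  proof (intro ballI impI)
    fix s t assume st: "s \<in> part_indices q a" "t \<in> part_indices q a" "s \<noteq> t"
    then obtain j k where "j < q" "k < q" "lab j = s" "lab k = t" using lab_surj by metis
    then show "A s \<inter> A t = {}" using A[of j] A[of k] st(3) unfolding blocks_def by auto
  qed
  moreover have "(\<Union>t\<in>part_indices q a. A t) = {1..n}"
  proof -
    have "part_indices q a = lab ` {..<q}" using lab unfolding bij_betw_def by simp
    then have "(\<Union>t\<in>part_indices q a. A t) = (\<Union>j<q. blocks n f j)" using A by simp
    also have "\<dots> = {1..n}" using f unfolding blocks_def by auto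
    finally show ?thesis .
  qed
  moreover have "(\<forall>(c, y)\<in>part_indices q a. \<forall>v\<in>A (c, y). [degree_in (induced_edges G (A (c, y))) v = c] (mod q))
      \<longleftrightarrow> valid_labelling q (\<lambda>j. fst (lab j)) n G f"
  proof -
    have "(\<forall>(c, y)\<in>part_indices q a. \<forall>v\<in>A (c, y). [degree_in (induced_edges G (A (c, y))) v = c] (mod q))
      \<longleftrightarrow> (\<forall>t\<in>lab ` {..<q}. \<forall>v\<in>A t. [degree_in (induced_edges G (A t)) v = fst t] (mod q))"
      using lab unfolding bij_betw_def by (simp add: case_prod_beta)
    also have "\<dots> \<longleftrightarrow> (\<forall>j<q. \<forall>v\<in>blocks n f j. [label_degree G f v = fst (lab j)] (mod q))"
      using A degree_in_block[OF G, of _ f] by auto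
    also have "\<dots> \<longleftrightarrow> valid_labelling q (\<lambda>j. fst (lab j)) n G f"
      using f unfolding valid_labelling_def blocks_def by auto
    finally show ?thesis .
  qed
  ultimately show ?thesis unfolding valid_family_def by blast
qed

text \<open>Every vertex lies in exactly one part, so on its indices a family is determined by the
  labelling that names this part; empty parts correspond to labels that are not attained.\<close>

lemma tuples_eq_block_tuples:
  assumes G: "G \<subseteq> all_edges n"
  shows "{tuple_of_family q a A | A. valid_family q a n G A} =
    block_tuple q (\<lambda>j. fst (lab j)) n ` valid_labellings q (\<lambda>j. fst (lab j)) n G"
proof (intro equalityI subsetI)
  fix T assume "T \<in> {tuple_of_family q a A | A. valid_family q a n G A}"
  then obtain A where A: "T = tuple_of_family q a A" "valid_family q a n G A" by blast
  have ex: "\<exists>j<q. v \<in> A (lab j)" if v: "v \<in> {1..n}" for v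
  proof -
    obtain t where "t \<in> part_indices q a" "v \<in> A t" using A(2) v unfolding valid_family_def by blast
    then show ?thesis using lab_surj by metis
  qed
  have disj: "j = k" if jk: "j < q" "k < q" and v: "v \<in> A (lab j)" "v \<in> A (lab k)" for j k v
  proof (rule ccontr)
    assume "j \<noteq> k"
    then have "lab j \<noteq> lab k" using lab_eq_iff jk by simp
    moreover have "disjoint_family_on A (part_indices q a)" using A(2) unfolding valid_family_def by simp
    ultimately have "A (lab j) \<inter> A (lab k) = {}"
      using lab_mem[OF jk(1)] lab_mem[OF jk(2)] unfolding disjoint_family_on_def by simp
    then show False using v by blast
  qed
  obtain g where g: "\<And>v. v \<in> {1..n} \<Longrightarrow> g v < q \<and> v \<in> A (lab (g v))" using ex by metis
  define f where "f = restrict g {1..n}"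
  have f: "f \<in> (\<Pi>\<^sub>E v\<in>{1..n}. {..<q})" unfolding f_def using g by auto
  have blk: "A (lab j) = blocks n f j" if j: "j < q" for j
  proof (intro equalityI subsetI)
    fix v assume v: "v \<in> A (lab j)"
    then have "v \<in> {1..n}" using A(2) lab_mem[OF j] unfolding valid_family_def by blast
    then show "v \<in> blocks n f j" using g[of v] disj[of "g v" j v] v j unfolding blocks_def f_def by simp
  next
    fix v assume "v \<in> blocks n f j"
    then show "v \<in> A (lab j)" using g[of v] unfolding blocks_def f_def by auto
  qed
  have "valid_labelling q (\<lambda>j. fst (lab j)) n G f"
    using valid_family_iff[where A = A and f = f, OF G blk] f A(2) by (auto simp: PiE_def)
  then show "T \<in> block_tuple q (\<lambda>j. fst (lab j)) n ` valid_labellings q (\<lambda>j. fst (lab j)) n G"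
    using tuple_of_family_eq_block_tuple[where A = A and f = f, OF blk] f A(1) unfolding valid_labellings_def by blast
next
  fix T assume "T \<in> block_tuple q (\<lambda>j. fst (lab j)) n ` valid_labellings q (\<lambda>j. fst (lab j)) n G"
  then obtain f where f: "f \<in> (\<Pi>\<^sub>E v\<in>{1..n}. {..<q})" "valid_labelling q (\<lambda>j. fst (lab j)) n G f"
      "T = block_tuple q (\<lambda>j. fst (lab j)) n f"
    unfolding valid_labellings_def by blast
  define A where "A t = blocks n f (inv_into {..<q} lab t)" for t
  have blk: "A (lab j) = blocks n f j" if "j < q" for j
    using that lab unfolding A_def bij_betw_def by simp
  have "valid_family q a n G A" using valid_family_iff[where A = A and f = f, OF G blk] f by (auto simp: PiE_def)
  moreover have "tuple_of_family q a A = T"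
    unfolding f(3) by (rule tuple_of_family_eq_block_tuple) (rule blk)
  ultimately show "T \<in> {tuple_of_family q a A | A. valid_family q a n G A}" by blast
qed

lemma num_tuples_eq:
  assumes "G \<subseteq> all_edges n"
  shows "num_tuples q a n G = card (block_tuple q (\<lambda>j. fst (lab j)) n ` valid_labellings q (\<lambda>j. fst (lab j)) n G)"
  unfolding num_tuples_def tuples_eq_block_tuples[OF assms] ..

end

section \<open>The limit theorem\<close>

context degree_moments
begin

text \<open>Read coordinate by coordinate, the ordered choices of \<open>r\<close> onto labellings
  which, once valid, describe pairwise different tuples.\<close>

definition distinct_families :: "nat \<Rightarrow> (nat \<Rightarrow> nat \<Rightarrow> nat) set" where
  "distinct_families n = {F \<in> families n. (\<forall>i<r. {..<q} \<subseteq> (\<lambda>v. F v i) ` {1..n}) \<and> inequivalent n F}"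

lemma sparse_subset_families: "sparse_families n \<subseteq> families n"
  unfolding sparse_families_def by blast

lemma onto_subset_distinct: "onto_families n \<subseteq> distinct_families n"
proof
  fix F assume F: "F \<in> onto_families n"
  have hit: "\<exists>v\<in>{1..n}. \<forall>i<r. F v i = p i" if p: "\<And>i. i < r \<Longrightarrow> p i < q" for p
  proof -
    have "(\<lambda>i\<in>{..<r}. p i) \<in> labels" using p unfolding labels_def by auto
    then have "(\<lambda>i\<in>{..<r}. p i) \<in> F ` {1..n}" using F unfolding onto_families_def by blast
    then obtain v where "v \<in> {1..n}" "(\<lambda>i\<in>{..<r}. p i) = F v" by (rule imageE)
    then show ?thesis by (metis lessThan_iff restrict_apply')
  qed
  have "{..<q} \<subseteq> (\<lambda>v. F v i) ` {1..n}" if i: "i < r" for i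
  proof
    fix j assume "j \<in> {..<q}"
    then obtain v where "v \<in> {1..n}" "F v i = j" using hit[of "\<lambda>_. j"] i by auto
    then show "j \<in> (\<lambda>v. F v i) ` {1..n}" by blast
  qed
  moreover have "inequivalent n F"
    unfolding inequivalent_def
  proof (rule notI, elim exE conjE)
    fix i j \<pi> assume ij: "i < r" "j < r" "i \<noteq> j" "\<forall>v\<in>{1..n}. F v i = \<pi> (F v j)"
    \<comment> \<open>\<open>c\<close> avoids \<open>\<pi> 0\<close>, so a vertex labelled
      \<open>c\<close> at \<open>i\<close> and 0 elsewhere refutes the tie.\<close>
    define c where "c = (if \<pi> 0 = 0 then 1 else 0 :: nat)"
    have "c < q" using q_ge_3 unfolding c_def by simp
    then have "\<exists>v\<in>{1..n}. \<forall>l<r. F v l = (if l = i then c else 0)"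
      using q_pos by (intro hit) auto
    then obtain v where "v \<in> {1..n}" "\<forall>l<r. F v l = (if l = i then c else 0)" by blast
    then have "c = \<pi> 0" using ij by metis
    then show False unfolding c_def by (simp split: if_splits)
  qed
  ultimately show "F \<in> distinct_families n"
    using F unfolding distinct_families_def onto_families_def by blast
qed

text \<open>Distinct families that miss a label vector are sparse, so they do not affect the
  limit.\<close>

lemma distinct_families_limit:
  "(\<lambda>n. of_real (\<Sum>F\<in>distinct_families n. prob n F) - character_sum q x n ^ r) \<longlonglongrightarrow> 0"
proof -
  have "(\<lambda>n. \<Sum>F\<in>distinct_families n - onto_families n. prob n F) \<longlonglongrightarrow> 0"
  proof (rule Lim_null_comparison[OF _ sparse_families_tendsto_0])
    have "(\<Sum>F\<in>distinct_families n - onto_families n. prob n F)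
        \<le> (\<Sum>F\<in>sparse_families n. prob n F)" for n
      using finite_families valid_prob_nonneg
      by (intro sum_mono2) (auto simp: distinct_families_def onto_families_def sparse_families_def)
    then show "\<forall>\<^sub>F n in sequentially. norm (\<Sum>F\<in>distinct_families n - onto_families n. prob n F)
        \<le> (\<Sum>F\<in>sparse_families n. prob n F)"
      using valid_prob_nonneg by (simp add: sum_nonneg)
  qed
  then have "(\<lambda>n. complex_of_real (\<Sum>F\<in>distinct_families n - onto_families n. prob n F)) \<longlonglongrightarrow> of_real 0"
    by (rule tendsto_of_real)
  from tendsto_add[OF this onto_families_limit]
  have "(\<lambda>n. complex_of_real (\<Sum>F\<in>distinct_families n - onto_families n. prob n F)
      + (of_real (\<Sum>F\<in>onto_families n. prob n F) - character_sum q x n ^ r)) \<longlonglongrightarrow> 0" by simp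
  moreover have "(\<Sum>F\<in>distinct_families n. prob n F) =
      (\<Sum>F\<in>distinct_families n - onto_families n. prob n F) + (\<Sum>F\<in>onto_families n. prob n F)" for n
    using finite_families by (intro sum.subset_diff onto_subset_distinct) (simp add: distinct_families_def)
  ultimately show ?thesis by (simp add: algebra_simps)
qed

lemma expected_count_families:
  assumes "\<F> \<subseteq> families n"
  shows "measure_pmf.expectation (random_graph n (1 / 2))
      (\<lambda>G. real (card {F \<in> \<F>. \<forall>i<r. valid_labelling q x n G (\<lambda>v. F v i)}))
    = (\<Sum>F\<in>\<F>. prob n F)"
proof -
  have fin: "finite \<F>" using assms finite_families finite_subset by blast
  let ?Q = "\<lambda>G F. \<forall>i<r. valid_labelling q x n G (\<lambda>v. F v i)"
  have "(\<Sum>G\<in>Pow (all_edges n). real (card {F \<in> \<F>. ?Q G F})) = (\<Sum>G\<in>Pow (all_edges n). \<Sum>F\<in>\<F>. of_bool (?Q G F))"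
    using fin by (intro sum.cong refl) (simp add: Int_def of_bool_def sum.If_cases)
  also have "\<dots> = (\<Sum>F\<in>\<F>. \<Sum>G\<in>Pow (all_edges n). of_bool (?Q G F))" by (rule sum.swap)
  also have "\<dots> = (\<Sum>F\<in>\<F>. real (card {G \<in> Pow (all_edges n). ?Q G F}))"
    using finite_all_edges by (intro sum.cong refl) (simp add: Int_def of_bool_def sum.If_cases)
  finally show ?thesis
    unfolding expectation_random_graph valid_prob_def by (simp add: sum_divide_distrib)
qed

text \<open>Transposition: \<open>r\<close> labellings of the vertices are one labelling by vectors,
  and the tuples are distinct exactly when no permutation ties two coordinates.\<close>

lemma card_distinct_selections:
  assumes G: "G \<subseteq> all_edges n" and x: "\<And>j. j < q \<Longrightarrow> x j < q"
  shows "card {h \<in> (\<Pi>\<^sub>E i\<in>{..<r}. onto_labellings q x n G). inj_on (block_tuple q x n \<circ> h) {..<r}}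
    = card {F \<in> distinct_families n. \<forall>i<r. valid_labelling q x n G (\<lambda>v. F v i)}"
proof (rule bij_betw_same_card)
  let ?H = "{h \<in> (\<Pi>\<^sub>E i\<in>{..<r}. onto_labellings q x n G). inj_on (block_tuple q x n \<circ> h) {..<r}}"
  let ?D = "{F \<in> distinct_families n. \<forall>i<r. valid_labelling q x n G (\<lambda>v. F v i)}"
  let ?to = "\<lambda>h. \<lambda>v\<in>{1..n}. \<lambda>i\<in>{..<r}. h i v"
  let ?from = "\<lambda>F. \<lambda>i\<in>{..<r}. \<lambda>v\<in>{1..n}. F v i"
  have inj_iff: "inj_on (block_tuple q x n \<circ> h) {..<r} \<longleftrightarrow> inequivalent n F"
    if h: "\<And>i. i < r \<Longrightarrow> h i \<in> onto_labellings q x n G"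
      and F: "\<And>i v. i < r \<Longrightarrow> v \<in> {1..n} \<Longrightarrow> F v i = h i v" for h F
  proof -
    have "block_tuple q x n (h i) = block_tuple q x n (h j) \<longleftrightarrow>
        (\<exists>\<pi>. bij_betw \<pi> {..<q} {..<q} \<and> (\<forall>v\<in>{1..n}. F v i = \<pi> (F v j)))" if "i < r" "j < r" for i j
      using block_tuple_eq_iff[OF G x h[OF that(1)] h[OF that(2)]] F that by simp
    then show ?thesis unfolding inj_on_def inequivalent_def comp_def by (metis lessThan_iff)
  qed
  show "bij_betw ?to ?H ?D"
  proof (rule bij_betw_byWitness[where f' = ?from])
    show "\<forall>h\<in>?H. ?from (?to h) = h"
    proof
      fix h assume h: "h \<in> ?H"
      then have "h i \<in> extensional {1..n}" if "i < r" for i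
        using that unfolding onto_labellings_def valid_labellings_def by (auto simp: PiE_def Pi_iff)
      then have "(\<lambda>v\<in>{1..n}. h i v) = h i" if "i < r" for i
        using that by (simp add: extensional_restrict)
      then have "?from (?to h) = (\<lambda>i\<in>{..<r}. h i)" by (intro restrict_ext) (auto cong: restrict_cong)
      also have "\<dots> = h" using h by (simp add: PiE_def extensional_restrict)
      finally show "?from (?to h) = h" .
    qed
    show "\<forall>F\<in>?D. ?to (?from F) = F"
    proof
      fix F assume "F \<in> ?D"
      then have F: "F \<in> families n" unfolding distinct_families_def by blast
      then have "F v \<in> extensional {..<r}" if "v \<in> {1..n}" for v
        using familiesD(1)[OF F that] unfolding labels_def by (simp add: PiE_def)
      then have "(\<lambda>i\<in>{..<r}. F v i) = F v" if "v \<in> {1..n}" for v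
        using that by (simp add: extensional_restrict)
      then have "?to (?from F) = (\<lambda>v\<in>{1..n}. F v)" by (intro restrict_ext) (auto cong: restrict_cong)
      also have "\<dots> = F" using F unfolding families_def by (simp add: PiE_def extensional_restrict)
      finally show "?to (?from F) = F" .
    qed
    show "?to ` ?H \<subseteq> ?D"
    proof
      fix F assume "F \<in> ?to ` ?H"
      then obtain h where h: "h \<in> ?H" "F = ?to h" by blast
      have hi: "h i \<in> onto_labellings q x n G" if "i < r" for i using h(1) that by (auto dest: PiE_mem)
      note hD = onto_labellingsD[OF hi]
      have Fv: "F v i = h i v" if "i < r" "v \<in> {1..n}" for i v using that h(2) by simp
      have "F \<in> families n"
      proof -
        have "h i v < q" if "i < r" "v \<in> {1..n}" for i v using hD(2)[OF that(1)] that(2) by auto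
        then show ?thesis unfolding families_def labels_def h(2) by auto
      qed
      moreover have "{..<q} \<subseteq> (\<lambda>v. F v i) ` {1..n}" if "i < r" for i
      proof -
        have "(\<lambda>v. F v i) ` {1..n} = h i ` {1..n}" using Fv[OF that] by (intro image_cong) auto
        then show ?thesis using hD(4)[OF that] by blast
      qed
      moreover have "inequivalent n F" using inj_iff[OF hi Fv] h(1) by simp
      moreover have "valid_labelling q x n G (\<lambda>v. F v i)" if "i < r" for i
        using hD(3)[OF that] valid_labelling_cong[OF G, of "\<lambda>v. F v i" "h i"] Fv[OF that] by simp
      ultimately show "F \<in> ?D" unfolding distinct_families_def by blast
    qed
    show "?from ` ?D \<subseteq> ?H"
    proof
      fix h assume "h \<in> ?from ` ?D"
      then obtain F where F: "F \<in> ?D" "h = ?from F" by blast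
      then have Ff: "F \<in> families n" unfolding distinct_families_def by blast
      have hv: "F v i = h i v" if "i < r" "v \<in> {1..n}" for i v using that F(2) by simp
      have hi: "h i \<in> onto_labellings q x n G" if i: "i < r" for i
      proof -
        have "h i \<in> (\<Pi>\<^sub>E v\<in>{1..n}. {..<q})" using familiesD(2)[OF Ff _ i] i unfolding F(2) by auto
        moreover have "valid_labelling q x n G (h i)"
        proof -
          have "valid_labelling q x n G (\<lambda>v. F v i)" using F(1) i by blast
          then show ?thesis using valid_labelling_cong[OF G, of "\<lambda>v. F v i" "h i"] hv[OF i] by simp
        qed
        moreover have "{..<q} \<subseteq> h i ` {1..n}"
        proof -
          have "(\<lambda>v. F v i) ` {1..n} = h i ` {1..n}" using hv[OF i] by (intro image_cong) auto
          then show ?thesis using F(1) i unfolding distinct_families_def by blast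
        qed
        ultimately show ?thesis unfolding onto_labellings_def valid_labellings_def by blast
      qed
      moreover have "h \<in> extensional {..<r}" using F(2) by simp
      moreover have "inequivalent n F" using F(1) unfolding distinct_families_def by blast
      ultimately show "h \<in> ?H" using inj_iff[OF hi hv] by (auto simp: PiE_def)
    qed
  qed
qed

lemma factorial_moment:
  assumes x: "\<And>j. j < q \<Longrightarrow> x j < q"
  shows "measure_pmf.expectation (random_graph n (1 / 2))
      (\<lambda>G. real (card (block_tuple q x n ` onto_labellings q x n G) choose r))
    = (\<Sum>F\<in>distinct_families n. prob n F) / (real (\<Prod>c<q. fact (card {j \<in> {..<q}. x j = c})) ^ r * fact r)"
proof -
  let ?m = "\<Prod>c<q. fact (card {j \<in> {..<q}. x j = c}) :: nat"
  let ?X = "\<lambda>G. card (block_tuple q x n ` onto_labellings q x n G)"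
  have "real ?m ^ r * fact r * real (?X G choose r) =
      real (card {F \<in> distinct_families n. \<forall>i<r. valid_labelling q x n G (\<lambda>v. F v i)})"
    if G: "G \<in> Pow (all_edges n)" for G
  proof -
    have "finite (onto_labellings q x n G)"
      using finite_valid_labellings unfolding onto_labellings_def by simp
    then have "?m ^ r * (fact r * (?X G choose r)) =
        card {F \<in> distinct_families n. \<forall>i<r. valid_labelling q x n G (\<lambda>v. F v i)}"
      using card_injective_selections[of "onto_labellings q x n G" "block_tuple q x n" ?m r]
        card_block_tuple_fibre[OF _ x] card_distinct_selections[OF _ x] G by simp
    then show ?thesis by (metis (no_types, lifting) mult.assoc of_nat_fact of_nat_mult of_nat_power)
  qed
  then have "(\<Sum>G\<in>Pow (all_edges n). real ?m ^ r * fact r * real (?X G choose r)) =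
      (\<Sum>G\<in>Pow (all_edges n). real (card {F \<in> distinct_families n. \<forall>i<r. valid_labelling q x n G (\<lambda>v. F v i)}))"
    by (rule sum.cong[OF refl])
  then have "real ?m ^ r * fact r * measure_pmf.expectation (random_graph n (1 / 2)) (\<lambda>G. real (?X G choose r))
      = (\<Sum>F\<in>distinct_families n. prob n F)"
    using expected_count_families[of "distinct_families n" n]
    unfolding expectation_random_graph sum_distrib_left[symmetric] by (auto simp: distinct_families_def)
  moreover have "real ?m ^ r * fact r \<noteq> 0" by simp
  ultimately show ?thesis by (simp add: nonzero_eq_divide_eq mult.commute)
qed

end

text \<open>First moment bound with \<open>r = 1\<close>: there \<open>inequivalent\<close> is
  vacuous, so a labelling that misses a label is a sparse family.\<close>

lemma nonsurjective_prob_tendsto_0: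
  assumes q: "q \<ge> 3"
  shows "(\<lambda>n. measure (measure_pmf (random_graph n (1 / 2)))
    {G. valid_labellings q x n G \<noteq> onto_labellings q x n G}) \<longlonglongrightarrow> 0"
proof -
  interpret degree_moments q 1 x by unfold_locales (rule q)
  let ?R = "\<lambda>n. measure_pmf (random_graph n (1 / 2))"
  let ?c = "\<lambda>n G. card {F \<in> sparse_families n. \<forall>i<1. valid_labelling q x n G (\<lambda>v. F v i)}"
  have "measure (?R n) {G. valid_labellings q x n G \<noteq> onto_labellings q x n G}
      \<le> (\<Sum>F\<in>sparse_families n. prob n F)" for n
  proof -
    have "measure (?R n) {G. valid_labellings q x n G \<noteq> onto_labellings q x n G}
        = measure_pmf.expectation (random_graph n (1 / 2)) (indicator {G. valid_labellings q x n G \<noteq> onto_labellings q x n G})"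
      by simp
    also have "\<dots> \<le> measure_pmf.expectation (random_graph n (1 / 2)) (\<lambda>G. real (?c n G))"
      unfolding expectation_random_graph
    proof (intro divide_right_mono sum_mono)
      fix G assume "G \<in> Pow (all_edges n)"
      then have G: "G \<subseteq> all_edges n" by simp
      show "indicator {G. valid_labellings q x n G \<noteq> onto_labellings q x n G} G \<le> real (?c n G)"
      proof (cases "valid_labellings q x n G = onto_labellings q x n G")
        case False
        then obtain f where f: "f \<in> valid_labellings q x n G" "\<not> {..<q} \<subseteq> f ` {1..n}"
          unfolding onto_labellings_def by blast
        define F where "F = (\<lambda>v\<in>{1..n}. \<lambda>i\<in>{..<1::nat}. f v)"
        have Fv: "F v 0 = f v" if "v \<in> {1..n}" for v using that unfolding F_def by simp
        have "F \<in> families n"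
          using f(1) unfolding F_def families_def labels_def valid_labellings_def by (auto simp: PiE_iff)
        moreover have "inequivalent n F" unfolding inequivalent_def by simp
        moreover have "\<not> labels \<subseteq> F ` {1..n}"
        proof
          assume full: "labels \<subseteq> F ` {1..n}"
          have "{..<q} \<subseteq> f ` {1..n}"
          proof
            fix j assume "j \<in> {..<q}"
            then have "(\<lambda>i\<in>{..<1::nat}. j) \<in> labels" unfolding labels_def by auto
            then have "(\<lambda>i\<in>{..<1::nat}. j) \<in> F ` {1..n}" using full by blast
            then obtain v where v: "v \<in> {1..n}" "(\<lambda>i\<in>{..<1::nat}. j) = F v" by (rule imageE)
            then have "j = f v" using Fv[OF v(1)] v(2)[symmetric] by simp
            then show "j \<in> f ` {1..n}" using v(1) by blast
          qed
          then show False using f(2) by blast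
        qed
        ultimately have sparse: "F \<in> sparse_families n" unfolding sparse_families_def by blast
        have "valid_labelling q x n G (\<lambda>v. F v 0)"
          using valid_labelling_cong[OF G, of "\<lambda>v. F v 0" f] Fv f(1) unfolding valid_labellings_def by simp
        then have "F \<in> {F \<in> sparse_families n. \<forall>i<1. valid_labelling q x n G (\<lambda>v. F v i)}"
          using sparse by simp
        moreover have "finite {F \<in> sparse_families n. \<forall>i<1. valid_labelling q x n G (\<lambda>v. F v i)}"
          using finite_families unfolding sparse_families_def by simp
        ultimately have "?c n G > 0" by (intro card_gt_0_iff[THEN iffD2] conjI) blast+
        then show ?thesis using False by simp
      qed simp
    qed simp
    also have "\<dots> = (\<Sum>F\<in>sparse_families n. prob n F)"
      by (rule expected_count_families[OF sparse_subset_families])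
    finally show ?thesis .
  qed
  then show ?thesis
    by (intro Lim_null_comparison[OF _ sparse_families_tendsto_0]) simp
qed

text \<open>\<open>\<phi>\<close> provides the passage to even \<open>n\<close>. Factorial moments
  are computed for the count \<open>?Y\<close> over onto labellings, where all fibres have size
  \<open>m\<close>; the true count \<open>?X\<close> differs from it with vanishing
  probability.\<close>

theorem num_tuples_poisson_limit:
  fixes q :: nat and a :: "nat \<Rightarrow> nat" and \<phi> :: "nat \<Rightarrow> nat" and \<mu> :: real
  assumes q: "q \<ge> 3" and lab: "bij_betw lab {..<q} (part_indices q a)"
    and \<phi>: "filterlim \<phi> at_top sequentially" and \<mu>: "\<mu> > 0"
    and char: "(\<lambda>k. character_sum q (\<lambda>j. fst (lab j)) (\<phi> k)) \<longlonglongrightarrow> of_real \<mu>"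
  shows "weak_conv_m (\<lambda>k. X_law q a (\<phi> k)) (poisson_law (\<mu> / (\<Prod>c = 0..q - 1. fact (a c))))"
proof -
  define x where "x j = fst (lab j)" for j
  define m :: nat where "m = (\<Prod>c<q. fact (card {j \<in> {..<q}. x j = c}))"
  have x: "x j < q" if "j < q" for j using lab_residue[OF lab that] unfolding x_def .
  have m: "real m = (\<Prod>c = 0..q - 1. fact (a c))"
  proof -
    have "card {j \<in> {..<q}. x j = c} = a c" if "c < q" for c
      using bij_betw_same_card[OF bij_betw_label_class[OF lab that]] unfolding x_def by simp
    moreover have "{0..q - 1} = {..<q}" using q by auto
    ultimately show ?thesis unfolding m_def by simp
  qed
  have m0: "m > 0" unfolding m_def by (intro prod_pos) simp
  let ?rate = "\<mu> / real m"
  let ?R = "\<lambda>k. random_graph (\<phi> k) (1 / 2)"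
  let ?X = "\<lambda>k G. card (block_tuple q x (\<phi> k) ` valid_labellings q x (\<phi> k) G)"
  let ?Y = "\<lambda>k G. card (block_tuple q x (\<phi> k) ` onto_labellings q x (\<phi> k) G)"
  have fin: "finite (set_pmf (?R k))" for k
    unfolding random_graph_half using finite_all_edges by (subst set_pmf_of_set) auto
  have "(\<lambda>k. pmf (map_pmf (?Y k) (?R k)) i) \<longlonglongrightarrow> pmf (poisson_pmf ?rate) i" for i
  proof (rule poisson_limit_of_factorial_moments)
    fix r
    interpret degree_moments q r x by unfold_locales (rule q)
    let ?S = "\<lambda>n. \<Sum>F\<in>distinct_families n. prob n F"
    have "(\<lambda>k. (of_real (?S (\<phi> k)) - character_sum q x (\<phi> k) ^ r) + character_sum q x (\<phi> k) ^ r)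
        \<longlonglongrightarrow> 0 + of_real \<mu> ^ r"
      using char unfolding x_def[symmetric]
      by (intro tendsto_add filterlim_compose[OF distinct_families_limit \<phi>] tendsto_power)
    then have "(\<lambda>k. complex_of_real (?S (\<phi> k))) \<longlonglongrightarrow> of_real (\<mu> ^ r)" by simp
    then have "(\<lambda>k. ?S (\<phi> k)) \<longlonglongrightarrow> \<mu> ^ r" unfolding tendsto_of_real_iff .
    then have "(\<lambda>k. ?S (\<phi> k) / (real m ^ r * fact r)) \<longlonglongrightarrow> \<mu> ^ r / (real m ^ r * fact r)"
      using m0 by (intro tendsto_divide tendsto_const) auto
    then show "(\<lambda>k. measure_pmf.expectation (map_pmf (?Y k) (?R k)) (\<lambda>y. real (y choose r)))
        \<longlonglongrightarrow> ?rate ^ r / fact r"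
      using factorial_moment[OF x] unfolding m_def[symmetric] by (simp add: power_divide)
  qed (use fin \<mu> m0 in auto)
  moreover have "(\<lambda>k. measure_pmf.prob (?R k) {G. ?X k G \<noteq> ?Y k G}) \<longlonglongrightarrow> 0"
  proof (rule Lim_null_comparison)
    show "(\<lambda>k. measure_pmf.prob (?R k) {G. valid_labellings q x (\<phi> k) G \<noteq> onto_labellings q x (\<phi> k) G}) \<longlonglongrightarrow> 0"
      by (rule filterlim_compose[OF nonsurjective_prob_tendsto_0[OF q] \<phi>])
    have "measure_pmf.prob (?R k) {G. ?X k G \<noteq> ?Y k G}
        \<le> measure_pmf.prob (?R k) {G. valid_labellings q x (\<phi> k) G \<noteq> onto_labellings q x (\<phi> k) G}" for k
      by (intro measure_pmf.finite_measure_mono) auto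
    then show "\<forall>\<^sub>F k in sequentially. norm (measure_pmf.prob (?R k) {G. ?X k G \<noteq> ?Y k G})
        \<le> measure_pmf.prob (?R k) {G. valid_labellings q x (\<phi> k) G \<noteq> onto_labellings q x (\<phi> k) G}"
      by simp
  qed
  ultimately have "(\<lambda>k. pmf (map_pmf (?X k) (?R k)) i) \<longlonglongrightarrow> pmf (poisson_pmf ?rate) i" for i
    by (rule pmf_limit_transfer)
  then have "weak_conv_m (\<lambda>k. distr (measure_pmf (map_pmf (?X k) (?R k))) borel real)
      (distr (measure_pmf (poisson_pmf ?rate)) borel real)"
    by (rule weak_conv_of_pmf_limit)
  moreover have "distr (measure_pmf (map_pmf (?X k) (?R k))) borel real = X_law q a (\<phi> k)" for k
  proof -
    have "map_pmf (?X k) (?R k) = map_pmf (num_tuples q a (\<phi> k)) (?R k)"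
    proof (rule map_pmf_cong[OF refl])
      fix G assume "G \<in> set_pmf (?R k)"
      then have "G \<subseteq> all_edges (\<phi> k)"
        unfolding random_graph_half using finite_all_edges by (subst (asm) set_pmf_of_set) auto
      then show "?X k G = num_tuples q a (\<phi> k) G" using num_tuples_eq[OF lab] unfolding x_def by simp
    qed
    then have "distr (measure_pmf (map_pmf (?X k) (?R k))) borel real
        = distr (measure_pmf (map_pmf (num_tuples q a (\<phi> k)) (?R k))) borel real"
      by (simp only:)
    also have "\<dots> = X_law q a (\<phi> k)"
      unfolding X_law_def map_pmf_rep_eq by (simp add: distr_distr comp_def)
    finally show ?thesis .
  qed
  ultimately show ?thesis unfolding poisson_law_def m by simp
qed

theorem theorem1p5:
  fixes q :: nat and a :: "nat \<Rightarrow> nat"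
  assumes "q \<ge> 3" and "(\<Sum>x = 0..q - 1. a x) = q"
  shows "let c = (\<Sum>x = 0..q div 2 - 1. a (2 * x)) in
    (odd q \<longrightarrow>
       weak_conv_m (\<lambda>n. X_law q a n) (poisson_law (1 / (\<Prod>x = 0..q - 1. fact (a x))))) \<and>
    (even q \<and> q \<ge> 4 \<and> c > 0 \<longrightarrow>
       weak_conv_m (\<lambda>n. X_law q a n) (poisson_law (2 ^ c / (\<Prod>x = 0..q - 1. fact (a x))))) \<and>
    (even q \<and> q \<ge> 4 \<and> c = 0 \<longrightarrow>
       weak_conv_m (\<lambda>m. X_law q a (2 * m)) (poisson_law (2 / (\<Prod>x = 0..q - 1. fact (a x)))))"
proof -
  have q0: "q > 0" using assms(1) by simp
  have range: "{0..q - 1} = {0..<q}" using q0 by auto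
  have "card (part_indices q a) = q"
    unfolding part_indices_def using assms(2) range by (simp add: card_SigmaI)
  moreover have "finite (part_indices q a)" unfolding part_indices_def by auto
  \<comment> \<open>There are exactly \<open>q\<close> part indices, so labels below
    \<open>q\<close> can number them.\<close>
  ultimately obtain lab where "bij_betw lab {0..<q} (part_indices q a)"
    using ex_bij_betw_nat_finite by metis
  then have lab: "bij_betw lab {..<q} (part_indices q a)" by (simp add: atLeast0LessThan)
  define x where "x j = fst (lab j)" for j
  define c where "c = (\<Sum>i = 0..q div 2 - 1. a (2 * i))"
  have count: "card {j \<in> {..<q}. even (x j)} = c" if even: "even q"
  proof -
    obtain h where h: "q = 2 * h" using even by (elim evenE)
    have img: "{j \<in> {..<q}. even (x j)} = (\<Union>i\<in>{0..q div 2 - 1}. {j \<in> {..<q}. fst (lab j) = 2 * i})"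
    proof (intro equalityI subsetI)
      fix j assume j: "j \<in> {j \<in> {..<q}. even (x j)}"
      then have "x j < q" using lab_residue[OF lab] unfolding x_def by simp
      moreover have "x j = 2 * (x j div 2)" using j by simp
      ultimately have "x j div 2 \<in> {0..q div 2 - 1}" using h by auto
      then show "j \<in> (\<Union>i\<in>{0..q div 2 - 1}. {j \<in> {..<q}. fst (lab j) = 2 * i})"
        using j unfolding x_def by (intro UN_I[of "fst (lab j) div 2"]) auto
    qed (auto simp: x_def)
    have "card {j \<in> {..<q}. even (x j)} = (\<Sum>i\<in>{0..q div 2 - 1}. card {j \<in> {..<q}. fst (lab j) = 2 * i})"
      unfolding img by (rule card_UN_disjoint) auto
    also have "\<dots> = c"
      unfolding c_def
    proof (rule sum.cong[OF refl])
      fix i assume "i \<in> {0..q div 2 - 1}"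
      then have "2 * i < q" using h q0 by auto
      then show "card {j \<in> {..<q}. fst (lab j) = 2 * i} = a (2 * i)"
        using bij_betw_same_card[OF bij_betw_label_class[OF lab]] by simp
    qed
    finally show ?thesis .
  qed
  have "weak_conv_m (\<lambda>n. X_law q a n) (poisson_law (1 / (\<Prod>x = 0..q - 1. fact (a x))))" if "odd q"
    using character_sum_odd[OF that]
    by (intro num_tuples_poisson_limit[OF assms(1) lab filterlim_ident]) simp_all
  moreover have "weak_conv_m (\<lambda>n. X_law q a n) (poisson_law (2 ^ c / (\<Prod>x = 0..q - 1. fact (a x))))"
    if "even q" "c > 0"
  proof (rule num_tuples_poisson_limit[OF assms(1) lab filterlim_ident])
    have "{j \<in> {..<q}. even (x j)} \<noteq> {}" using count[OF that(1)] that(2) by (metis card.empty less_irrefl)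
    then obtain j where "j < q" "even (x j)" by blast
    then show "(\<lambda>n. character_sum q (\<lambda>j. fst (lab j)) n) \<longlonglongrightarrow> of_real (2 ^ c)"
      using character_sum_limit_even_label[OF that(1) q0, of j x] count[OF that(1)] unfolding x_def by simp
  qed simp
  moreover have "weak_conv_m (\<lambda>m. X_law q a (2 * m)) (poisson_law (2 / (\<Prod>x = 0..q - 1. fact (a x))))"
    if "even q" "c = 0"
  proof (rule num_tuples_poisson_limit[OF assms(1) lab])
    show "filterlim (\<lambda>m::nat. 2 * m) at_top at_top"
      by (rule filterlim_subseq) (simp add: strict_mono_def)
    have "{j \<in> {..<q}. even (x j)} = {}" using count[OF that(1)] that(2) by simp
    then show "(\<lambda>m. character_sum q (\<lambda>j. fst (lab j)) (2 * m)) \<longlonglongrightarrow> of_real 2"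
      using character_sum_limit_odd_labels[OF that(1) q0, of x] unfolding x_def by auto
  qed simp
  ultimately show ?thesis unfolding Let_def c_def[symmetric] by blast
qed

end
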